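(* Let $G$ be a finite group. Up to homotopy, an $N_\infty$-operad for $G$ is the data of a set of norm maps $X$, whose elements are symbols $N_K^H$ with $1 \leq K < H \leq G$, satisfying the following rules (and all conjugates thereof, i.e. $N_K^H \in X$ implies $N_{gKg^{-1}}^{gHg^{-1}} \in X$ for all $g \in G$): (Restriction) if $N_K^H \in X$ and $M < H$, then $N_{K\cap M}^{M} \in X$; (Composition) if $N_L^K \in X$ and $N_K^H \in X$, then $N_L^H \in X$. That is, sending an $N_\infty$-operad $\mathcal{O}$ to the set of those $N_K^H$ with $K<H$ and $H/K \in \underline{\mathcal{C}}(H)$, where $\underline{\mathcal{C}}$ is the indexing system determined by $\mathcal{O}$, induces a bijection between homotopy classes of $N_\infty$-operads for $G$ and such sets $X$. In particular, homotopy classes of $N_\infty$-operads can be described as certain subgraphs of the lattice of subgroups of $G$.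
   Context: Identity norms $N_H^H$ are regarded as always present and are not recorded in $X$; thus the restriction rule imposes nothing when $K \cap M = M$. A $G$-operad $\mathcal{O}$ is a symmetric operad in $G$-spaces: a sequence of $(G\times\Sigma_n)$-spaces $\mathcal{O}_n$, $n \geq 0$, with a $G$-fixed identity element $1 \in \mathcal{O}_1$ and $G$-equivariant composition maps $\mathcal{O}_k \times \mathcal{O}_{n_1}\times\cdots\times\mathcal{O}_{n_k} \to \mathcal{O}_{n_1+\cdots+n_k}$ satisfying the usual compatibility conditions with each other and with the symmetric group actions. A family of subgroups of a group is a collection closed under passage to subgroups and conjugation; a universal space for a family $\mathcal{F}$ is a space $E\mathcal{F}$ with action such that $(E\mathcal{F})^H$ is contractible for $H \in \mathcal{F}$ and empty for $H \notin \mathcal{F}$. An $N_\infty$-operad for $G$ is a $G$-operad $\mathcal{O}$ such that (1) $\mathcal{O}_0$ is $G$-contractible; (2) the action of $\Sigma_n$ on $\mathcal{O}_n$ is free; (3) $\mathcal{O}_n$ is a universal space for a family $\mathcal{F}_n(\mathcal{O})$ of subgroups of $G\times\Sigma_n$ containing all subgroups $H \times \{1\}$, $H \leq G$. Weak equivalences of $N_\infty$-operads are maps of $G$-operads which, at each level $n$, induce weak homotopy equivalences on $\Gamma$-fixed points for all $\Gamma \leq G\times\Sigma_n$; homotopy classes of $N_\infty$-operads are isomorphism classes in the resulting homotopy category. Let $\mathcal{S}et$ be the symmetric monoidal coefficient system on the orbit category of $G$ sending $G/H$ to the category of finite $H$-sets with disjoint union. An indexing system is a sub-symmetric monoidal coefficient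 system $\underline{\mathcal{C}}$ of $\mathcal{S}et$ closed under sub-objects and self-induction ($T \in \underline{\mathcal{C}}(K)$ and $H/K \in \underline{\mathcal{C}}(H)$ imply $H\times_K T \in \underline{\mathcal{C}}(H)$). The indexing system determined by an $N_\infty$-operad $\mathcal{O}$ is the one for which a finite $H$-set $T$ with $n$ elements lies in $\underline{\mathcal{C}}(H)$ iff the graph $\{(h,\rho_T(h)) : h \in H\} \leq G\times\Sigma_n$ lies in $\mathcal{F}_n(\mathcal{O})$, where $\rho_T \colon H \to \Sigma_n$ is the action homomorphism of $T$ for some ordering of $T$. It is a known theorem (Blumberg–Hill, Bonventre–Pereira, Gutiérrez–White, Rubin) that this assignment gives an equivalence between the homotopy category of $N_\infty$-operads and the poset of indexing systems. *)

theory Defs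
  imports
    "HOL-Analysis.Analysis"
    "HOL-Algebra.Group_Action"
    "Graph_Theory.Digraph_Component"
begin

section \<open>Spaces with an action of a discrete group\<close>

definition continuous_action ::
  "('h, 'm) monoid_scheme \<Rightarrow> 'a topology \<Rightarrow> ('h \<Rightarrow> 'a \<Rightarrow> 'a) \<Rightarrow> bool" where
  "continuous_action A X act \<longleftrightarrow>
     group_action A (topspace X) act \<and> (\<forall>a \<in> carrier A. continuous_map X X (act a))"

definition fixed_points :: "'h set \<Rightarrow> 'a topology \<Rightarrow> ('h \<Rightarrow> 'a \<Rightarrow> 'a) \<Rightarrow> 'a topology" where
  "fixed_points \<Gamma> X act = subtopology X {x. \<forall>\<gamma> \<in> \<Gamma>. act \<gamma> x = x}"

definition conj_subset :: "('h, 'm) monoid_scheme \<Rightarrow> 'h \<Rightarrow> 'h set \<Rightarrow> 'h set" where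
  "conj_subset A a H = (a <#\<^bsub>A\<^esub> H) #>\<^bsub>A\<^esub> (inv\<^bsub>A\<^esub> a)"

definition subgroup_family :: "('h, 'm) monoid_scheme \<Rightarrow> 'h set set \<Rightarrow> bool" where
  "subgroup_family A F \<longleftrightarrow>
     (\<forall>H \<in> F. subgroup H A) \<and>
     (\<forall>H \<in> F. \<forall>K. subgroup K A \<and> K \<subseteq> H \<longrightarrow> K \<in> F) \<and>
     (\<forall>H \<in> F. \<forall>a \<in> carrier A. conj_subset A a H \<in> F)"

text \<open>The library counts the empty space as contractible, so nonemptiness is stated separately.\<close>

definition universal_space ::
  "('h, 'm) monoid_scheme \<Rightarrow> 'h set set \<Rightarrow> 'a topology \<Rightarrow> ('h \<Rightarrow> 'a \<Rightarrow> 'a) \<Rightarrow> bool" where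
  "universal_space A F X act \<longleftrightarrow>
     continuous_action A X act \<and>
     (\<forall>H. subgroup H A \<longrightarrow>
        (if H \<in> F
         then contractible_space (fixed_points H X act) \<and> topspace (fixed_points H X act) \<noteq> {}
         else topspace (fixed_points H X act) = {}))"

text \<open>Equivariant contractibility: the identity is equivariantly homotopic to an equivariant
  constant map. The value of such a constant map is a fixed point.\<close>

definition equivariantly_contractible ::
  "('h, 'm) monoid_scheme \<Rightarrow> 'a topology \<Rightarrow> ('h \<Rightarrow> 'a \<Rightarrow> 'a) \<Rightarrow> bool" where
  "equivariantly_contractible A X act \<longleftrightarrow>
     (\<exists>c \<in> topspace X.
        homotopic_with
          (\<lambda>k. \<forall>a \<in> carrier A. \<forall>x \<in> topspace X. k (act a x) = act a (k x)) X X id (\<lambda>_. c))"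


section \<open>Weak homotopy equivalences\<close>

definition unit_cube :: "nat \<Rightarrow> (nat \<Rightarrow> real) topology" where
  "unit_cube n = product_topology (\<lambda>_. top_of_set {0..1}) {..<n}"

definition cube_boundary :: "nat \<Rightarrow> (nat \<Rightarrow> real) set" where
  "cube_boundary n = {t \<in> topspace (unit_cube n). \<exists>i<n. t i = 0 \<or> t i = 1}"

definition cube_maps :: "nat \<Rightarrow> 'a topology \<Rightarrow> 'a \<Rightarrow> ((nat \<Rightarrow> real) \<Rightarrow> 'a) set" where
  "cube_maps n X x = {p. continuous_map (unit_cube n) X p \<and> p ` cube_boundary n \<subseteq> {x}}"

definition cube_class ::
  "nat \<Rightarrow> 'a topology \<Rightarrow> 'a \<Rightarrow> ((nat \<Rightarrow> real) \<Rightarrow> 'a) \<Rightarrow> ((nat \<Rightarrow> real) \<Rightarrow> 'a) set" where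
  "cube_class n X x p =
     {q \<in> cube_maps n X x.
        homotopic_with (\<lambda>k. k ` cube_boundary n \<subseteq> {x}) (unit_cube n) X p q}"

text \<open>The underlying set of the n-th homotopy group. The 0-cube is a point with empty boundary,
  so for \<open>n = 0\<close> this is the set of path components.\<close>

definition homotopy_group :: "nat \<Rightarrow> 'a topology \<Rightarrow> 'a \<Rightarrow> ((nat \<Rightarrow> real) \<Rightarrow> 'a) set set" where
  "homotopy_group n X x = cube_class n X x ` cube_maps n X x"

definition homotopy_group_map ::
  "nat \<Rightarrow> 'b topology \<Rightarrow> ('a \<Rightarrow> 'b) \<Rightarrow> 'a
    \<Rightarrow> ((nat \<Rightarrow> real) \<Rightarrow> 'a) set \<Rightarrow> ((nat \<Rightarrow> real) \<Rightarrow> 'b) set" where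
  "homotopy_group_map n Y f x c = (\<Union>p \<in> c. cube_class n Y (f x) (f \<circ> p))"

text \<open>The induced maps are homomorphisms for \<open>n \<ge> 1\<close>, so bijectivity is enough. The emptiness
  clause is the part of bijectivity on path components that no base point sees.\<close>

definition weak_homotopy_equivalence :: "'a topology \<Rightarrow> 'b topology \<Rightarrow> ('a \<Rightarrow> 'b) \<Rightarrow> bool" where
  "weak_homotopy_equivalence X Y f \<longleftrightarrow>
     continuous_map X Y f \<and>
     (topspace X = {} \<longrightarrow> topspace Y = {}) \<and>
     (\<forall>n. \<forall>x \<in> topspace X.
        bij_betw (homotopy_group_map n Y f x) (homotopy_group n X x) (homotopy_group n Y (f x)))"


section \<open>Operads in spaces with an action of a group\<close>

text \<open>The symmetric group on \<open>n\<close> letters permutes \<open>0, \<dots>, n - 1\<close>. It acts on operads from the left;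
  a right action is converted by \<open>\<sigma> \<cdot> x = x \<cdot> \<sigma>\<^sup>-\<^sup>1\<close>. On functions of \<open>n\<close> variables the left
  action is \<open>(\<sigma> \<cdot> f) (x\<^sub>0, \<dots>, x\<^sub>n\<^sub>-\<^sub>1) = f (x\<^sub>\<sigma>\<^sub>0, \<dots>, x\<^sub>\<sigma>\<^sub>(\<^sub>n\<^sub>-\<^sub>1\<^sub>))\<close>.\<close>

abbreviation Sym :: "nat \<Rightarrow> (nat \<Rightarrow> nat) monoid" where
  "Sym n \<equiv> BijGroup {..<n}"

text \<open>A list \<open>ns\<close> cuts \<open>{..<sum_list ns}\<close> into consecutive blocks, the \<open>i\<close>-th of length
  \<open>ns ! i\<close>.\<close>

definition block_start :: "nat list \<Rightarrow> nat \<Rightarrow> nat" where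
  "block_start ns i = sum_list (take i ns)"

definition block_of :: "nat list \<Rightarrow> nat \<Rightarrow> nat" where
  "block_of ns j = (LEAST i. j < block_start ns (Suc i))"

definition permute_list_by :: "(nat \<Rightarrow> nat) \<Rightarrow> 'b list \<Rightarrow> 'b list" where
  "permute_list_by \<sigma> xs = map (\<lambda>i. xs ! \<sigma> i) [0..<length xs]"

text \<open>\<open>block_perm ns \<sigma>\<close> maps the \<open>i\<close>-th block of the permuted list of lengths identically onto the
  \<open>\<sigma> i\<close>-th block of \<open>ns\<close>.\<close>

definition block_perm :: "nat list \<Rightarrow> (nat \<Rightarrow> nat) \<Rightarrow> nat \<Rightarrow> nat" where
  "block_perm ns \<sigma> =
     (\<lambda>j \<in> {..<sum_list ns}.
        let ms = permute_list_by \<sigma> ns; i = block_of ms j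
        in block_start ns (\<sigma> i) + (j - block_start ms i))"

definition block_sum :: "nat list \<Rightarrow> (nat \<Rightarrow> nat \<Rightarrow> nat) \<Rightarrow> nat \<Rightarrow> nat" where
  "block_sum ns \<tau> =
     (\<lambda>j \<in> {..<sum_list ns}.
        let i = block_of ns j in block_start ns i + \<tau> i (j - block_start ns i))"

definition block_slice :: "nat list \<Rightarrow> 'b list \<Rightarrow> nat \<Rightarrow> 'b list" where
  "block_slice ns xs i = take (ns ! i) (drop (block_start ns i) xs)"

text \<open>\<open>ocomp P [n\<^sub>0, \<dots>, n\<^sub>k\<^sub>-\<^sub>1] x y\<close> is the composite of the \<open>k\<close>-ary operation \<open>x\<close> with the
  \<open>n\<^sub>i\<close>-ary operations \<open>y i\<close>.\<close>

record ('g, 'a) operad_data =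
  ospace :: "nat \<Rightarrow> 'a topology"
  oact :: "nat \<Rightarrow> 'g \<times> (nat \<Rightarrow> nat) \<Rightarrow> 'a \<Rightarrow> 'a"
  ounit :: 'a
  ocomp :: "nat list \<Rightarrow> 'a \<Rightarrow> (nat \<Rightarrow> 'a) \<Rightarrow> 'a"

abbreviation ops :: "('g, 'a) operad_data \<Rightarrow> nat \<Rightarrow> 'a set" where
  "ops P n \<equiv> topspace (ospace P n)"

abbreviation inputs :: "('g, 'a) operad_data \<Rightarrow> nat list \<Rightarrow> (nat \<Rightarrow> 'a) set" where
  "inputs P ns \<equiv> (\<Pi>\<^sub>E i \<in> {..<length ns}. ops P (ns ! i))"

abbreviation gact :: "('g, 'a) operad_data \<Rightarrow> nat \<Rightarrow> 'g \<Rightarrow> 'a \<Rightarrow> 'a" where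
  "gact P n g \<equiv> oact P n (g, \<one>\<^bsub>Sym n\<^esub>)"

abbreviation sact ::
  "('g, 'm) monoid_scheme \<Rightarrow> ('g, 'a) operad_data \<Rightarrow> nat \<Rightarrow> (nat \<Rightarrow> nat) \<Rightarrow> 'a \<Rightarrow> 'a" where
  "sact G P n \<sigma> \<equiv> oact P n (\<one>\<^bsub>G\<^esub>, \<sigma>)"

locale G_operad = group G for G (structure) and P :: "('g, 'a) operad_data" +
  assumes action: "\<And>n. continuous_action (G \<times>\<times> Sym n) (ospace P n) (oact P n)"
    and unit_closed: "ounit P \<in> ops P 1"
    and unit_fixed: "\<And>g. g \<in> carrier G \<Longrightarrow> gact P 1 g (ounit P) = ounit P"
    and comp_continuous:
      "\<And>ns. continuous_map
         (prod_topology (ospace P (length ns))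
            (product_topology (\<lambda>i. ospace P (ns ! i)) {..<length ns}))
         (ospace P (sum_list ns)) (\<lambda>(x, y). ocomp P ns x y)"
    and comp_equivariant:
      "\<And>g ns x y. g \<in> carrier G \<Longrightarrow> x \<in> ops P (length ns) \<Longrightarrow> y \<in> inputs P ns \<Longrightarrow>
         gact P (sum_list ns) g (ocomp P ns x y) =
         ocomp P ns (gact P (length ns) g x) (\<lambda>i \<in> {..<length ns}. gact P (ns ! i) g (y i))"
    and unit_left:
      "\<And>n x. x \<in> ops P n \<Longrightarrow> ocomp P [n] (ounit P) (\<lambda>i \<in> {..<1}. x) = x"
    and unit_right:
      "\<And>n x. x \<in> ops P n \<Longrightarrow> ocomp P (replicate n 1) x (\<lambda>i \<in> {..<n}. ounit P) = x"
    and comp_assoc: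
      "\<And>ns ms x y z.
         x \<in> ops P (length ns) \<Longrightarrow> y \<in> inputs P ns \<Longrightarrow>
         length ms = sum_list ns \<Longrightarrow> z \<in> inputs P ms \<Longrightarrow>
         ocomp P ms (ocomp P ns x y) z =
         ocomp P (map (\<lambda>i. sum_list (block_slice ns ms i)) [0..<length ns]) x
           (\<lambda>i \<in> {..<length ns}.
              ocomp P (block_slice ns ms i) (y i) (\<lambda>r \<in> {..<ns ! i}. z (block_start ns i + r)))"
    and comp_outer_symmetry:
      "\<And>ns \<sigma> x y.
         \<sigma> \<in> carrier (Sym (length ns)) \<Longrightarrow> x \<in> ops P (length ns) \<Longrightarrow> y \<in> inputs P ns \<Longrightarrow>
         ocomp P ns (sact G P (length ns) \<sigma> x) y =
         sact G P (sum_list ns) (block_perm ns \<sigma>)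
           (ocomp P (permute_list_by \<sigma> ns) x (\<lambda>i \<in> {..<length ns}. y (\<sigma> i)))"
    and comp_inner_symmetry:
      "\<And>ns \<tau> x y.
         (\<And>i. i < length ns \<Longrightarrow> \<tau> i \<in> carrier (Sym (ns ! i))) \<Longrightarrow>
         x \<in> ops P (length ns) \<Longrightarrow> y \<in> inputs P ns \<Longrightarrow>
         ocomp P ns x (\<lambda>i \<in> {..<length ns}. sact G P (ns ! i) (\<tau> i) (y i)) =
         sact G P (sum_list ns) (block_sum ns \<tau>) (ocomp P ns x y)"

text \<open>Operad maps are extensional, so that equality of maps is equality on the spaces.\<close>

definition operad_maps ::
  "('g, 'm) monoid_scheme \<Rightarrow> ('g, 'a) operad_data \<Rightarrow> ('g, 'b) operad_data
    \<Rightarrow> (nat \<Rightarrow> 'a \<Rightarrow> 'b) set" where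
  "operad_maps G P Q =
     {\<phi>. (\<forall>n. \<phi> n \<in> extensional (ops P n) \<and> continuous_map (ospace P n) (ospace Q n) (\<phi> n)) \<and>
         (\<forall>n. \<forall>a \<in> carrier (G \<times>\<times> Sym n). \<forall>x \<in> ops P n. \<phi> n (oact P n a x) = oact Q n a (\<phi> n x)) \<and>
         \<phi> 1 (ounit P) = ounit Q \<and>
         (\<forall>ns. \<forall>x \<in> ops P (length ns). \<forall>y \<in> inputs P ns.
            \<phi> (sum_list ns) (ocomp P ns x y) =
            ocomp Q ns (\<phi> (length ns) x) (\<lambda>i \<in> {..<length ns}. \<phi> (ns ! i) (y i)))}"

definition operad_weqs ::
  "('g, 'm) monoid_scheme \<Rightarrow> ('g, 'a) operad_data \<Rightarrow> ('g, 'b) operad_data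
    \<Rightarrow> (nat \<Rightarrow> 'a \<Rightarrow> 'b) set" where
  "operad_weqs G P Q =
     {\<phi> \<in> operad_maps G P Q.
        \<forall>n \<Gamma>. subgroup \<Gamma> (G \<times>\<times> Sym n) \<longrightarrow>
          weak_homotopy_equivalence
            (fixed_points \<Gamma> (ospace P n) (oact P n)) (fixed_points \<Gamma> (ospace Q n) (oact Q n)) (\<phi> n)}"

definition operad_id :: "('g, 'a) operad_data \<Rightarrow> nat \<Rightarrow> 'a \<Rightarrow> 'a" where
  "operad_id P = (\<lambda>n. \<lambda>x \<in> ops P n. x)"

definition operad_map_comp ::
  "('g, 'a) operad_data \<Rightarrow> (nat \<Rightarrow> 'b \<Rightarrow> 'c) \<Rightarrow> (nat \<Rightarrow> 'a \<Rightarrow> 'b) \<Rightarrow> nat \<Rightarrow> 'a \<Rightarrow> 'c" where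
  "operad_map_comp P \<psi> \<phi> = (\<lambda>n. compose (ops P n) (\<psi> n) (\<phi> n))"


section \<open>N-infinity operads\<close>

locale N_infinity_operad = G_operad +
  assumes nullary_contractible: "equivariantly_contractible G (ospace P 0) (gact P 0)"
    and free:
      "\<And>n \<sigma> x. \<sigma> \<in> carrier (Sym n) \<Longrightarrow> x \<in> ops P n \<Longrightarrow> sact G P n \<sigma> x = x \<Longrightarrow> \<sigma> = \<one>\<^bsub>Sym n\<^esub>"
    and universal:
      "\<And>n. \<exists>F. subgroup_family (G \<times>\<times> Sym n) F \<and>
         universal_space (G \<times>\<times> Sym n) F (ospace P n) (oact P n) \<and>
         (\<forall>H. subgroup H G \<longrightarrow> H \<times> {\<one>\<^bsub>Sym n\<^esub>} \<in> F)"

definition operad_family ::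
  "('g, 'm) monoid_scheme \<Rightarrow> ('g, 'a) operad_data \<Rightarrow> nat \<Rightarrow> ('g \<times> (nat \<Rightarrow> nat)) set set" where
  "operad_family G P n =
     (THE F. subgroup_family (G \<times>\<times> Sym n) F \<and>
        universal_space (G \<times>\<times> Sym n) F (ospace P n) (oact P n))"

text \<open>The homotopy category: the localization at the weak equivalences, with morphisms the zigzags
  modulo the congruence that respects identities and composition and makes weak equivalences
  invertible. \<open>Forward P \<phi> Q\<close> is a map \<open>\<phi>\<close> from \<open>P\<close> to \<open>Q\<close>; \<open>Backward P \<phi> Q\<close> is the formal
  inverse, from \<open>P\<close> to \<open>Q\<close>, of a weak equivalence \<open>\<phi>\<close> from \<open>Q\<close> to \<open>P\<close>.\<close>

datatype ('o, 'f) arrow = Forward 'o 'f 'o | Backward 'o 'f 'o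

inductive zigzag ::
  "('g, 'm) monoid_scheme \<Rightarrow> ('g, 'a) operad_data
    \<Rightarrow> (('g, 'a) operad_data, nat \<Rightarrow> 'a \<Rightarrow> 'a) arrow list \<Rightarrow> ('g, 'a) operad_data \<Rightarrow> bool"
  for G :: "('g, 'm) monoid_scheme" where
  Nil: "N_infinity_operad G P \<Longrightarrow> zigzag G P [] P"
| Forward: "N_infinity_operad G P \<Longrightarrow> \<phi> \<in> operad_maps G P Q \<Longrightarrow> zigzag G Q p R \<Longrightarrow>
    zigzag G P (Forward P \<phi> Q # p) R"
| Backward: "N_infinity_operad G P \<Longrightarrow> \<phi> \<in> operad_weqs G Q P \<Longrightarrow> zigzag G Q p R \<Longrightarrow>
    zigzag G P (Backward P \<phi> Q # p) R"

inductive zigzag_eq ::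
  "('g, 'm) monoid_scheme \<Rightarrow> ('g, 'a) operad_data \<Rightarrow> ('g, 'a) operad_data
    \<Rightarrow> (('g, 'a) operad_data, nat \<Rightarrow> 'a \<Rightarrow> 'a) arrow list
    \<Rightarrow> (('g, 'a) operad_data, nat \<Rightarrow> 'a \<Rightarrow> 'a) arrow list \<Rightarrow> bool"
  for G :: "('g, 'm) monoid_scheme" where
  refl: "zigzag G P p Q \<Longrightarrow> zigzag_eq G P Q p p"
| sym: "zigzag_eq G P Q p q \<Longrightarrow> zigzag_eq G P Q q p"
| trans: "zigzag_eq G P Q p q \<Longrightarrow> zigzag_eq G P Q q r \<Longrightarrow> zigzag_eq G P Q p r"
| append: "zigzag_eq G P Q p p' \<Longrightarrow> zigzag_eq G Q R q q' \<Longrightarrow> zigzag_eq G P R (p @ q) (p' @ q')"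
| ident: "N_infinity_operad G P \<Longrightarrow> zigzag_eq G P P [Forward P (operad_id P) P] []"
| comp: "N_infinity_operad G P \<Longrightarrow> N_infinity_operad G Q \<Longrightarrow> N_infinity_operad G R \<Longrightarrow>
    \<phi> \<in> operad_maps G P Q \<Longrightarrow> \<psi> \<in> operad_maps G Q R \<Longrightarrow>
    zigzag_eq G P R [Forward P \<phi> Q, Forward Q \<psi> R] [Forward P (operad_map_comp P \<psi> \<phi>) R]"
| inverse_right: "N_infinity_operad G P \<Longrightarrow> N_infinity_operad G Q \<Longrightarrow> \<phi> \<in> operad_weqs G P Q \<Longrightarrow>
    zigzag_eq G P P [Forward P \<phi> Q, Backward Q \<phi> P] []"
| inverse_left: "N_infinity_operad G P \<Longrightarrow> N_infinity_operad G Q \<Longrightarrow> \<phi> \<in> operad_weqs G P Q \<Longrightarrow>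
    zigzag_eq G Q Q [Backward Q \<phi> P, Forward P \<phi> Q] []"

definition homotopy_iso :: "('g, 'm) monoid_scheme \<Rightarrow> ('g, 'a) operad_data rel" where
  "homotopy_iso G =
     {(P, Q). \<exists>p q. zigzag G P p Q \<and> zigzag G Q q P \<and>
        zigzag_eq G P P (p @ q) [] \<and> zigzag_eq G Q Q (q @ p) []}"

text \<open>The points of all spaces of an operad lie in one type \<open>'a\<close>, which serves as the universe.
  Statements about all homotopy classes need \<open>'a\<close> to have at least the cardinality of the
  continuum, so that the expected universal spaces exist.\<close>

definition homotopy_classes :: "('g, 'm) monoid_scheme \<Rightarrow> ('g, 'a) operad_data set set" where
  "homotopy_classes G = {P. N_infinity_operad G P} // homotopy_iso G"


section \<open>Finite sets with a group action and indexing systems\<close>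

type_synonym ('g, 'b) hset = "'b set \<times> ('g \<Rightarrow> 'b \<Rightarrow> 'b)"

definition finite_hset :: "('g, 'm) monoid_scheme \<Rightarrow> 'g set \<Rightarrow> ('g, 'b) hset \<Rightarrow> bool" where
  "finite_hset G H T \<longleftrightarrow> finite (fst T) \<and> group_action (G\<lparr>carrier := H\<rparr>) (fst T) (snd T)"

definition hset_iso :: "'g set \<Rightarrow> ('g, 'b) hset \<Rightarrow> ('g, 'c) hset \<Rightarrow> bool" where
  "hset_iso H S T \<longleftrightarrow>
     (\<exists>f. bij_betw f (fst S) (fst T) \<and> (\<forall>h \<in> H. \<forall>x \<in> fst S. f (snd S h x) = snd T h (f x)))"

definition hset_coprod :: "('g, 'b) hset \<Rightarrow> ('g, 'c) hset \<Rightarrow> ('g, 'b + 'c) hset" where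
  "hset_coprod S T = (fst S <+> fst T, \<lambda>h. map_sum (snd S h) (snd T h))"

definition coset_hset :: "('g, 'm) monoid_scheme \<Rightarrow> 'g set \<Rightarrow> 'g set \<Rightarrow> ('g, 'g set) hset" where
  "coset_hset G H K =
     (let E = (\<lambda>h. h <#\<^bsub>G\<^esub> K) ` H in (E, \<lambda>h. \<lambda>A \<in> E. h <#\<^bsub>G\<^esub> A))"

text \<open>The induced set \<open>H \<times>\<^sub>K T\<close>, the quotient of \<open>H \<times> T\<close> by \<open>(h k, t) \<sim> (h, k t)\<close>.\<close>

definition induced_hset ::
  "('g, 'm) monoid_scheme \<Rightarrow> 'g set \<Rightarrow> 'g set \<Rightarrow> ('g, 'b) hset \<Rightarrow> ('g, ('g \<times> 'b) set) hset" where
  "induced_hset G H K T =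
     (let E = (H \<times> fst T) // {((h \<otimes>\<^bsub>G\<^esub> k, t), (h, snd T k t)) | h k t. h \<in> H \<and> k \<in> K \<and> t \<in> fst T}
      in (E, \<lambda>h. \<lambda>A \<in> E. (\<lambda>(h', t). (h \<otimes>\<^bsub>G\<^esub> h', t)) ` A))"

text \<open>The pullback of an action along \<open>k \<mapsto> a\<^sup>-\<^sup>1 k a\<close>. For \<open>a\<^sup>-\<^sup>1 K a \<subseteq> H\<close> this is the functor from
  \<open>H\<close>-sets to \<open>K\<close>-sets belonging to the morphism \<open>G/K \<rightarrow> G/H\<close>, \<open>g K \<mapsto> g a H\<close>, and every morphism
  of the orbit category has this form.\<close>

definition hset_pullback ::
  "('g, 'm) monoid_scheme \<Rightarrow> 'g \<Rightarrow> ('g, 'b) hset \<Rightarrow> ('g, 'b) hset" where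
  "hset_pullback G a T = (fst T, \<lambda>k. snd T (inv\<^bsub>G\<^esub> a \<otimes>\<^bsub>G\<^esub> k \<otimes>\<^bsub>G\<^esub> a))"

text \<open>Since every finite set with an action is isomorphic to one whose points are natural numbers,
  coefficient systems of such sets are represented by collections of these, closed under
  isomorphism. Membership of arbitrary sets with an action is up to isomorphism.\<close>

type_synonym 'g coeff_system = "'g set \<Rightarrow> ('g, nat) hset set"

definition hset_in :: "'g coeff_system \<Rightarrow> 'g set \<Rightarrow> ('g, 'b) hset \<Rightarrow> bool" where
  "hset_in \<C> H T \<longleftrightarrow> (\<exists>S \<in> \<C> H. hset_iso H S T)"

text \<open>Full and replete symmetric monoidal sub-coefficient systems of the system of finite sets,
  containing the trivial orbits, and closed under sub-objects and self-induction.\<close>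

locale indexing_system = group G for G (structure) and \<C> :: "'g coeff_system" +
  assumes finite_sets: "\<And>H T. subgroup H G \<Longrightarrow> T \<in> \<C> H \<Longrightarrow> finite_hset G H T"
    and replete:
      "\<And>H S T. subgroup H G \<Longrightarrow> S \<in> \<C> H \<Longrightarrow> finite_hset G H T \<Longrightarrow> hset_iso H S T \<Longrightarrow> T \<in> \<C> H"
    and pullback:
      "\<And>H K a T. subgroup H G \<Longrightarrow> subgroup K G \<Longrightarrow> a \<in> carrier G \<Longrightarrow>
         conj_subset G (inv a) K \<subseteq> H \<Longrightarrow> T \<in> \<C> H \<Longrightarrow> hset_pullback G a T \<in> \<C> K"
    and empty: "\<And>H T. subgroup H G \<Longrightarrow> finite_hset G H T \<Longrightarrow> fst T = {} \<Longrightarrow> T \<in> \<C> H"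
    and coprod: "\<And>H S T. subgroup H G \<Longrightarrow> S \<in> \<C> H \<Longrightarrow> T \<in> \<C> H \<Longrightarrow> hset_in \<C> H (hset_coprod S T)"
    and trivial_orbit: "\<And>H. subgroup H G \<Longrightarrow> hset_in \<C> H (coset_hset G H H)"
    and sub_object:
      "\<And>H S T. subgroup H G \<Longrightarrow> T \<in> \<C> H \<Longrightarrow> finite_hset G H S \<Longrightarrow> fst S \<subseteq> fst T \<Longrightarrow>
         (\<And>h x. h \<in> H \<Longrightarrow> x \<in> fst S \<Longrightarrow> snd S h x = snd T h x) \<Longrightarrow> S \<in> \<C> H"
    and self_induction:
      "\<And>H K T. subgroup H G \<Longrightarrow> subgroup K G \<Longrightarrow> K \<subseteq> H \<Longrightarrow> T \<in> \<C> K \<Longrightarrow>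
         hset_in \<C> H (coset_hset G H K) \<Longrightarrow> hset_in \<C> H (induced_hset G H K T)"

text \<open>\<open>\<rho>\<close> is the action homomorphism of \<open>T\<close> for an ordering of its \<open>n\<close> points.\<close>

definition operad_indexing_system ::
  "('g, 'm) monoid_scheme \<Rightarrow> ('g, 'a) operad_data \<Rightarrow> 'g coeff_system" where
  "operad_indexing_system G P H =
     {T. finite_hset G H T \<and>
         (\<exists>n \<rho>. finite_hset G H ({..<n}, \<rho>) \<and> hset_iso H T ({..<n}, \<rho>) \<and>
            {(h, \<rho> h) | h. h \<in> H} \<in> operad_family G P n)}"


section \<open>Sets of norm maps\<close>

text \<open>The norm symbol from \<open>K\<close> to \<open>H\<close> is the pair \<open>(K, H)\<close>.\<close>

definition norm_symbols :: "('g, 'm) monoid_scheme \<Rightarrow> ('g set \<times> 'g set) set" where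
  "norm_symbols G = {(K, H). subgroup K G \<and> subgroup H G \<and> K \<subset> H}"

text \<open>Identity norms are not recorded, so restriction imposes nothing when \<open>K \<inter> M = M\<close>.\<close>

definition norm_system :: "('g, 'm) monoid_scheme \<Rightarrow> ('g set \<times> 'g set) set \<Rightarrow> bool" where
  "norm_system G X \<longleftrightarrow>
     X \<subseteq> norm_symbols G \<and>
     (\<forall>K H g. (K, H) \<in> X \<and> g \<in> carrier G \<longrightarrow> (conj_subset G g K, conj_subset G g H) \<in> X) \<and>
     (\<forall>K H M. (K, H) \<in> X \<and> subgroup M G \<and> M \<subset> H \<and> K \<inter> M \<noteq> M \<longrightarrow> (K \<inter> M, M) \<in> X) \<and>
     (\<forall>L K H. (L, K) \<in> X \<and> (K, H) \<in> X \<longrightarrow> (L, H) \<in> X)"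

definition operad_norms ::
  "('g, 'm) monoid_scheme \<Rightarrow> ('g, 'a) operad_data \<Rightarrow> ('g set \<times> 'g set) set" where
  "operad_norms G P =
     {(K, H) \<in> norm_symbols G. hset_in (operad_indexing_system G P) H (coset_hset G H K)}"

definition norm_digraph ::
  "('g, 'm) monoid_scheme \<Rightarrow> ('g set \<times> 'g set) set \<Rightarrow> ('g set, 'g set \<times> 'g set) pre_digraph" where
  "norm_digraph G X = \<lparr>verts = {H. subgroup H G}, arcs = X, tail = fst, head = snd\<rparr>"

definition subgroup_lattice_digraph ::
  "('g, 'm) monoid_scheme \<Rightarrow> ('g set, 'g set \<times> 'g set) pre_digraph" where
  "subgroup_lattice_digraph G = norm_digraph G (norm_symbols G)"

end

theory Submission
  imports Defs
begin

text \<open>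
  Call an \<open>H\<close>-set admissible if the graph of its action homomorphism fixes an operation. If
  \<open>E \<rightarrow> B\<close> is equivariant, \<open>B\<close> is admissible for \<open>H\<close>, and over each orbit of \<open>B\<close> some fibre is
  admissible for the stabilizer of its base point, then \<open>E\<close> is admissible: translate the operations
  of these fibres to the other fibres and plug them into an operation fixed by the graph of \<open>B\<close>.
  Coproducts, sub-objects (where the fibres have at most one point), self-induction and the
  composition of norms are instances. Splitting a set into orbits shows that an operad and its norms
  determine the same families.

  No separation condition is imposed on the spaces, so they may be indiscrete. A nonempty indiscrete
  space is contractible and every function into it is continuous. Since maps between nonempty
  contractible spaces are weak equivalences, operads \<open>P\<close> and \<open>Q\<close> with the same norms are connected
  by weak equivalences through \<open>P\<close>, \<open>Q\<close> and \<open>P \<times> Q\<close> with indiscrete topologies.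

  A norm system is realized by an operad of trees. A leaf is described by the word of the edges on
  its path from the root, composition concatenates words, and the edges that leave a node are points
  of orbits \<open>H/K\<close> with a norm from \<open>K\<close> to \<open>H\<close>. A subgroup acts on the leaves with stabilizers that
  arise from such \<open>K\<close> by restriction and composition.
\<close>

section \<open>Indiscrete spaces\<close>

text \<open>All operads have their points in the one type \<open>'a\<close>, whereas products and
  trees live on pairs and on families of words. They are moved into \<open>'a\<close> along
  injections. The operad axioms are checked by hand only for words; the other operads that are built
  here inherit them through \<open>G_operad_pulled_back\<close>.

  An indiscrete product admits every function into it, but its projection to \<open>P\<close> need
  not be continuous. Hence both ends of the chain
  \<open>P -> P_ind <- (P x Q)_ind -> Q_ind <- Q\<close> are made indiscrete as well.

  Weak equivalences are tested on homotopy sets with base points, while a contraction may move the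
  base point. Homotopies of cubes relative to the boundary have to be manufactured from it.

  Freeness is what makes the elementwise definition of admissibility work: the permutation that
  accompanies a group element is then unique, so these permutations form a homomorphism.

  Identity norms are absent from norm systems but present among admissible orbits, which is why the
  alternative \<open>K = H\<close> accompanies membership in \<open>X\<close> throughout.\<close>

definition indiscrete :: "'a set \<Rightarrow> 'a topology" where
  "indiscrete S = topology (\<lambda>U. U = {} \<or> U = S)"

lemma openin_indiscrete: "openin (indiscrete S) U \<longleftrightarrow> U = {} \<or> U = S"
proof -
  have "istopology (\<lambda>U. U = {} \<or> U = S)"
    unfolding istopology_def by (auto; blast)
  then show ?thesis
    by (simp add: indiscrete_def)
qed

lemma topspace_indiscrete [simp]: "topspace (indiscrete S) = S"
  by (auto simp: topspace_def openin_indiscrete)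

lemma continuous_map_indiscrete [simp]:
  "continuous_map X (indiscrete S) f \<longleftrightarrow> f \<in> topspace X \<rightarrow> S"
proof -
  have "f \<in> topspace X \<rightarrow> S \<Longrightarrow> {x \<in> topspace X. f x \<in> S} = topspace X"
    by auto
  then show ?thesis
    by (auto simp: continuous_map_def openin_indiscrete)
qed

lemma subtopology_indiscrete: "subtopology (indiscrete S) A = indiscrete (S \<inter> A)"
  by (auto simp: topology_eq openin_subtopology openin_indiscrete)

text \<open>Every function into the space is continuous, so the homotopy may jump: it is the
  identity at time 0 and constant at all later times. The empty space counts as contractible and is
  treated separately.\<close>

lemma contractible_indiscrete: "contractible_space (indiscrete S)"
proof (cases "S = {}")
  case False
  then obtain a where "a \<in> S"
    by blast
  then have "homotopic_with (\<lambda>_. True) (indiscrete S) (indiscrete S) id (\<lambda>_. a)"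
    unfolding homotopic_with_def
    by (intro exI[of _ "\<lambda>(t, x). if t = (0::real) then x else a"]) auto
  then show ?thesis
    by (auto simp: contractible_space_def)
next
  case True
  then have "indiscrete S = trivial_topology"
    by (metis null_topspace_iff_trivial topspace_indiscrete)
  then show ?thesis
    by simp
qed

section \<open>Weak equivalences of contractible spaces\<close>

definition clamp01 :: "real \<Rightarrow> real" where
  "clamp01 r = max 0 (min 1 r)"

text \<open>Stretching by the factor \<open>1 + s\<close> about the centre 1/2 of every coordinate,
  followed by clamping. At \<open>s = 1\<close> the coordinates below 1/4 and above 3/4 are pushed
  to 0 and 1.\<close>

definition collar :: "nat \<Rightarrow> real \<Rightarrow> (nat \<Rightarrow> real) \<Rightarrow> nat \<Rightarrow> real" where
  "collar n s u = (\<lambda>i \<in> {..<n}. clamp01 ((1 + s) * u i - s / 2))"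

text \<open>Vanishes on the boundary. The factor 4 makes it at least 1 where all coordinates lie
  between 1/4 and 3/4, that is, away from what \<open>collar n 1\<close> pushes to the boundary. For
  \<open>n = 0\<close> the empty product 1 agrees with the boundary being empty.\<close>

definition boundary_height :: "nat \<Rightarrow> (nat \<Rightarrow> real) \<Rightarrow> real" where
  "boundary_height n u = (\<Prod>i<n. 4 * min (u i) (1 - u i))"

lemma topspace_unit_cube: "topspace (unit_cube n) = (\<Pi>\<^sub>E i\<in>{..<n}. {0..1})"
  by (simp add: unit_cube_def)

lemma unit_cube_coord:
  assumes "i < n"
  shows "continuous_map (unit_cube n) euclideanreal (\<lambda>u. u i)"
proof -
  have "continuous_map (unit_cube n) (top_of_set {0..1::real}) (\<lambda>u. u i)"
    unfolding unit_cube_def using assms by (intro continuous_map_product_projection) auto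
  then show ?thesis
    using continuous_map_in_subtopology by blast
qed

lemma continuous_map_into_unit_cube:
  assumes "\<And>i. i < n \<Longrightarrow> continuous_map X euclideanreal (\<lambda>x. f x i)"
    and "\<And>x i. x \<in> topspace X \<Longrightarrow> i < n \<Longrightarrow> 0 \<le> f x i \<and> f x i \<le> 1"
    and "\<And>x. x \<in> topspace X \<Longrightarrow> f x \<in> extensional {..<n}"
  shows "continuous_map X (unit_cube n) f"
  unfolding unit_cube_def continuous_map_componentwise
  using assms by (auto simp: continuous_map_in_subtopology)

lemma continuous_map_collar:
  "continuous_map (prod_topology (top_of_set {0..1}) (unit_cube n)) (unit_cube n) (\<lambda>(s, u). collar n s u)"
proof (rule continuous_map_into_unit_cube)
  fix i assume i: "i < n"
  let ?X = "prod_topology (top_of_set {0..1::real}) (unit_cube n)"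
  have s: "continuous_map ?X euclideanreal (\<lambda>z. fst z)"
    using continuous_map_fst[of "top_of_set {0..1::real}" "unit_cube n"]
    by (auto simp: continuous_map_in_subtopology)
  have u: "continuous_map ?X euclideanreal (\<lambda>z. snd z i)"
    using continuous_map_compose[OF continuous_map_snd unit_cube_coord[OF i], of "top_of_set {0..1::real}"]
    by (simp add: o_def)
  have "continuous_map ?X euclideanreal (\<lambda>z. max 0 (min 1 ((1 + fst z) * snd z i - fst z / 2)))"
    by (intro continuous_intros s u continuous_map_real_max continuous_map_real_min) auto
  then show "continuous_map ?X euclideanreal (\<lambda>x. (case x of (s, u) \<Rightarrow> collar n s u) i)"
    using i by (simp add: collar_def clamp01_def split_beta)
qed (auto simp: collar_def clamp01_def)

lemma continuous_map_boundary_height: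
  "continuous_map (unit_cube n) euclideanreal (boundary_height n)"
  unfolding boundary_height_def
  by (intro continuous_map_prod continuous_map_real_mult continuous_map_real_min continuous_map_diff
      unit_cube_coord) auto

lemma collar_boundary:
  assumes "s \<in> {0..1}" "u \<in> cube_boundary n"
  shows "collar n s u \<in> cube_boundary n"
proof -
  obtain i where i: "i < n" "u i = 0 \<or> u i = 1"
    using assms by (auto simp: cube_boundary_def)
  then have "collar n s u i = 0 \<or> collar n s u i = 1"
    using assms by (auto simp: collar_def clamp01_def)
  then show ?thesis
    using i by (auto simp: cube_boundary_def topspace_unit_cube collar_def clamp01_def)
qed

lemma collar_0:
  assumes "u \<in> topspace (unit_cube n)"
  shows "collar n 0 u = u"
  using assms by (auto simp: collar_def topspace_unit_cube clamp01_def PiE_iff extensional_def)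

lemma collar_1:
  assumes u: "u \<in> topspace (unit_cube n)" and h: "boundary_height n u < 1"
  shows "collar n 1 u \<in> cube_boundary n"
proof -
  have "\<exists>i<n. 4 * min (u i) (1 - u i) < 1"
  proof (rule ccontr)
    assume "\<not> ?thesis"
    then have "1 \<le> boundary_height n u"
      unfolding boundary_height_def by (intro prod_ge_1) (meson lessThan_iff not_less)
    then show False
      using h by simp
  qed
  then obtain i where i: "i < n" "u i < 1/4 \<or> u i > 3/4"
    by (auto simp: min_def split: if_splits)
  then have "collar n 1 u i = 0 \<or> collar n 1 u i = 1"
    by (auto simp: collar_def clamp01_def)
  then show ?thesis
    using i by (auto simp: cube_boundary_def topspace_unit_cube collar_def clamp01_def)
qed

lemma boundary_height_nonneg:
  "u \<in> topspace (unit_cube n) \<Longrightarrow> 0 \<le> boundary_height n u"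
  unfolding boundary_height_def by (intro prod_nonneg) (auto simp: topspace_unit_cube PiE_iff)

lemma boundary_height_boundary:
  "u \<in> cube_boundary n \<Longrightarrow> boundary_height n u = 0"
  unfolding boundary_height_def cube_boundary_def by (force intro: prod_zero)

text \<open>The definition of \<open>homotopic_with\<close> prescribes the ends of the homotopy on
  the whole type. Since the boundary condition only sees points of the cube, it is enough to
  prescribe them there.\<close>

lemma homotopic_rel_boundaryI:
  fixes x :: 'b
  assumes "continuous_map (prod_topology (top_of_set {0..1::real}) (unit_cube n)) X h"
    and "\<And>u. u \<in> topspace (unit_cube n) \<Longrightarrow> h (0, u) = p u"
    and "\<And>u. u \<in> topspace (unit_cube n) \<Longrightarrow> h (1, u) = q u"
    and "\<And>t u. t \<in> {0..1} \<Longrightarrow> u \<in> cube_boundary n \<Longrightarrow> h (t, u) = x"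
  shows "homotopic_with (\<lambda>k. k ` cube_boundary n \<subseteq> {x}) (unit_cube n) X p q"
proof (subst homotopic_with)
  show "(\<And>u. u \<in> topspace (unit_cube n) \<Longrightarrow> f u = g u) \<Longrightarrow>
      (f ` cube_boundary n \<subseteq> {x}) = (g ` cube_boundary n \<subseteq> {x})" for f g :: "(nat \<Rightarrow> real) \<Rightarrow> 'b"
    by (auto simp: cube_boundary_def)
qed (use assms in \<open>blast\<close>)

lemma homotopic_collar:
  assumes p: "p \<in> cube_maps n X x"
  shows "homotopic_with (\<lambda>k. k ` cube_boundary n \<subseteq> {x}) (unit_cube n) X p (p \<circ> collar n 1)"
proof -
  have c: "continuous_map (prod_topology (top_of_set {0..1}) (unit_cube n)) X
      (p \<circ> (\<lambda>(s, u). collar n s u))"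
    using p by (intro continuous_map_compose[OF continuous_map_collar]) (simp add: cube_maps_def)
  show ?thesis
    by (rule homotopic_rel_boundaryI[OF c])
      (use p in \<open>auto simp: collar_0 cube_maps_def image_subset_iff collar_boundary\<close>)
qed

text \<open>After \<open>p\<close> has been made constant on a collar of the boundary, the contraction can be run at a
  speed that vanishes on the boundary and is full outside the collar. The result no longer depends
  on \<open>p\<close>.\<close>

lemma homotopic_rel_boundary:
  assumes X: "contractible_space X" and x: "x \<in> topspace X"
    and p: "p \<in> cube_maps n X x" and q: "q \<in> cube_maps n X x"
  shows "homotopic_with (\<lambda>k. k ` cube_boundary n \<subseteq> {x}) (unit_cube n) X p q"
proof -
  let ?B = "\<lambda>k. k ` cube_boundary n \<subseteq> {x}"
  obtain a where "homotopic_with (\<lambda>_. True) X X id (\<lambda>_. a)"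
    using X by (auto simp: contractible_space_def)
  then obtain h where h: "continuous_map (prod_topology (top_of_set {0..1::real}) X) X h"
    and h0: "\<And>y. h (0, y) = y" and h1: "\<And>y. h (1, y) = a"
    by (auto simp: homotopic_with_def)
  have main: "homotopic_with ?B (unit_cube n) X (p \<circ> collar n 1) (\<lambda>u. h (min 1 (boundary_height n u), x))"
    if p: "p \<in> cube_maps n X x" for p
  proof -
    let ?Z = "prod_topology (top_of_set {0..1::real}) (unit_cube n)"
    define F where "F = (\<lambda>z. h (min (fst z) (boundary_height n (snd z)), (p \<circ> collar n 1) (snd z)))"
    have p1: "continuous_map (unit_cube n) X (p \<circ> collar n 1)"
      using homotopic_with_imp_continuous_maps[OF homotopic_collar[OF p]] by blast
    have s: "continuous_map ?Z euclideanreal (\<lambda>z. fst z)"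
      using continuous_map_fst[of "top_of_set {0..1::real}" "unit_cube n"]
      by (auto simp: continuous_map_in_subtopology)
    have d: "continuous_map ?Z euclideanreal (\<lambda>z. boundary_height n (snd z))"
      using continuous_map_compose[OF continuous_map_snd continuous_map_boundary_height,
          of "top_of_set {0..1::real}"] by (simp add: o_def)
    have "continuous_map ?Z (top_of_set {0..1::real}) (\<lambda>z. min (fst z) (boundary_height n (snd z)))"
      by (auto simp: continuous_map_in_subtopology boundary_height_nonneg min_le_iff_disj
          intro!: continuous_map_real_min s d)
    moreover have "continuous_map ?Z X (\<lambda>z. (p \<circ> collar n 1) (snd z))"
      using continuous_map_compose[OF continuous_map_snd p1, of "top_of_set {0..1::real}"]
      by (simp add: o_def)
    ultimately have F: "continuous_map ?Z X F"
      unfolding F_def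
      using continuous_map_compose[OF continuous_map_pairedI h]
      by (simp add: o_def)
    have F0: "F (0, u) = (p \<circ> collar n 1) u" if "u \<in> topspace (unit_cube n)" for u
      using boundary_height_nonneg[OF that] h0 by (simp add: F_def)
    \<comment> \<open>Where the height is below 1, the collared \<open>p\<close> has the value
      \<open>x\<close>. Elsewhere the contraction has reached its end, whose value \<open>a\<close>
      is the same for all points. In neither case is anything left of \<open>p\<close>.\<close>
    have F1: "F (1, u) = h (min 1 (boundary_height n u), x)" if "u \<in> topspace (unit_cube n)" for u
    proof (cases "boundary_height n u < 1")
      case True
      then have "p (collar n 1 u) = x"
        using collar_1[OF that] p by (auto simp: cube_maps_def)
      then show ?thesis
        by (simp add: F_def)
    qed (simp add: F_def h1)
    have FB: "F (t, u) = x" if "t \<in> {0..1}" and u: "u \<in> cube_boundary n" for t u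
    proof -
      have "p (collar n 1 u) = x"
        using collar_boundary[OF _ u, of 1] p by (auto simp: cube_maps_def)
      then show ?thesis
        using boundary_height_boundary[OF u] \<open>t \<in> {0..1}\<close> h0 by (simp add: F_def)
    qed
    show ?thesis
      using F F0 F1 FB by (rule homotopic_rel_boundaryI)
  qed
  have pq: "homotopic_with ?B (unit_cube n) X p (\<lambda>u. h (min 1 (boundary_height n u), x))"
    if "p \<in> cube_maps n X x" for p
    by (rule homotopic_with_trans[OF homotopic_collar[OF that] main[OF that]])
  show ?thesis
    using homotopic_with_trans[OF pq[OF p] homotopic_with_symD[OF pq[OF q]]] .
qed

lemma cube_class_contractible:
  assumes "contractible_space X" "x \<in> topspace X" "p \<in> cube_maps n X x"
  shows "cube_class n X x p = cube_maps n X x"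
  using homotopic_rel_boundary[OF assms] by (auto simp: cube_class_def)

lemma const_cube_maps: "x \<in> topspace X \<Longrightarrow> (\<lambda>_. x) \<in> cube_maps n X x"
  by (auto simp: cube_maps_def)

text \<open>All cube maps at a base point form a single class, so each homotopy set has one element
  and bijectivity is automatic.\<close>

lemma weak_homotopy_equivalence_contractible:
  assumes X: "contractible_space X" "topspace X \<noteq> {}" and Y: "contractible_space Y"
    and f: "continuous_map X Y f"
  shows "weak_homotopy_equivalence X Y f"
proof -
  have "bij_betw (homotopy_group_map n Y f x) (homotopy_group n X x) (homotopy_group n Y (f x))"
    if x: "x \<in> topspace X" for n x
  proof -
    have y: "f x \<in> topspace Y"
      using f x by (auto simp: continuous_map_def)
    have gx: "homotopy_group n X x = {cube_maps n X x}"
      unfolding homotopy_group_def using cube_class_contractible[OF X(1) x] const_cube_maps[OF x, of n]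
      by (auto simp: image_iff)
    have gy: "homotopy_group n Y (f x) = {cube_maps n Y (f x)}"
      unfolding homotopy_group_def using cube_class_contractible[OF Y y] const_cube_maps[OF y, of n]
      by (auto simp: image_iff)
    have "f \<circ> p \<in> cube_maps n Y (f x)" if "p \<in> cube_maps n X x" for p
      using that f by (auto simp: cube_maps_def intro: continuous_map_compose)
    then have "homotopy_group_map n Y f x (cube_maps n X x) = cube_maps n Y (f x)"
      unfolding homotopy_group_map_def using cube_class_contractible[OF Y y] const_cube_maps[OF x]
      by blast
    then show ?thesis
      by (simp add: gx gy bij_betw_def)
  qed
  then show ?thesis
    using X(2) f by (simp add: weak_homotopy_equivalence_def)
qed

lemma weak_homotopy_equivalence_empty:
  "topspace X = {} \<Longrightarrow> topspace Y = {} \<Longrightarrow> weak_homotopy_equivalence X Y f"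
  by (auto simp: weak_homotopy_equivalence_def continuous_map_def Pi_def)

section \<open>N-infinity operads and their families\<close>

lemma carrier_Sym: "carrier (Sym n) = Bij {..<n}"
  and one_Sym: "\<one>\<^bsub>Sym n\<^esub> = (\<lambda>i\<in>{..<n}. i)"
  and mult_Sym: "\<sigma> \<in> Bij {..<n} \<Longrightarrow> \<tau> \<in> Bij {..<n} \<Longrightarrow> \<sigma> \<otimes>\<^bsub>Sym n\<^esub> \<tau> = compose {..<n} \<sigma> \<tau>"
  by (auto simp: BijGroup_def)

lemma mult_Sym_apply:
  "\<sigma> \<in> carrier (Sym n) \<Longrightarrow> \<tau> \<in> carrier (Sym n) \<Longrightarrow> i < n \<Longrightarrow> (\<sigma> \<otimes>\<^bsub>Sym n\<^esub> \<tau>) i = \<sigma> (\<tau> i)"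
  by (simp add: carrier_Sym mult_Sym compose_def)

lemma group_Sym: "group (Sym n)"
  by (rule group_BijGroup)

lemma Sym_apply_less: "\<sigma> \<in> carrier (Sym n) \<Longrightarrow> i < n \<Longrightarrow> \<sigma> i < n"
  by (metis Bij_imp_funcset PiE carrier_Sym lessThan_iff)

lemma Sym_eqI:
  "\<sigma> \<in> carrier (Sym n) \<Longrightarrow> \<tau> \<in> carrier (Sym n) \<Longrightarrow> (\<And>i. i < n \<Longrightarrow> \<sigma> i = \<tau> i) \<Longrightarrow> \<sigma> = \<tau>"
  by (metis Bij_imp_extensional carrier_Sym extensionalityI lessThan_iff)

lemma inv_Sym_apply:
  assumes "\<sigma> \<in> carrier (Sym n)" "i < n"
  shows "(inv\<^bsub>Sym n\<^esub> \<sigma>) (\<sigma> i) = i" "\<sigma> ((inv\<^bsub>Sym n\<^esub> \<sigma>) i) = i"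
proof -
  interpret S: group "Sym n"
    by (rule group_Sym)
  have "(inv\<^bsub>Sym n\<^esub> \<sigma> \<otimes>\<^bsub>Sym n\<^esub> \<sigma>) i = i" "(\<sigma> \<otimes>\<^bsub>Sym n\<^esub> inv\<^bsub>Sym n\<^esub> \<sigma>) i = i"
    using assms by (simp_all only: S.l_inv S.r_inv) (simp_all add: one_Sym)
  then show "(inv\<^bsub>Sym n\<^esub> \<sigma>) (\<sigma> i) = i" "\<sigma> ((inv\<^bsub>Sym n\<^esub> \<sigma>) i) = i"
    using assms S.inv_closed by (simp_all only: mult_Sym_apply)
qed

definition fixed_set :: "('g, 'a) operad_data \<Rightarrow> nat \<Rightarrow> ('g \<times> (nat \<Rightarrow> nat)) set \<Rightarrow> 'a set" where
  "fixed_set P n \<Gamma> = {x \<in> ops P n. \<forall>\<gamma> \<in> \<Gamma>. oact P n \<gamma> x = x}"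

lemma topspace_fixed_points [simp]:
  "topspace (fixed_points \<Gamma> (ospace P n) (oact P n)) = fixed_set P n \<Gamma>"
  by (auto simp: fixed_points_def fixed_set_def)

lemma (in group) group_DirProd_Sym: "group (G \<times>\<times> Sym n)"
  by (simp add: DirProd_group group_Sym)

lemma conj_subset_image: "conj_subset A a H = (\<lambda>h. a \<otimes>\<^bsub>A\<^esub> h \<otimes>\<^bsub>A\<^esub> inv\<^bsub>A\<^esub> a) ` H"
  by (auto simp: conj_subset_def l_coset_def r_coset_def)

lemma (in group) subgroup_conj_subset:
  "a \<in> carrier G \<Longrightarrow> subgroup H G \<Longrightarrow> subgroup (conj_subset G a H) G"
  using subgroup_conjugation_is_surj1[of "inv a" H] by (simp add: conj_subset_def)

context G_operad
begin

lemma group_action_ops: "group_action (G \<times>\<times> Sym n) (ops P n) (oact P n)"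
  using action[of n] by (simp add: continuous_action_def)

lemma oact_mem_ops: "a \<in> carrier (G \<times>\<times> Sym n) \<Longrightarrow> x \<in> ops P n \<Longrightarrow> oact P n a x \<in> ops P n"
  by (rule group_action.element_image[OF group_action_ops _ _ HOL.refl])

lemma oact_closed:
  "g \<in> carrier G \<Longrightarrow> \<sigma> \<in> carrier (Sym n) \<Longrightarrow> x \<in> ops P n \<Longrightarrow> oact P n (g, \<sigma>) x \<in> ops P n"
  by (rule oact_mem_ops) (simp_all add: DirProd_def)

lemma oact_oact:
  assumes "g \<in> carrier G" "\<sigma> \<in> carrier (Sym n)" "h \<in> carrier G" "\<tau> \<in> carrier (Sym n)" "x \<in> ops P n"
  shows "oact P n (g, \<sigma>) (oact P n (h, \<tau>) x) = oact P n (g \<otimes> h, \<sigma> \<otimes>\<^bsub>Sym n\<^esub> \<tau>) x"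
  using group_action.composition_rule[OF group_action_ops assms(5), of "(g, \<sigma>)" "(h, \<tau>)"] assms
  by (simp add: DirProd_def)

lemma oact_one: "x \<in> ops P n \<Longrightarrow> oact P n (\<one>, \<one>\<^bsub>Sym n\<^esub>) x = x"
  using group_action.id_eq_one[OF group_action_ops[of n], symmetric] by (simp add: DirProd_def)

lemma gact_closed: "g \<in> carrier G \<Longrightarrow> x \<in> ops P n \<Longrightarrow> gact P n g x \<in> ops P n"
  and sact_closed: "\<sigma> \<in> carrier (Sym n) \<Longrightarrow> x \<in> ops P n \<Longrightarrow> sact G P n \<sigma> x \<in> ops P n"
  by (simp_all add: oact_closed group.is_monoid group_Sym monoid.one_closed)

lemma gact_sact:
  assumes "g \<in> carrier G" "\<sigma> \<in> carrier (Sym n)" "x \<in> ops P n"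
  shows "gact P n g (sact G P n \<sigma> x) = oact P n (g, \<sigma>) x"
    and "sact G P n \<sigma> (gact P n g x) = oact P n (g, \<sigma>) x"
proof -
  interpret S: group "Sym n"
    by (rule group_Sym)
  show "gact P n g (sact G P n \<sigma> x) = oact P n (g, \<sigma>) x"
    "sact G P n \<sigma> (gact P n g x) = oact P n (g, \<sigma>) x"
    using assms by (simp_all add: oact_oact)
qed

end

lemma operad_mapsD:
  assumes "\<phi> \<in> operad_maps G P Q"
  shows "x \<in> ops P n \<Longrightarrow> \<phi> n x \<in> ops Q n"
    and "a \<in> carrier (G \<times>\<times> Sym n) \<Longrightarrow> x \<in> ops P n \<Longrightarrow> \<phi> n (oact P n a x) = oact Q n a (\<phi> n x)"
  using assms by (auto simp: operad_maps_def continuous_map_def)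

lemma operad_maps_fixed_set:
  assumes "\<phi> \<in> operad_maps G P Q" "subgroup \<Gamma> (G \<times>\<times> Sym n)" "x \<in> fixed_set P n \<Gamma>"
  shows "\<phi> n x \<in> fixed_set Q n \<Gamma>"
proof -
  have x: "x \<in> ops P n" "\<And>\<gamma>. \<gamma> \<in> \<Gamma> \<Longrightarrow> oact P n \<gamma> x = x"
    using assms(3) by (auto simp: fixed_set_def)
  have "oact Q n \<gamma> (\<phi> n x) = \<phi> n x" if "\<gamma> \<in> \<Gamma>" for \<gamma>
    using operad_mapsD(2)[OF assms(1) subgroup.mem_carrier[OF assms(2) that] x(1)] x(2)[OF that] by simp
  then show ?thesis
    using operad_mapsD(1)[OF assms(1) x(1)] by (simp add: fixed_set_def)
qed

text \<open>A universal space determines its family as the set of subgroups that have fixed points.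
  So the definite description in \<open>operad_family\<close> is well defined.\<close>

lemma operad_family_eqI:
  assumes "subgroup_family (G \<times>\<times> Sym n) F" "universal_space (G \<times>\<times> Sym n) F (ospace P n) (oact P n)"
  shows "operad_family G P n = F"
  unfolding operad_family_def
proof (rule the_equality)
  fix F' assume F': "subgroup_family (G \<times>\<times> Sym n) F' \<and>
    universal_space (G \<times>\<times> Sym n) F' (ospace P n) (oact P n)"
  have *: "F = {H. subgroup H (G \<times>\<times> Sym n) \<and> fixed_set P n H \<noteq> {}}"
    if "subgroup_family (G \<times>\<times> Sym n) F \<and> universal_space (G \<times>\<times> Sym n) F (ospace P n) (oact P n)" for F
  proof -
    have "subgroup H (G \<times>\<times> Sym n)" if "H \<in> F" for H
      using that \<open>subgroup_family (G \<times>\<times> Sym n) F \<and> _\<close> by (simp add: subgroup_family_def)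
    moreover have "H \<in> F \<longleftrightarrow> fixed_set P n H \<noteq> {}" if "subgroup H (G \<times>\<times> Sym n)" for H
      using that \<open>_ \<and> universal_space (G \<times>\<times> Sym n) F (ospace P n) (oact P n)\<close>
      unfolding universal_space_def topspace_fixed_points by (cases "H \<in> F") auto
    ultimately show ?thesis
      by blast
  qed
  show "F' = F"
    using *[OF F'] * assms by blast
qed (use assms in blast)

lemma N_infinity_family:
  assumes "N_infinity_operad G P"
  shows operad_family_eq:
      "operad_family G P n = {\<Gamma>. subgroup \<Gamma> (G \<times>\<times> Sym n) \<and> fixed_set P n \<Gamma> \<noteq> {}}"
    and contractible_fixed_points:
      "subgroup \<Gamma> (G \<times>\<times> Sym n) \<Longrightarrow> fixed_set P n \<Gamma> \<noteq> {} \<Longrightarrow>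
        contractible_space (fixed_points \<Gamma> (ospace P n) (oact P n))"
    and ex_G_fixed: "\<exists>x \<in> ops P n. \<forall>g \<in> carrier G. gact P n g x = x"
proof -
  interpret N_infinity_operad G P
    by (rule assms)
  obtain F where F: "subgroup_family (G \<times>\<times> Sym n) F"
      "universal_space (G \<times>\<times> Sym n) F (ospace P n) (oact P n)"
      "\<And>H. subgroup H G \<Longrightarrow> H \<times> {\<one>\<^bsub>Sym n\<^esub>} \<in> F"
    using universal[of n] by blast
  have "subgroup \<Gamma> (G \<times>\<times> Sym n)" if "\<Gamma> \<in> F" for \<Gamma>
    using F(1) that by (simp add: subgroup_family_def)
  moreover have u: "if \<Gamma> \<in> F then contractible_space (fixed_points \<Gamma> (ospace P n) (oact P n)) \<and> fixed_set P n \<Gamma> \<noteq> {}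
      else fixed_set P n \<Gamma> = {}" if "subgroup \<Gamma> (G \<times>\<times> Sym n)" for \<Gamma>
    using F(2) that unfolding universal_space_def topspace_fixed_points by metis
  ultimately show "operad_family G P n = {\<Gamma>. subgroup \<Gamma> (G \<times>\<times> Sym n) \<and> fixed_set P n \<Gamma> \<noteq> {}}"
    unfolding operad_family_eqI[OF F(1,2)] by (auto split: if_splits)
  show "contractible_space (fixed_points \<Gamma> (ospace P n) (oact P n))"
    if "subgroup \<Gamma> (G \<times>\<times> Sym n)" "fixed_set P n \<Gamma> \<noteq> {}"
    using u[OF that(1)] that(2) by (auto split: if_splits)
  \<comment> \<open>The condition on the subgroups \<open>H \<times> {1}\<close>, taken at
    \<open>H = G\<close>.\<close>
  have G: "carrier G \<times> {\<one>\<^bsub>Sym n\<^esub>} \<in> F"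
    using F(3) subgroup_self by blast
  then have "fixed_set P n (carrier G \<times> {\<one>\<^bsub>Sym n\<^esub>}) \<noteq> {}"
    using u[of "carrier G \<times> {\<one>\<^bsub>Sym n\<^esub>}"] F(1) by (auto simp: subgroup_family_def)
  then show "\<exists>x \<in> ops P n. \<forall>g \<in> carrier G. gact P n g x = x"
    by (auto simp: fixed_set_def)
qed

lemma (in G_operad) fixed_set_conj:
  assumes a: "a \<in> carrier (G \<times>\<times> Sym n)" and \<Gamma>: "subgroup \<Gamma> (G \<times>\<times> Sym n)"
    and x: "x \<in> fixed_set P n \<Gamma>"
  shows "oact P n a x \<in> fixed_set P n (conj_subset (G \<times>\<times> Sym n) a \<Gamma>)"
proof -
  interpret A: group "G \<times>\<times> Sym n"
    by (rule group_DirProd_Sym)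
  interpret act: group_action "G \<times>\<times> Sym n" "ops P n" "oact P n"
    by (rule group_action_ops)
  have xo: "x \<in> ops P n"
    using x by (simp add: fixed_set_def)
  have "oact P n (a \<otimes>\<^bsub>G \<times>\<times> Sym n\<^esub> \<gamma> \<otimes>\<^bsub>G \<times>\<times> Sym n\<^esub> inv\<^bsub>G \<times>\<times> Sym n\<^esub> a) (oact P n a x) = oact P n a x"
    if "\<gamma> \<in> \<Gamma>" for \<gamma>
  proof -
    have \<gamma>: "\<gamma> \<in> carrier (G \<times>\<times> Sym n)"
      using subgroup.mem_carrier[OF \<Gamma> that] .
    have "oact P n \<gamma> x = x"
      using x that by (simp add: fixed_set_def)
    have "oact P n (a \<otimes>\<^bsub>G \<times>\<times> Sym n\<^esub> \<gamma> \<otimes>\<^bsub>G \<times>\<times> Sym n\<^esub> inv\<^bsub>G \<times>\<times> Sym n\<^esub> a) (oact P n a x) =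
        oact P n (a \<otimes>\<^bsub>G \<times>\<times> Sym n\<^esub> \<gamma> \<otimes>\<^bsub>G \<times>\<times> Sym n\<^esub> inv\<^bsub>G \<times>\<times> Sym n\<^esub> a \<otimes>\<^bsub>G \<times>\<times> Sym n\<^esub> a) x"
      by (rule act.composition_rule[OF xo _ a, symmetric]) (intro A.m_closed A.inv_closed a \<gamma>)
    also have "\<dots> = oact P n (a \<otimes>\<^bsub>G \<times>\<times> Sym n\<^esub> \<gamma>) x"
      using a \<gamma> by (simp only: A.m_assoc A.m_closed A.inv_closed A.l_inv A.r_one)
    also have "\<dots> = oact P n a x"
      using act.composition_rule[OF xo a \<gamma>] \<open>oact P n \<gamma> x = x\<close> by simp
    finally show ?thesis .
  qed
  then show ?thesis
    using act.element_image[OF a xo] by (auto simp: fixed_set_def conj_subset_image)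
qed

text \<open>For indiscrete spaces the homotopical axioms reduce to the existence of fixed
  operations. Nonempty fixed point spaces are contractible, so the family can be taken to be all
  subgroups with a fixed point. The operation fixed by \<open>G\<close> puts every
  \<open>H \<times> {1}\<close> into it and, in arity 0, is the end of an equivariant homotopy that
  jumps.\<close>

lemma N_infinity_operad_indiscreteI:
  assumes "G_operad G P" and ind: "\<And>n. ospace P n = indiscrete (ops P n)"
    and free: "\<And>n \<sigma> x. \<sigma> \<in> carrier (Sym n) \<Longrightarrow> x \<in> ops P n \<Longrightarrow> sact G P n \<sigma> x = x \<Longrightarrow> \<sigma> = \<one>\<^bsub>Sym n\<^esub>"
    and fixed: "\<And>n. \<exists>x \<in> ops P n. \<forall>g \<in> carrier G. gact P n g x = x"
  shows "N_infinity_operad G P"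
proof -
  interpret G_operad G P
    by (rule assms)
  show ?thesis
  proof
    obtain c where c: "c \<in> ops P 0" "\<And>g. g \<in> carrier G \<Longrightarrow> gact P 0 g c = c"
      using fixed[of 0] by blast
    have cont: "continuous_map (prod_topology (top_of_set {0..1::real}) (ospace P 0)) (ospace P 0)
        (\<lambda>(t, x). if t = (0::real) then x else c)"
      by (subst (2) ind, unfold continuous_map_indiscrete) (use c in auto)
    show "equivariantly_contractible G (ospace P 0) (gact P 0)"
      unfolding equivariantly_contractible_def homotopic_with_def
      using c cont by (intro bexI[of _ c] exI[of _ "\<lambda>(t, x). if t = (0::real) then x else c"]) auto
  next
    fix n
    interpret A: group "G \<times>\<times> Sym n"
      by (rule group_DirProd_Sym)
    let ?F = "{\<Gamma>. subgroup \<Gamma> (G \<times>\<times> Sym n) \<and> fixed_set P n \<Gamma> \<noteq> {}}"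
    have "contractible_space (fixed_points \<Gamma> (ospace P n) (oact P n))" for \<Gamma>
      unfolding fixed_points_def by (subst ind) (simp add: subtopology_indiscrete contractible_indiscrete)
    then have "universal_space (G \<times>\<times> Sym n) ?F (ospace P n) (oact P n)"
      using action[of n] unfolding universal_space_def topspace_fixed_points by auto
    moreover have "subgroup_family (G \<times>\<times> Sym n) ?F"
      unfolding subgroup_family_def
    proof (intro conjI ballI allI impI)
      fix H K assume "H \<in> ?F" "subgroup K (G \<times>\<times> Sym n) \<and> K \<subseteq> H"
      then show "K \<in> ?F"
        unfolding fixed_set_def by blast
    next
      fix H a assume H: "H \<in> ?F" and a: "a \<in> carrier (G \<times>\<times> Sym n)"
      have "subgroup (conj_subset (G \<times>\<times> Sym n) a H) (G \<times>\<times> Sym n)"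
        using A.subgroup_conj_subset[OF a] H by blast
      then show "conj_subset (G \<times>\<times> Sym n) a H \<in> ?F"
        using fixed_set_conj[OF a] H by blast
    qed auto
    moreover have "H \<times> {\<one>\<^bsub>Sym n\<^esub>} \<in> ?F" if "subgroup H G" for H
    proof -
      obtain x where "x \<in> ops P n" "\<forall>g \<in> carrier G. gact P n g x = x"
        using fixed by blast
      then have "x \<in> fixed_set P n (H \<times> {\<one>\<^bsub>Sym n\<^esub>})"
        using subgroup.subset[OF that] by (auto simp: fixed_set_def)
      moreover have "subgroup (H \<times> {\<one>\<^bsub>Sym n\<^esub>}) (G \<times>\<times> Sym n)"
        using that group_Sym is_group by (intro DirProd_subgroups group.triv_subgroup)
      ultimately show ?thesis
        by blast
    qed
    ultimately show "\<exists>F. subgroup_family (G \<times>\<times> Sym n) F \<and>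
         universal_space (G \<times>\<times> Sym n) F (ospace P n) (oact P n) \<and>
         (\<forall>H. subgroup H G \<longrightarrow> H \<times> {\<one>\<^bsub>Sym n\<^esub>} \<in> F)"
      by blast
  qed (use free in blast)
qed

text \<open>Maps carry fixed operations forward, so only the backward implication has to be assumed.
  Then the two fixed point spaces are both empty or both nonempty and contractible.\<close>

lemma operad_weqsI:
  assumes P: "N_infinity_operad G P" and Q: "N_infinity_operad G Q" and \<phi>: "\<phi> \<in> operad_maps G P Q"
    and fixed: "\<And>n \<Gamma>. subgroup \<Gamma> (G \<times>\<times> Sym n) \<Longrightarrow> fixed_set Q n \<Gamma> \<noteq> {} \<Longrightarrow> fixed_set P n \<Gamma> \<noteq> {}"
  shows "\<phi> \<in> operad_weqs G P Q"
  unfolding operad_weqs_def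
proof (intro CollectI conjI allI impI \<phi>)
  fix n \<Gamma> assume \<Gamma>: "subgroup \<Gamma> (G \<times>\<times> Sym n)"
  show "weak_homotopy_equivalence (fixed_points \<Gamma> (ospace P n) (oact P n))
      (fixed_points \<Gamma> (ospace Q n) (oact Q n)) (\<phi> n)"
  proof (cases "fixed_set P n \<Gamma> = {}")
    case True
    then show ?thesis
      using fixed[OF \<Gamma>] by (intro weak_homotopy_equivalence_empty) auto
  next
    case False
    have im: "\<phi> n x \<in> fixed_set Q n \<Gamma>" if "x \<in> fixed_set P n \<Gamma>" for x
      using operad_maps_fixed_set[OF \<phi> \<Gamma> that] .
    have "continuous_map (ospace P n) (ospace Q n) (\<phi> n)"
      using \<phi> by (simp add: operad_maps_def)
    then have "continuous_map (fixed_points \<Gamma> (ospace P n) (oact P n))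
        (fixed_points \<Gamma> (ospace Q n) (oact Q n)) (\<phi> n)"
      using im topspace_fixed_points[of \<Gamma> P n]
      unfolding continuous_map_in_subtopology fixed_points_def
      by (auto simp: continuous_map_from_subtopology fixed_set_def)
    moreover have "fixed_set Q n \<Gamma> \<noteq> {}"
      using im False by blast
    ultimately show ?thesis
      using False contractible_fixed_points[OF P \<Gamma>] contractible_fixed_points[OF Q \<Gamma>]
      by (intro weak_homotopy_equivalence_contractible) auto
  qed
qed

section \<open>Isomorphism in the homotopy category\<close>

lemma zigzag_N_infinity: "zigzag G P p Q \<Longrightarrow> N_infinity_operad G P \<and> N_infinity_operad G Q"
  by (induction rule: zigzag.induct) auto

lemma zigzag_append: "zigzag G P p Q \<Longrightarrow> zigzag G Q q R \<Longrightarrow> zigzag G P (p @ q) R"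
  by (induction rule: zigzag.induct) (auto intro: zigzag.intros)

text \<open>Maps preserve fixed operations. A weak equivalence can also be run backwards, because a
  nonempty target space of fixed points has a nonempty source. Zigzags in both directions therefore
  give equal families.\<close>

lemma zigzag_family_mono:
  "zigzag G P p Q \<Longrightarrow> operad_family G P n \<subseteq> operad_family G Q n"
proof (induction rule: zigzag.induct)
  case (Forward P \<phi> Q p R)
  have "operad_family G P n \<subseteq> operad_family G Q n"
    unfolding operad_family_eq[OF Forward(1)]
      operad_family_eq[OF conjunct1[OF zigzag_N_infinity[OF Forward(3)]]]
    using operad_maps_fixed_set[OF Forward(2)] by blast
  with Forward.IH show ?case
    by blast
next
  case (Backward P \<phi> Q p R)
  have "fixed_set Q n \<Gamma> \<noteq> {}" if "subgroup \<Gamma> (G \<times>\<times> Sym n)" "fixed_set P n \<Gamma> \<noteq> {}" for \<Gamma>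
    using Backward(2) that topspace_fixed_points
    unfolding operad_weqs_def weak_homotopy_equivalence_def by fastforce
  then have "operad_family G P n \<subseteq> operad_family G Q n"
    unfolding operad_family_eq[OF Backward(1)]
      operad_family_eq[OF conjunct1[OF zigzag_N_infinity[OF Backward(3)]]] by blast
  with Backward.IH show ?case
    by blast
qed auto

lemma homotopy_iso_family:
  "(P, Q) \<in> homotopy_iso G \<Longrightarrow> operad_family G P n = operad_family G Q n"
  unfolding homotopy_iso_def by (blast dest: zigzag_family_mono)

lemma homotopy_iso_N_infinity:
  "(P, Q) \<in> homotopy_iso G \<Longrightarrow> N_infinity_operad G P \<and> N_infinity_operad G Q"
  unfolding homotopy_iso_def by (blast dest: zigzag_N_infinity)

lemma homotopy_iso_sym: "(P, Q) \<in> homotopy_iso G \<Longrightarrow> (Q, P) \<in> homotopy_iso G"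
  unfolding homotopy_iso_def by blast

lemma homotopy_iso_trans:
  assumes "(P, Q) \<in> homotopy_iso G" "(Q, R) \<in> homotopy_iso G"
  shows "(P, R) \<in> homotopy_iso G"
proof -
  have cancel: "zigzag_eq G P P ((p @ q) @ (q' @ p')) []"
    if "zigzag G P p Q" "zigzag G Q p' P" "zigzag_eq G P P (p @ p') []" "zigzag_eq G Q Q (q @ q') []"
    for P Q :: "('a, 'b) operad_data" and p p' q q'
  proof -
    have "zigzag_eq G P P (p @ (q @ q') @ p') (p @ [] @ p')"
      using that by (intro zigzag_eq.append[of G P Q] zigzag_eq.append[of G Q Q] zigzag_eq.refl)
    then show ?thesis
      using that(3) by (auto intro: zigzag_eq.trans)
  qed
  obtain p p' where p: "zigzag G P p Q" "zigzag G Q p' P"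
      "zigzag_eq G P P (p @ p') []" "zigzag_eq G Q Q (p' @ p) []"
    using assms(1) unfolding homotopy_iso_def by blast
  obtain q q' where q: "zigzag G Q q R" "zigzag G R q' Q"
      "zigzag_eq G Q Q (q @ q') []" "zigzag_eq G R R (q' @ q) []"
    using assms(2) unfolding homotopy_iso_def by blast
  show ?thesis
    unfolding homotopy_iso_def
    using zigzag_append[OF p(1) q(1)] zigzag_append[OF q(2) p(2)]
      cancel[OF p(1,2,3) q(3)] cancel[OF q(2,1,4) p(4)] by blast
qed

lemma operad_weqs_homotopy_iso:
  assumes "N_infinity_operad G P" "N_infinity_operad G Q" "\<phi> \<in> operad_weqs G P Q"
  shows "(P, Q) \<in> homotopy_iso G"
proof -
  have "\<phi> \<in> operad_maps G P Q"
    using assms(3) by (simp add: operad_weqs_def)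
  then have "zigzag G P [Forward P \<phi> Q] Q" "zigzag G Q [Backward Q \<phi> P] P"
    using assms by (auto intro!: zigzag.intros)
  then show ?thesis
    unfolding homotopy_iso_def
    using zigzag_eq.inverse_right[OF assms] zigzag_eq.inverse_left[OF assms] by fastforce
qed

section \<open>Arithmetic of blocks\<close>

lemma block_start_Suc: "i < length ns \<Longrightarrow> block_start ns (Suc i) = block_start ns i + ns ! i"
  by (simp add: block_start_def take_Suc_conv_app_nth)

lemma block_start_mono: "i \<le> j \<Longrightarrow> block_start ns i \<le> block_start ns j"
proof (induction j)
  case (Suc j)
  \<comment> \<open>Beyond the end of the list \<open>take\<close> returns all of it, and the block
    starts stay at the total sum.\<close>
  then show ?case
    by (cases "j < length ns") (auto simp: block_start_Suc le_Suc_eq, simp_all add: block_start_def)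
qed simp

lemma block_start_length: "block_start ns (length ns) = sum_list ns"
  by (simp add: block_start_def)

lemma block_pos_less:
  assumes "i < length ns" "r < ns ! i"
  shows "block_start ns i + r < sum_list ns"
  using block_start_mono[of "Suc i" "length ns" ns] assms block_start_Suc[of i ns]
  by (simp add: block_start_length)

text \<open>Empty blocks may share the start of block \<open>i\<close>. Those before it are passed
  over, since they end at or before the position.\<close>

lemma block_of_pos:
  assumes "i < length ns" "r < ns ! i"
  shows "block_of ns (block_start ns i + r) = i"
  unfolding block_of_def
proof (rule Least_equality)
  show "block_start ns i + r < block_start ns (Suc i)"
    using assms by (simp add: block_start_Suc)
next
  fix j assume "block_start ns i + r < block_start ns (Suc j)"
  then show "i \<le> j"
    using block_start_mono[of "Suc j" i ns] by (meson le_add1 linorder_not_less not_less_eq_eq order_less_le_trans order_trans)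
qed

lemma block_cases:
  assumes "j < sum_list ns"
  obtains i r where "i < length ns" "r < ns ! i" "j = block_start ns i + r"
proof -
  have "\<exists>i r. i < m \<and> r < ns ! i \<and> j = block_start ns i + r"
    if "m \<le> length ns" "j < block_start ns m" for m
    using that
  proof (induction m)
    case (Suc m)
    show ?case
    proof (cases "j < block_start ns m")
      case True
      then show ?thesis
        using Suc by (metis Suc_leD less_Suc_eq)
    next
      case False
      then have "j - block_start ns m < ns ! m \<and> j = block_start ns m + (j - block_start ns m)"
        using Suc.prems by (simp add: block_start_Suc)
      then show ?thesis
        by blast
    qed
  qed (simp add: block_start_def)
  then show thesis
    using that assms by (metis block_start_length order_refl)
qed

lemma block_pos_inj:
  assumes "i < length ns" "r < ns ! i" "i' < length ns" "r' < ns ! i'"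
    "block_start ns i + r = block_start ns i' + r'"
  shows "i = i' \<and> r = r'"
  using assms block_of_pos by (metis add_left_cancel)

lemma length_permute_list_by [simp]: "length (permute_list_by \<sigma> xs) = length xs"
  by (simp add: permute_list_by_def)

lemma nth_permute_list_by [simp]: "i < length xs \<Longrightarrow> permute_list_by \<sigma> xs ! i = xs ! \<sigma> i"
  by (simp add: permute_list_by_def)

lemma Sym_bij_betw: "\<sigma> \<in> carrier (Sym n) \<Longrightarrow> bij_betw \<sigma> {..<n} {..<n}"
  by (simp add: carrier_Sym Bij_def)

lemma SymI:
  assumes "\<sigma> \<in> extensional {..<n}" "\<And>i. i < n \<Longrightarrow> \<sigma> i < n"
    "\<And>i j. i < n \<Longrightarrow> j < n \<Longrightarrow> \<sigma> i = \<sigma> j \<Longrightarrow> i = j"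
  shows "\<sigma> \<in> carrier (Sym n)"
proof -
  have "inj_on \<sigma> {..<n}" "\<sigma> ` {..<n} \<subseteq> {..<n}"
    using assms by (auto simp: inj_on_def)
  then have "bij_betw \<sigma> {..<n} {..<n}"
    by (simp add: bij_betw_def endo_inj_surj)
  then show ?thesis
    using assms(1) by (simp add: carrier_Sym Bij_def)
qed

lemma sum_list_permute_list_by:
  fixes ns :: "nat list"
  assumes "\<sigma> \<in> carrier (Sym (length ns))"
  shows "sum_list (permute_list_by \<sigma> ns) = sum_list ns"
proof -
  have "sum_list (permute_list_by \<sigma> ns) = (\<Sum>i<length ns. ns ! \<sigma> i)"
    by (simp add: sum_list_sum_nth atLeast0LessThan)
  also have "\<dots> = (\<Sum>i<length ns. ns ! i)"
    using sum.reindex_bij_betw[OF Sym_bij_betw[OF assms]] .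
  finally show ?thesis
    by (simp add: sum_list_sum_nth atLeast0LessThan)
qed

lemma block_perm_apply:
  assumes "\<sigma> \<in> carrier (Sym (length ns))" "i < length ns" "r < ns ! \<sigma> i"
  shows "block_perm ns \<sigma> (block_start (permute_list_by \<sigma> ns) i + r) = block_start ns (\<sigma> i) + r"
  using assms block_pos_less[of i "permute_list_by \<sigma> ns" r] block_of_pos[of i "permute_list_by \<sigma> ns" r]
  by (simp add: block_perm_def Let_def sum_list_permute_list_by)

lemma block_sum_apply:
  assumes "i < length ns" "r < ns ! i"
  shows "block_sum ns \<tau> (block_start ns i + r) = block_start ns i + \<tau> i r"
  using assms block_pos_less block_of_pos by (simp add: block_sum_def Let_def)

lemma block_perm_closed:
  assumes \<sigma>: "\<sigma> \<in> carrier (Sym (length ns))"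
  shows "block_perm ns \<sigma> \<in> carrier (Sym (sum_list ns))"
proof (rule SymI)
  let ?ms = "permute_list_by \<sigma> ns"
  have cases: "\<exists>i r. i < length ns \<and> r < ns ! \<sigma> i \<and> j = block_start ?ms i + r" if "j < sum_list ns" for j
    using that block_cases[of j ?ms] sum_list_permute_list_by[OF \<sigma>]
    by (metis length_permute_list_by nth_permute_list_by)
  show "block_perm ns \<sigma> \<in> extensional {..<sum_list ns}"
    by (simp add: block_perm_def)
  show "block_perm ns \<sigma> j < sum_list ns" if "j < sum_list ns" for j
    using cases[OF that] block_perm_apply[OF \<sigma>] block_pos_less Sym_apply_less[OF \<sigma>] by metis
  show "j = j'" if j: "j < sum_list ns" "j' < sum_list ns" "block_perm ns \<sigma> j = block_perm ns \<sigma> j'" for j j'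
  proof -
    obtain i r where i: "i < length ns" "r < ns ! \<sigma> i" "j = block_start ?ms i + r"
      using cases[OF j(1)] by blast
    obtain i' r' where i': "i' < length ns" "r' < ns ! \<sigma> i'" "j' = block_start ?ms i' + r'"
      using cases[OF j(2)] by blast
    have "\<sigma> i = \<sigma> i' \<and> r = r'"
      using block_pos_inj[OF Sym_apply_less[OF \<sigma> i(1)] i(2) Sym_apply_less[OF \<sigma> i'(1)] i'(2)]
        block_perm_apply[OF \<sigma>] i i' j(3) by simp
    moreover have "inj_on \<sigma> {..<length ns}"
      using Sym_bij_betw[OF \<sigma>] by (simp add: bij_betw_def)
    ultimately show ?thesis
      using i i' by (auto simp: inj_on_def)
  qed
qed

lemma block_sum_closed:
  assumes \<tau>: "\<And>i. i < length ns \<Longrightarrow> \<tau> i \<in> carrier (Sym (ns ! i))"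
  shows "block_sum ns \<tau> \<in> carrier (Sym (sum_list ns))"
proof (rule SymI)
  show "block_sum ns \<tau> \<in> extensional {..<sum_list ns}"
    by (simp add: block_sum_def)
  show "block_sum ns \<tau> j < sum_list ns" if j: "j < sum_list ns" for j
    using j by (rule block_cases) (simp add: block_sum_apply block_pos_less Sym_apply_less[OF \<tau>])
  show "j = j'" if j: "j < sum_list ns" "j' < sum_list ns" "block_sum ns \<tau> j = block_sum ns \<tau> j'" for j j'
  proof -
    obtain i r where i: "i < length ns" "r < ns ! i" "j = block_start ns i + r"
      using block_cases[OF j(1)] by blast
    obtain i' r' where i': "i' < length ns" "r' < ns ! i'" "j' = block_start ns i' + r'"
      using block_cases[OF j(2)] by blast
    have "i = i' \<and> \<tau> i r = \<tau> i' r'"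
      using block_pos_inj[OF i(1) Sym_apply_less[OF \<tau> i(2)] i'(1) Sym_apply_less[OF \<tau> i'(2)]]
        i i' j(3) by (simp add: block_sum_apply)
    moreover have "inj_on (\<tau> i) {..<ns ! i}"
      using Sym_bij_betw[OF \<tau>[OF i(1)]] by (simp add: bij_betw_def)
    ultimately show ?thesis
      using i i' by (auto simp: inj_on_def)
  qed
qed

section \<open>Admissible sets\<close>

text \<open>In contrast to \<open>group_action\<close>, the action need not be extensional. An
  invariant subset, such as an orbit or a fibre, can thus keep the action function of the whole set,
  and restriction to a subgroup changes nothing.\<close>

definition hset_action :: "('g, 'm) monoid_scheme \<Rightarrow> 'g set \<Rightarrow> ('g, 'b) hset \<Rightarrow> bool" where
  "hset_action G H T \<longleftrightarrow>
     (\<forall>h \<in> H. \<forall>x \<in> fst T. snd T h x \<in> fst T) \<and> (\<forall>x \<in> fst T. snd T \<one>\<^bsub>G\<^esub> x = x) \<and>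
     (\<forall>h \<in> H. \<forall>k \<in> H. \<forall>x \<in> fst T. snd T (h \<otimes>\<^bsub>G\<^esub> k) x = snd T h (snd T k x))"

text \<open>The graph of the action homomorphism of \<open>T\<close>, for the ordering \<open>e\<close>, fixes the operation \<open>x\<close>.\<close>

definition fixes_graph ::
  "('g, 'a) operad_data \<Rightarrow> 'g set \<Rightarrow> ('g, 'b) hset \<Rightarrow> nat \<Rightarrow> (nat \<Rightarrow> 'b) \<Rightarrow> 'a \<Rightarrow> bool" where
  "fixes_graph P H T n e x \<longleftrightarrow>
     bij_betw e {..<n} (fst T) \<and> x \<in> ops P n \<and>
     (\<forall>h \<in> H. \<exists>\<sigma> \<in> carrier (Sym n). (\<forall>i<n. e (\<sigma> i) = snd T h (e i)) \<and> oact P n (h, \<sigma>) x = x)"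

definition admissible :: "('g, 'a) operad_data \<Rightarrow> 'g set \<Rightarrow> ('g, 'b) hset \<Rightarrow> bool" where
  "admissible P H T \<longleftrightarrow> (\<exists>n e x. fixes_graph P H T n e x)"

lemma admissible_subgroup: "admissible P H T \<Longrightarrow> K \<subseteq> H \<Longrightarrow> admissible P K T"
  unfolding admissible_def fixes_graph_def by blast

text \<open>The operation stays the same; only the ordering is composed with the
  isomorphism.\<close>

lemma admissible_iso:
  assumes "admissible P H S" "hset_iso H S T"
  shows "admissible P H T"
proof -
  obtain n e x where S: "bij_betw e {..<n} (fst S)" "x \<in> ops P n"
    "\<And>h. h \<in> H \<Longrightarrow> \<exists>\<sigma> \<in> carrier (Sym n). (\<forall>i<n. e (\<sigma> i) = snd S h (e i)) \<and> oact P n (h, \<sigma>) x = x"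
    using assms(1) unfolding admissible_def fixes_graph_def by blast
  obtain f where f: "bij_betw f (fst S) (fst T)"
    "\<And>h x. h \<in> H \<Longrightarrow> x \<in> fst S \<Longrightarrow> f (snd S h x) = snd T h (f x)"
    using assms(2) unfolding hset_iso_def by blast
  have "\<exists>\<sigma> \<in> carrier (Sym n). (\<forall>i<n. (f \<circ> e) (\<sigma> i) = snd T h ((f \<circ> e) i)) \<and> oact P n (h, \<sigma>) x = x"
    if "h \<in> H" for h
  proof -
    obtain \<sigma> where \<sigma>: "\<sigma> \<in> carrier (Sym n)" "\<And>i. i < n \<Longrightarrow> e (\<sigma> i) = snd S h (e i)" "oact P n (h, \<sigma>) x = x"
      using S(3)[OF \<open>h \<in> H\<close>] by blast
    have "(f \<circ> e) (\<sigma> i) = snd T h ((f \<circ> e) i)" if "i < n" for i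
      using \<sigma>(2)[OF that] f(2)[OF \<open>h \<in> H\<close>, of "e i"] bij_betwE[OF S(1)] that by simp
    with \<sigma> show ?thesis
      by blast
  qed
  then have "fixes_graph P H T n (f \<circ> e) x"
    using bij_betw_trans[OF S(1) f(1)] S(2) unfolding fixes_graph_def by blast
  then show ?thesis
    unfolding admissible_def by blast
qed

lemma hset_iso_refl: "hset_iso H T T"
  unfolding hset_iso_def by (intro exI[of _ id]) auto

section \<open>Admissible sets over an admissible base\<close>

lemma (in G_operad) ocomp_closed:
  assumes "x \<in> ops P (length ns)" "y \<in> inputs P ns"
  shows "ocomp P ns x y \<in> ops P (sum_list ns)"
proof -
  have "(x, y) \<in> topspace (prod_topology (ospace P (length ns))
            (product_topology (\<lambda>i. ospace P (ns ! i)) {..<length ns}))"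
    using assms by simp
  then show ?thesis
    using continuous_map_image_subset_topspace[OF comp_continuous[of ns]] by fastforce
qed

text \<open>The operation for \<open>E\<close> is the composite of an operation for \<open>B\<close>
  with the operations \<open>Y b\<close>, where \<open>Y b\<close> has one input for each point of
  the fibre over \<open>b\<close>. The family \<open>Y\<close> has to be coherent: \<open>h\<close>
  takes \<open>Y b\<close> to \<open>Y (h b)\<close> up to the permutation by which \<open>h\<close>
  maps one fibre to the other.\<close>

lemma (in G_operad) admissible_compose:
  assumes H: "subgroup H G" and B: "admissible P H B"
    and p: "\<And>z. z \<in> fst E \<Longrightarrow> p z \<in> fst B"
    and bij: "\<And>b. b \<in> fst B \<Longrightarrow> bij_betw (\<epsilon> b) {..<N b} {z \<in> fst E. p z = b}"
    and Y: "\<And>b. b \<in> fst B \<Longrightarrow> Y b \<in> ops P (N b)"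
    and N: "\<And>h b. h \<in> H \<Longrightarrow> b \<in> fst B \<Longrightarrow> N (snd B h b) = N b"
    and eqv: "\<And>h b. h \<in> H \<Longrightarrow> b \<in> fst B \<Longrightarrow>
      \<exists>\<tau> \<in> carrier (Sym (N b)). (\<forall>j<N b. \<epsilon> (snd B h b) (\<tau> j) = snd E h (\<epsilon> b j)) \<and>
         oact P (N b) (h, \<tau>) (Y b) = Y (snd B h b)"
  shows "admissible P H E"
proof -
  obtain k c x where c: "bij_betw c {..<k} (fst B)" and x: "x \<in> ops P k"
    and \<sigma>: "\<And>h. h \<in> H \<Longrightarrow> \<exists>\<sigma> \<in> carrier (Sym k). (\<forall>i<k. c (\<sigma> i) = snd B h (c i)) \<and> oact P k (h, \<sigma>) x = x"
    using B unfolding admissible_def fixes_graph_def by blast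
  have cB: "c i \<in> fst B" if "i < k" for i
    using bij_betwE[OF c] that by blast
  define ns where "ns = map (N \<circ> c) [0..<k]"
  have ns: "length ns = k" "\<And>i. i < k \<Longrightarrow> ns ! i = N (c i)"
    by (auto simp: ns_def)
  define y where "y = (\<lambda>i \<in> {..<k}. Y (c i))"
  have y: "y \<in> inputs P ns"
    using Y cB ns by (auto simp: y_def)
  define z where "z = ocomp P ns x y"
  have z: "z \<in> ops P (sum_list ns)"
    unfolding z_def using x y ns by (intro ocomp_closed) auto
  define e where "e j = \<epsilon> (c (block_of ns j)) (j - block_start ns (block_of ns j))" for j
  have e: "e (block_start ns i + r) = \<epsilon> (c i) r" if "i < k" "r < N (c i)" for i r
    using that ns by (simp add: e_def block_of_pos)
  have e_bij: "bij_betw e {..<sum_list ns} (fst E)"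
    unfolding bij_betw_def
  proof (intro conjI inj_onI subset_antisym subsetI)
    fix j j' assume j: "j \<in> {..<sum_list ns}" "j' \<in> {..<sum_list ns}" "e j = e j'"
    obtain i r where i: "i < k" "r < N (c i)" "j = block_start ns i + r"
      using block_cases[of j ns] j(1) ns by (metis lessThan_iff)
    obtain i' r' where i': "i' < k" "r' < N (c i')" "j' = block_start ns i' + r'"
      using block_cases[of j' ns] j(2) ns by (metis lessThan_iff)
    have eq: "\<epsilon> (c i) r = \<epsilon> (c i') r'"
      using j(3) i i' e by simp
    have "\<epsilon> (c i) r \<in> {z \<in> fst E. p z = c i}" "\<epsilon> (c i') r' \<in> {z \<in> fst E. p z = c i'}"
      using bij_betwE[OF bij[OF cB]] i i' by blast+
    then have "c i = c i'"
      using eq by auto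
    then have "i = i'"
      using c i(1) i'(1) by (auto simp: bij_betw_def inj_on_def)
    moreover have "r = r'"
      using bij[OF cB[OF i(1)]] eq i i' \<open>i = i'\<close> by (auto simp: bij_betw_def inj_on_def)
    ultimately show "j = j'"
      using i i' by simp
  next
    fix w assume "w \<in> e ` {..<sum_list ns}"
    then obtain j where "j < sum_list ns" "w = e j"
      by blast
    then obtain i r where i: "i < k" "r < N (c i)" "w = e (block_start ns i + r)"
      using block_cases[of j ns] ns by metis
    then show "w \<in> fst E"
      using e bij_betwE[OF bij[OF cB]] by fastforce
  next
    fix w assume w: "w \<in> fst E"
    then obtain i where i: "i < k" "p w = c i"
      using p[OF w] c by (auto simp: bij_betw_def)
    then have "w \<in> \<epsilon> (c i) ` {..<N (c i)}"
      using bij[OF cB[OF i(1)]] w by (auto simp: bij_betw_def)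
    then obtain r where r: "r < N (c i)" "w = \<epsilon> (c i) r"
      by blast
    then have "w = e (block_start ns i + r)" "block_start ns i + r < sum_list ns"
      using e block_pos_less ns i by auto
    then show "w \<in> e ` {..<sum_list ns}"
      by blast
  qed
  have "\<exists>\<theta> \<in> carrier (Sym (sum_list ns)).
      (\<forall>j<sum_list ns. e (\<theta> j) = snd E h (e j)) \<and> oact P (sum_list ns) (h, \<theta>) z = z"
    if h: "h \<in> H" for h
  proof -
    have hG: "h \<in> carrier G"
      using subgroup.mem_carrier[OF H h] .
    obtain s where s: "s \<in> carrier (Sym k)" "\<And>i. i < k \<Longrightarrow> c (s i) = snd B h (c i)" "oact P k (h, s) x = x"
      using \<sigma>[OF h] by blast
    have "\<forall>i. \<exists>t. i < k \<longrightarrow> t \<in> carrier (Sym (N (c i))) \<and>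
        (\<forall>j<N (c i). \<epsilon> (snd B h (c i)) (t j) = snd E h (\<epsilon> (c i) j)) \<and>
        oact P (N (c i)) (h, t) (Y (c i)) = Y (snd B h (c i))"
      using eqv[OF h cB] by blast
    then obtain t where t: "\<And>i. i < k \<Longrightarrow> t i \<in> carrier (Sym (N (c i)))"
        "\<And>i j. i < k \<Longrightarrow> j < N (c i) \<Longrightarrow> \<epsilon> (snd B h (c i)) (t i j) = snd E h (\<epsilon> (c i) j)"
        "\<And>i. i < k \<Longrightarrow> oact P (N (c i)) (h, t i) (Y (c i)) = Y (snd B h (c i))"
      by metis
    have sk: "s i < k" if "i < k" for i
      using Sym_apply_less[OF s(1) that] .
    \<comment> \<open>Fibres over one orbit have the same size, so the outer permutation leaves the
      list of arities unchanged.\<close>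
    have perm: "permute_list_by s ns = ns"
    proof (rule nth_equalityI)
      fix i assume "i < length (permute_list_by s ns)"
      then show "permute_list_by s ns ! i = ns ! i"
        using ns sk s(2) N[OF h cB] by simp
    qed simp
    define v where "v = block_sum ns t"
    define u where "u = block_perm ns s"
    have u: "u \<in> carrier (Sym (sum_list ns))" and v: "v \<in> carrier (Sym (sum_list ns))"
      unfolding u_def v_def using s(1) t(1) ns by (auto intro!: block_perm_closed block_sum_closed)
    have hx: "gact P k h x \<in> ops P k"
      using gact_closed[OF hG x] .
    have "y (s i) = sact G P (ns ! i) (t i) (gact P (ns ! i) h (y i))" if "i < k" for i
      using that sk[OF that] s(2) t ns Y cB hG by (simp add: y_def gact_sact(2))
    then have yz: "(\<lambda>i \<in> {..<length ns}. y (s i)) =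
        (\<lambda>i \<in> {..<length ns}. sact G P (ns ! i) (t i) ((\<lambda>i \<in> {..<length ns}. gact P (ns ! i) h (y i)) i))"
      using ns by (intro restrict_ext) auto
    have hy: "(\<lambda>i \<in> {..<length ns}. gact P (ns ! i) h (y i)) \<in> inputs P ns"
      using y by (auto intro!: gact_closed[OF hG])
    \<comment> \<open>In \<open>x = (h, s) x\<close> the outer symmetry moves \<open>s\<close> out
      as \<open>u\<close> and permutes the inner operations. By coherence these are
      \<open>t i\<close> applied to translates by \<open>h\<close>. The inner symmetry moves the
      \<open>t i\<close> out as \<open>v\<close>, equivariance moves \<open>h\<close> out, and
      \<open>z\<close> turns out to be fixed by \<open>h\<close> together with the product of
      \<open>u\<close> and \<open>v\<close>.\<close>
    have "z = ocomp P ns (sact G P k s (gact P k h x)) y"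
      using gact_sact(2)[OF hG s(1) x] s(3) by (simp add: z_def)
    also have "\<dots> = sact G P (sum_list ns) u (ocomp P ns (gact P k h x) (\<lambda>i \<in> {..<length ns}. y (s i)))"
      using comp_outer_symmetry[of s ns "gact P k h x" y] s(1) hx y ns perm by (simp add: u_def)
    also have "ocomp P ns (gact P k h x) (\<lambda>i \<in> {..<length ns}. y (s i)) =
        sact G P (sum_list ns) v (ocomp P ns (gact P k h x) (\<lambda>i \<in> {..<length ns}. gact P (ns ! i) h (y i)))"
      unfolding yz v_def by (rule comp_inner_symmetry[OF _ _ hy]) (use t(1) hx ns in auto)
    also have "ocomp P ns (gact P k h x) (\<lambda>i \<in> {..<length ns}. gact P (ns ! i) h (y i)) =
        gact P (sum_list ns) h z"
      using comp_equivariant[OF hG, of x ns y] x y ns by (simp add: z_def)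
    also have "sact G P (sum_list ns) v (gact P (sum_list ns) h z) = oact P (sum_list ns) (h, v) z"
      using gact_sact(2)[OF hG v z] .
    also have "sact G P (sum_list ns) u (oact P (sum_list ns) (h, v) z) =
        oact P (sum_list ns) (h, u \<otimes>\<^bsub>Sym (sum_list ns)\<^esub> v) z"
      using oact_oact[OF one_closed u hG v z] hG by simp
    finally have zfix: "oact P (sum_list ns) (h, u \<otimes>\<^bsub>Sym (sum_list ns)\<^esub> v) z = z"
      by simp
    have "e ((u \<otimes>\<^bsub>Sym (sum_list ns)\<^esub> v) j) = snd E h (e j)" if j: "j < sum_list ns" for j
    proof -
      obtain i r where i: "i < k" "r < N (c i)" "j = block_start ns i + r"
        using block_cases[OF j] ns by metis
      have tr: "t i r < N (c i)"
        using Sym_apply_less[OF t(1)[OF i(1)] i(2)] .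
      have Ns: "N (c (s i)) = N (c i)"
        using s(2) N[OF h cB] i(1) by simp
      have "(u \<otimes>\<^bsub>Sym (sum_list ns)\<^esub> v) j = u (v j)"
        by (rule mult_Sym_apply[OF u v j])
      also have "v j = block_start ns i + t i r"
        using block_sum_apply[of i ns r t] i ns by (simp add: v_def)
      also have "u \<dots> = block_start ns (s i) + t i r"
        using block_perm_apply[of s ns i "t i r"] s(1) i tr ns sk Ns perm by (simp add: u_def)
      finally show ?thesis
        using e[OF sk[OF i(1)], of "t i r"] tr Ns e[OF i(1,2)] s(2) t(2) i by simp
    qed
    moreover have "u \<otimes>\<^bsub>Sym (sum_list ns)\<^esub> v \<in> carrier (Sym (sum_list ns))"
      using u v by (intro monoid.m_closed[OF group.is_monoid[OF group_Sym]])
    ultimately show ?thesis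
      using zfix by blast
  qed
  then have "fixes_graph P H E (sum_list ns) e z"
    using e_bij z unfolding fixes_graph_def by blast
  then show ?thesis
    unfolding admissible_def by blast
qed

text \<open>A coherent family for \<open>admissible_compose\<close> is obtained by choosing in each
  orbit of \<open>B\<close> a point whose fibre is admissible for its stabilizer and translating the
  operation found there along the orbit. This is the common source of the closure
  properties.\<close>

lemma (in G_operad) admissible_fibration:
  assumes H: "subgroup H G" and E: "hset_action G H E" and B: "hset_action G H B" "admissible P H B"
    and p: "\<And>z. z \<in> fst E \<Longrightarrow> p z \<in> fst B"
    and p_eqv: "\<And>h z. h \<in> H \<Longrightarrow> z \<in> fst E \<Longrightarrow> p (snd E h z) = snd B h (p z)"
    and fibre: "\<And>b. b \<in> fst B \<Longrightarrow> \<exists>h \<in> H.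
      admissible P {k \<in> H. snd B k (snd B h b) = snd B h b} ({z \<in> fst E. p z = snd B h b}, snd E)"
  shows "admissible P H E"
proof -
  interpret H: subgroup H G
    by (rule H)
  have HG: "h \<in> carrier G" if "h \<in> H" for h
    using subgroup.mem_carrier[OF H that] .
  have Ec: "\<And>h z. h \<in> H \<Longrightarrow> z \<in> fst E \<Longrightarrow> snd E h z \<in> fst E"
    and Em: "\<And>h k z. h \<in> H \<Longrightarrow> k \<in> H \<Longrightarrow> z \<in> fst E \<Longrightarrow> snd E (h \<otimes> k) z = snd E h (snd E k z)"
    and E1: "\<And>z. z \<in> fst E \<Longrightarrow> snd E \<one> z = z"
    using E by (auto simp: hset_action_def)
  have Bc: "\<And>h b. h \<in> H \<Longrightarrow> b \<in> fst B \<Longrightarrow> snd B h b \<in> fst B"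
    and Bm: "\<And>h k b. h \<in> H \<Longrightarrow> k \<in> H \<Longrightarrow> b \<in> fst B \<Longrightarrow> snd B (h \<otimes> k) b = snd B h (snd B k b)"
    and B1: "\<And>b. b \<in> fst B \<Longrightarrow> snd B \<one> b = b"
    using B(1) by (auto simp: hset_action_def)
  define orb where "orb b = (\<lambda>h. snd B h b) ` H" for b
  define S where "S b = {k \<in> H. snd B k b = b}" for b
  define F where "F b = {z \<in> fst E. p z = b}" for b
  define good where "good b \<longleftrightarrow> b \<in> fst B \<and> admissible P (S b) (F b, snd E)" for b
  \<comment> \<open>The choice depends on the orbit only, so \<open>rep\<close> is constant on
    orbits.\<close>
  define rep where "rep b = (SOME b'. b' \<in> orb b \<and> good b')" for b
  have rep: "rep b \<in> orb b \<and> good (rep b)" if "b \<in> fst B" for b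
  proof -
    have "\<exists>b'. b' \<in> orb b \<and> good b'"
      using fibre[OF that] Bc that unfolding orb_def good_def S_def F_def by blast
    then show ?thesis
      unfolding rep_def by (rule someI_ex)
  qed
  have orb_eq: "orb (snd B h b) = orb b" if h: "h \<in> H" and b: "b \<in> fst B" for h b
  proof -
    have "snd B k b = snd B (k \<otimes> inv h) (snd B h b)" if "k \<in> H" for k
      using Bm[of "k \<otimes> inv h" h b] that h b HG by (simp add: m_assoc)
    moreover have "snd B k (snd B h b) = snd B (k \<otimes> h) b" if "k \<in> H" for k
      using Bm that h b by simp
    moreover have "k \<otimes> inv h \<in> H" "k \<otimes> h \<in> H" if "k \<in> H" for k
      using that h by auto
    ultimately show ?thesis
      unfolding orb_def by (intro subset_antisym image_subsetI) (metis imageI)+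
  qed
  have rep_eq: "rep (snd B h b) = rep b" if "h \<in> H" "b \<in> fst B" for h b
    unfolding rep_def orb_eq[OF that] ..
  have "\<forall>b. \<exists>g. b \<in> fst B \<longrightarrow> g \<in> H \<and> snd B g (rep b) = b"
  proof (intro allI)
    fix b
    show "\<exists>g. b \<in> fst B \<longrightarrow> g \<in> H \<and> snd B g (rep b) = b"
    proof (cases "b \<in> fst B")
      case True
      then obtain h where h: "h \<in> H" "rep b = snd B h b"
        using rep by (auto simp: orb_def)
      then have "snd B (inv h) (rep b) = b"
        using Bm[of "inv h" h b] B1 True HG by simp
      then show ?thesis
        using h by blast
    qed blast
  qed
  then obtain g where g: "\<And>b. b \<in> fst B \<Longrightarrow> g b \<in> H" "\<And>b. b \<in> fst B \<Longrightarrow> snd B (g b) (rep b) = b"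
    by metis
  have "\<forall>b. \<exists>n e y. good b \<longrightarrow> fixes_graph P (S b) (F b, snd E) n e y"
    unfolding good_def admissible_def by blast
  then obtain n e y where fg: "\<And>b. good b \<Longrightarrow> fixes_graph P (S b) (F b, snd E) (n b) (e b) (y b)"
    by metis
  have repB: "rep b \<in> fst B" "good (rep b)" if "b \<in> fst B" for b
    using rep[OF that] by (auto simp: good_def)
  define N where "N b = n (rep b)" for b
  define \<epsilon> where "\<epsilon> b j = snd E (g b) (e (rep b) j)" for b j
  define Y where "Y b = gact P (N b) (g b) (y (rep b))" for b
  have eb: "bij_betw (e (rep b)) {..<N b} (F (rep b))" and yb: "y (rep b) \<in> ops P (N b)"
    if "b \<in> fst B" for b
    using fg[OF repB(2)[OF that]] by (auto simp: fixes_graph_def N_def)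
  have eE: "e (rep b) j \<in> fst E" "p (e (rep b) j) = rep b" if "b \<in> fst B" "j < N b" for b j
    using bij_betwE[OF eb[OF that(1)]] that(2) by (auto simp: F_def)
  have g_bij: "bij_betw (snd E (g b)) (F (rep b)) (F b)" if b: "b \<in> fst B" for b
  proof (rule bij_betw_byWitness[where f' = "snd E (inv (g b))"])
    have inv: "snd E (inv (g b)) (snd E (g b) z) = z" "snd E (g b) (snd E (inv (g b)) z) = z" if "z \<in> fst E" for z
      using Em[of "inv (g b)" "g b" z] Em[of "g b" "inv (g b)" z] g(1)[OF b] E1 that HG by auto
    then show "\<forall>z \<in> F (rep b). snd E (inv (g b)) (snd E (g b) z) = z"
      "\<forall>z \<in> F b. snd E (g b) (snd E (inv (g b)) z) = z"
      by (auto simp: F_def)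
    show "snd E (g b) ` F (rep b) \<subseteq> F b"
      using Ec p_eqv g b by (auto simp: F_def)
    have "snd B (inv (g b)) b = rep b"
      using Bm[of "inv (g b)" "g b" "rep b"] g[OF b] B1 repB[OF b] HG by simp
    then show "snd E (inv (g b)) ` F b \<subseteq> F (rep b)"
      using Ec p_eqv g b by (auto simp: F_def)
  qed
  show ?thesis
  proof (rule admissible_compose[OF H B(2) p])
    fix b assume b: "b \<in> fst B"
    show "Y b \<in> ops P (N b)"
      unfolding Y_def by (rule gact_closed[OF HG[OF g(1)[OF b]] yb[OF b]])
    have "bij_betw (\<epsilon> b) {..<N b} (F b)"
      using bij_betw_trans[OF eb[OF b] g_bij[OF b]] by (simp add: \<epsilon>_def[abs_def] o_def)
    then show "bij_betw (\<epsilon> b) {..<N b} {z \<in> fst E. p z = b}"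
      by (simp add: F_def)
  next
    fix h b assume h: "h \<in> H" and b: "b \<in> fst B"
    show Nh: "N (snd B h b) = N b"
      unfolding N_def rep_eq[OF h b] ..
    have hb: "snd B h b \<in> fst B"
      using Bc h b by blast
    let ?g = "g (snd B h b)"
    have gs: "?g \<in> H" "g b \<in> H" "snd B ?g (rep b) = snd B h b" "snd B (g b) (rep b) = b"
      using g[OF hb] g[OF b] rep_eq[OF h b] by auto
    \<comment> \<open>Going from the representative to \<open>b\<close>, then by \<open>h\<close>,
      and back: this is an element of the stabilizer of the representative, and there the operation
      is known to be fixed up to a permutation. It measures the failure of the translations
      \<open>g\<close> to be compatible with \<open>h\<close>.\<close>
    define s where "s = inv ?g \<otimes> h \<otimes> g b"
    have s: "s \<in> H" "?g \<otimes> s = h \<otimes> g b"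
      using h gs HG by (auto simp: s_def m_assoc[symmetric])
    have "snd B s (rep b) = snd B (inv ?g) (snd B ?g (rep b))"
      unfolding s_def using h b gs Bm Bc repB[OF b] by simp
    also have "\<dots> = rep b"
      using Bm[of "inv ?g" ?g "rep b"] gs repB[OF b] B1 HG by simp
    finally have "s \<in> S (rep b)"
      using s by (simp add: S_def)
    then obtain \<tau> where \<tau>: "\<tau> \<in> carrier (Sym (N b))"
      "\<And>j. j < N b \<Longrightarrow> e (rep b) (\<tau> j) = snd E s (e (rep b) j)" "oact P (N b) (s, \<tau>) (y (rep b)) = y (rep b)"
      using fg[OF repB(2)[OF b]] unfolding fixes_graph_def N_def by auto
    have "\<epsilon> (snd B h b) (\<tau> j) = snd E h (\<epsilon> b j)" if "j < N b" for j
      using \<tau>(2)[OF that] Em[of ?g s "e (rep b) j"] Em[of h "g b" "e (rep b) j"] eE[OF b that] s gs h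
      by (simp add: \<epsilon>_def rep_eq[OF h b])
    moreover have "oact P (N b) (h, \<tau>) (Y b) = Y (snd B h b)"
    proof -
      interpret S: group "Sym (N b)"
        by (rule group_Sym)
      have c: "h \<in> carrier G" "g b \<in> carrier G" "?g \<in> carrier G" "s \<in> carrier G"
        using h gs s HG by auto
      have "oact P (N b) (h, \<tau>) (Y b) = oact P (N b) (h \<otimes> g b, \<tau>) (y (rep b))"
        unfolding Y_def using oact_oact[OF c(1) \<tau>(1) c(2) S.one_closed yb[OF b]] \<tau>(1) by simp
      also have "\<dots> = gact P (N b) ?g (oact P (N b) (s, \<tau>) (y (rep b)))"
        using oact_oact[OF c(3) S.one_closed c(4) \<tau>(1) yb[OF b]] \<tau>(1) s(2) by simp
      finally show ?thesis
        unfolding Y_def \<tau>(3) Nh rep_eq[OF h b] .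
    qed
    ultimately show "\<exists>\<tau> \<in> carrier (Sym (N b)). (\<forall>j<N b. \<epsilon> (snd B h b) (\<tau> j) = snd E h (\<epsilon> b j)) \<and>
         oact P (N b) (h, \<tau>) (Y b) = Y (snd B h b)"
      using \<tau>(1) by blast
  qed
qed

lemma hset_iso_sym:
  assumes "hset_iso H S T" and closed: "\<And>h x. h \<in> H \<Longrightarrow> x \<in> fst S \<Longrightarrow> snd S h x \<in> fst S"
  shows "hset_iso H T S"
proof -
  obtain f where f: "bij_betw f (fst S) (fst T)"
    "\<And>h x. h \<in> H \<Longrightarrow> x \<in> fst S \<Longrightarrow> f (snd S h x) = snd T h (f x)"
    using assms(1) unfolding hset_iso_def by blast
  let ?g = "inv_into (fst S) f"
  have "?g (snd T h y) = snd S h (?g y)" if "h \<in> H" "y \<in> fst T" for h y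
  proof -
    have gy: "?g y \<in> fst S" "f (?g y) = y"
      using f(1) that by (auto simp: bij_betw_def inv_into_into f_inv_into_f)
    then have "snd T h y = f (snd S h (?g y))"
      using f(2) that by simp
    then show ?thesis
      using f(1) closed[OF that(1) gy(1)] by (simp add: bij_betw_def)
  qed
  then show ?thesis
    using bij_betw_inv_into[OF f(1)] unfolding hset_iso_def by blast
qed

lemma admissible_finite: "admissible P H T \<Longrightarrow> finite (fst T)"
  unfolding admissible_def fixes_graph_def using bij_betw_finite by blast

lemma finite_hset_action:
  assumes "group G" "subgroup H G" "finite_hset G H T"
  shows "hset_action G H T"
proof -
  interpret group_action "G\<lparr>carrier := H\<rparr>" "fst T" "snd T"
    using assms(3) by (simp add: finite_hset_def)
  show ?thesis
    unfolding hset_action_def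
  proof (intro conjI ballI)
    show "snd T \<one>\<^bsub>G\<^esub> x = x" if "x \<in> fst T" for x
      using fun_cong[OF id_eq_one, of x] that by simp
    show "snd T h x \<in> fst T" if "h \<in> H" "x \<in> fst T" for h x
      using element_image[of h x "snd T h x"] that by simp
    show "snd T (h \<otimes>\<^bsub>G\<^esub> k) x = snd T h (snd T k x)" if "h \<in> H" "k \<in> H" "x \<in> fst T" for h k x
      using composition_rule[of x h k] that by simp
  qed
qed

section \<open>Admissible sets and the indexing system of an operad\<close>

context N_infinity_operad
begin

lemma N_inf: "N_infinity_operad G P"
  by (rule N_infinity_operad_axioms)

text \<open>Freeness is applied at the operation \<open>g x\<close>, which the quotient of the two
  permutations fixes.\<close>

lemma oact_eq_imp_eq:
  assumes g: "g \<in> carrier G" and \<sigma>: "\<sigma> \<in> carrier (Sym n)" and \<tau>: "\<tau> \<in> carrier (Sym n)"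
    and x: "x \<in> ops P n" and eq: "oact P n (g, \<sigma>) x = oact P n (g, \<tau>) x"
  shows "\<sigma> = \<tau>"
proof -
  interpret S: group "Sym n"
    by (rule group_Sym)
  let ?y = "gact P n g x" and ?i = "inv\<^bsub>Sym n\<^esub> \<tau>"
  have y: "?y \<in> ops P n"
    by (rule gact_closed[OF g x])
  have eq': "sact G P n \<sigma> ?y = sact G P n \<tau> ?y"
    using eq by (simp add: gact_sact(2) g \<sigma> \<tau> x)
  have "sact G P n (?i \<otimes>\<^bsub>Sym n\<^esub> \<sigma>) ?y = sact G P n ?i (sact G P n \<sigma> ?y)"
    using oact_oact[OF one_closed S.inv_closed[OF \<tau>] one_closed \<sigma> y] by simp
  also have "\<dots> = sact G P n (?i \<otimes>\<^bsub>Sym n\<^esub> \<tau>) ?y"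
    unfolding eq' using oact_oact[OF one_closed S.inv_closed[OF \<tau>] one_closed \<tau> y] by simp
  also have "\<dots> = ?y"
    by (simp only: S.l_inv[OF \<tau>] oact_one[OF y])
  finally have "?i \<otimes>\<^bsub>Sym n\<^esub> \<sigma> = \<one>\<^bsub>Sym n\<^esub>"
    using free[OF S.m_closed[OF S.inv_closed[OF \<tau>] \<sigma>] y] by simp
  then have "inv\<^bsub>Sym n\<^esub> ?i = \<sigma>"
    by (metis S.inv_closed S.inv_equality S.inv_inv S.inv_comm \<sigma> \<tau>)
  then show ?thesis
    using S.inv_inv[OF \<tau>] by simp
qed

text \<open>\<open>fixes_graph\<close> provides a permutation for each \<open>h\<close> separately.
  By freeness it is the only one over \<open>h\<close> that fixes \<open>x\<close>, so the
  permutations multiply as the group elements do, and their graph is a subgroup.\<close>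

lemma fixes_graph_imp_family:
  assumes H: "subgroup H G" and fg: "fixes_graph P H T n e x"
  obtains \<rho> where "finite_hset G H ({..<n}, \<rho>)" "hset_iso H ({..<n}, \<rho>) T"
    "{(h, \<rho> h) | h. h \<in> H} \<in> operad_family G P n"
proof -
  interpret S: group "Sym n"
    by (rule group_Sym)
  have HG: "h \<in> carrier G" if "h \<in> H" for h
    using subgroup.mem_carrier[OF H that] .
  have x: "x \<in> ops P n" and e: "bij_betw e {..<n} (fst T)"
    using fg by (auto simp: fixes_graph_def)
  obtain \<rho> where \<rho>: "\<And>h. h \<in> H \<Longrightarrow> \<rho> h \<in> carrier (Sym n)"
      "\<And>h i. h \<in> H \<Longrightarrow> i < n \<Longrightarrow> e (\<rho> h i) = snd T h (e i)" "\<And>h. h \<in> H \<Longrightarrow> oact P n (h, \<rho> h) x = x"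
    using fg unfolding fixes_graph_def by metis
  have mult: "\<rho> (h \<otimes> k) = \<rho> h \<otimes>\<^bsub>Sym n\<^esub> \<rho> k" if "h \<in> H" "k \<in> H" for h k
  proof (rule oact_eq_imp_eq[where x = x])
    show "oact P n (h \<otimes> k, \<rho> (h \<otimes> k)) x = oact P n (h \<otimes> k, \<rho> h \<otimes>\<^bsub>Sym n\<^esub> \<rho> k) x"
      using oact_oact[OF HG[OF that(1)] \<rho>(1)[OF that(1)] HG[OF that(2)] \<rho>(1)[OF that(2)] x]
        \<rho>(3) that subgroup.m_closed[OF H that] by simp
  qed (use HG \<rho>(1) that x subgroup.m_closed[OF H that] in auto)
  have grp: "group (G\<lparr>carrier := H\<rparr>)"
    by (rule subgroup.subgroup_is_group[OF H is_group])
  have hom: "group_hom (G\<lparr>carrier := H\<rparr>) (Sym n) \<rho>"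
    unfolding group_hom_def group_hom_axioms_def hom_def
    using grp S.group_axioms \<rho>(1) mult by auto
  have inv: "\<rho> (inv h) = inv\<^bsub>Sym n\<^esub> (\<rho> h)" if "h \<in> H" for h
    using group_hom.hom_inv[OF hom, of h] that m_inv_consistent[OF H that] by simp
  have "finite_hset G H ({..<n}, \<rho>)"
    using hom by (simp add: finite_hset_def group_action_def)
  moreover have "hset_iso H ({..<n}, \<rho>) T"
    unfolding hset_iso_def using e \<rho>(2) by (intro exI[of _ e]) auto
  moreover have "{(h, \<rho> h) | h. h \<in> H} \<in> operad_family G P n"
  proof -
    interpret A: group "G \<times>\<times> Sym n"
      by (rule group_DirProd_Sym)
    have "subgroup {(h, \<rho> h) | h. h \<in> H} (G \<times>\<times> Sym n)"
    proof (rule A.subgroupI)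
      show "{(h, \<rho> h) | h. h \<in> H} \<noteq> {}"
        using subgroup.one_closed[OF H] by blast
      show "{(h, \<rho> h) | h. h \<in> H} \<subseteq> carrier (G \<times>\<times> Sym n)"
        using HG \<rho>(1) by (auto simp: DirProd_def)
      show "inv\<^bsub>G \<times>\<times> Sym n\<^esub> a \<in> {(h, \<rho> h) | h. h \<in> H}" if "a \<in> {(h, \<rho> h) | h. h \<in> H}" for a
        using that inv HG \<rho>(1) subgroup.m_inv_closed[OF H] by (auto simp: inv_DirProd is_group group_Sym)
      show "a \<otimes>\<^bsub>G \<times>\<times> Sym n\<^esub> b \<in> {(h, \<rho> h) | h. h \<in> H}"
        if "a \<in> {(h, \<rho> h) | h. h \<in> H}" "b \<in> {(h, \<rho> h) | h. h \<in> H}" for a b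
        using that mult subgroup.m_closed[OF H] by (auto simp: DirProd_def)
    qed
    moreover have "x \<in> fixed_set P n {(h, \<rho> h) | h. h \<in> H}"
      using x \<rho>(3) by (auto simp: fixed_set_def)
    ultimately show ?thesis
      unfolding operad_family_eq[OF N_inf] by blast
  qed
  ultimately show thesis
    using that by blast
qed

lemma family_imp_admissible:
  assumes "{(h, \<rho> h) | h. h \<in> H} \<in> operad_family G P n"
  shows "admissible P H ({..<n}, \<rho>)"
proof -
  have sub: "subgroup {(h, \<rho> h) | h. h \<in> H} (G \<times>\<times> Sym n)" and "fixed_set P n {(h, \<rho> h) | h. h \<in> H} \<noteq> {}"
    using assms unfolding operad_family_eq[OF N_inf] by blast+
  then obtain x where x: "x \<in> ops P n" "\<And>h. h \<in> H \<Longrightarrow> oact P n (h, \<rho> h) x = x"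
    by (auto simp: fixed_set_def)
  have "\<rho> h \<in> carrier (Sym n)" if "h \<in> H" for h
    using subgroup.subset[OF sub] that by (auto simp: DirProd_def)
  then have "fixes_graph P H ({..<n}, \<rho>) n id x"
    using x unfolding fixes_graph_def by auto
  then show ?thesis
    unfolding admissible_def by blast
qed

lemma operad_indexing_system_iff:
  assumes H: "subgroup H G"
  shows "T \<in> operad_indexing_system G P H \<longleftrightarrow> finite_hset G H T \<and> admissible P H T"
proof (intro iffI conjI)
  assume "T \<in> operad_indexing_system G P H"
  then obtain n \<rho> where T: "finite_hset G H T" "finite_hset G H ({..<n}, \<rho>)" "hset_iso H T ({..<n}, \<rho>)"
      "{(h, \<rho> h) | h. h \<in> H} \<in> operad_family G P n"
    unfolding operad_indexing_system_def by blast
  show "finite_hset G H T"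
    by (rule T(1))
  have "hset_iso H ({..<n}, \<rho>) T"
    using hset_iso_sym[OF T(3)] finite_hset_action[OF is_group H T(1)] by (simp add: hset_action_def)
  then show "admissible P H T"
    using admissible_iso family_imp_admissible[OF T(4)] by blast
next
  assume T: "finite_hset G H T \<and> admissible P H T"
  then obtain n e x where "fixes_graph P H T n e x"
    unfolding admissible_def by blast
  from fixes_graph_imp_family[OF H this] obtain \<rho> where \<rho>: "finite_hset G H ({..<n}, \<rho>)"
    "hset_iso H ({..<n}, \<rho>) T" "{(h, \<rho> h) | h. h \<in> H} \<in> operad_family G P n" .
  have "hset_iso H T ({..<n}, \<rho>)"
    using hset_iso_sym[OF \<rho>(2)] finite_hset_action[OF is_group H \<rho>(1)] by (simp add: hset_action_def)
  then show "T \<in> operad_indexing_system G P H"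
    unfolding operad_indexing_system_def using T \<rho> by blast
qed

text \<open>The points of \<open>T\<close> may have any type. An admissible \<open>T\<close> is
  replaced by the isomorphic set on \<open>{..<n}\<close> that its ordering provides.\<close>

lemma hset_in_iff_admissible:
  assumes H: "subgroup H G"
  shows "hset_in (operad_indexing_system G P) H T \<longleftrightarrow> admissible P H T"
proof
  assume "hset_in (operad_indexing_system G P) H T"
  then show "admissible P H T"
    unfolding hset_in_def using operad_indexing_system_iff[OF H] admissible_iso by blast
next
  assume "admissible P H T"
  then obtain n e x where "fixes_graph P H T n e x"
    unfolding admissible_def by blast
  from fixes_graph_imp_family[OF H this] obtain \<rho> where \<rho>: "finite_hset G H ({..<n}, \<rho>)"
    "hset_iso H ({..<n}, \<rho>) T" "{(h, \<rho> h) | h. h \<in> H} \<in> operad_family G P n" .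
  then have "({..<n}, \<rho>) \<in> operad_indexing_system G P H"
    unfolding operad_indexing_system_def using hset_iso_refl by blast
  then show "hset_in (operad_indexing_system G P) H T"
    unfolding hset_in_def using \<rho>(2) by blast
qed

lemma operad_norms_eq:
  "operad_norms G P = {(K, H) \<in> norm_symbols G. admissible P H (coset_hset G H K)}"
proof -
  have "hset_in (operad_indexing_system G P) H (coset_hset G H K) \<longleftrightarrow> admissible P H (coset_hset G H K)"
    if "(K, H) \<in> norm_symbols G" for K H
    using that by (intro hset_in_iff_admissible) (simp add: norm_symbols_def)
  then show ?thesis
    unfolding operad_norms_def by fast
qed

section \<open>Closure properties of admissible sets\<close>

text \<open>Every arity has an operation fixed by all of \<open>G\<close>; it serves with identity
  permutations.\<close>

lemma admissible_trivial:
  assumes "finite (fst T)" "H \<subseteq> carrier G" "\<And>h x. h \<in> H \<Longrightarrow> x \<in> fst T \<Longrightarrow> snd T h x = x"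
  shows "admissible P H T"
proof -
  interpret S: group "Sym (card (fst T))"
    by (rule group_Sym)
  obtain e where e: "bij_betw e {..<card (fst T)} (fst T)"
    using ex_bij_betw_nat_finite[OF assms(1)] by (auto simp: atLeast0LessThan)
  obtain x where x: "x \<in> ops P (card (fst T))" "\<And>g. g \<in> carrier G \<Longrightarrow> gact P (card (fst T)) g x = x"
    using ex_G_fixed[OF N_inf] by blast
  have "fixes_graph P H T (card (fst T)) e x"
    unfolding fixes_graph_def
  proof (intro conjI ballI bexI[of _ "\<one>\<^bsub>Sym (card (fst T))\<^esub>"])
    show "\<forall>i<card (fst T). e (\<one>\<^bsub>Sym (card (fst T))\<^esub> i) = snd T h (e i)" if "h \<in> H" for h
      using assms(3)[OF that] bij_betwE[OF e] by (auto simp: one_Sym)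
  qed (use e x assms(2) S.one_closed in auto)
  then show ?thesis
    unfolding admissible_def by blast
qed

text \<open>The stabilizer of a point in the image acts trivially on its one-point fibre. Over a
  point outside the image the fibre is empty, which amounts to plugging a nullary operation into
  that input.\<close>

lemma admissible_inj:
  assumes H: "subgroup H G" and S: "hset_action G H S" and T: "hset_action G H T" "admissible P H T"
    and f: "inj_on f (fst S)" "\<And>x. x \<in> fst S \<Longrightarrow> f x \<in> fst T"
      "\<And>h x. h \<in> H \<Longrightarrow> x \<in> fst S \<Longrightarrow> f (snd S h x) = snd T h (f x)"
  shows "admissible P H S"
proof (rule admissible_fibration[OF H S T f(2,3)])
  fix b assume b: "b \<in> fst T"
  have one: "snd T \<one> b = b"
    using T(1) b by (simp add: hset_action_def)
  have "admissible P {k \<in> H. snd T k b = b} ({z \<in> fst S. f z = b}, snd S)"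
  proof (rule admissible_trivial)
    have "{z \<in> fst S. f z = b} \<subseteq> {inv_into (fst S) f b}"
      using f(1) by auto
    then show "finite (fst ({z \<in> fst S. f z = b}, snd S))"
      using finite_subset[OF _ finite.insertI[OF finite.emptyI]] by simp
    show "{k \<in> H. snd T k b = b} \<subseteq> carrier G"
      using subgroup.subset[OF H] by blast
    fix h x assume h: "h \<in> {k \<in> H. snd T k b = b}" and x: "x \<in> fst ({z \<in> fst S. f z = b}, snd S)"
    then have x': "f (snd S h x) = f x" "x \<in> fst S"
      using f(3) by simp_all
    moreover have "snd S h x \<in> fst S"
      using S h x'(2) by (simp add: hset_action_def)
    ultimately show "snd ({z \<in> fst S. f z = b}, snd S) h x = x"
      using f(1) by (simp add: inj_on_def)
  qed
  then show "\<exists>h \<in> H. admissible P {k \<in> H. snd T k (snd T h b) = snd T h b}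
      ({z \<in> fst S. f z = snd T h b}, snd S)"
    using subgroup.one_closed[OF H] one by (intro bexI[of _ \<one>]) auto
qed auto

text \<open>If \<open>(a^-1 k a, s)\<close> fixes \<open>x\<close>, then \<open>(k, s)\<close> fixes
  \<open>a x\<close>. Ordering and permutations stay the same.\<close>

lemma admissible_pullback:
  assumes T: "admissible P H T" and a: "a \<in> carrier G" and K: "K \<subseteq> carrier G" "conj_subset G (inv a) K \<subseteq> H"
  shows "admissible P K (hset_pullback G a T)"
proof -
  obtain n e x where e: "bij_betw e {..<n} (fst T)" and x: "x \<in> ops P n"
    and \<sigma>: "\<And>h. h \<in> H \<Longrightarrow> \<exists>\<sigma> \<in> carrier (Sym n). (\<forall>i<n. e (\<sigma> i) = snd T h (e i)) \<and> oact P n (h, \<sigma>) x = x"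
    using T unfolding admissible_def fixes_graph_def by blast
  interpret S: group "Sym n"
    by (rule group_Sym)
  have "\<exists>\<sigma> \<in> carrier (Sym n). (\<forall>i<n. e (\<sigma> i) = snd (hset_pullback G a T) k (e i)) \<and>
      oact P n (k, \<sigma>) (gact P n a x) = gact P n a x" if k: "k \<in> K" for k
  proof -
    let ?h = "inv a \<otimes> k \<otimes> a"
    have kG: "k \<in> carrier G"
      using K k by blast
    have h: "?h \<in> H"
      using K(2) k a by (auto simp: conj_subset_image)
    then obtain s where s: "s \<in> carrier (Sym n)" "\<forall>i<n. e (s i) = snd T ?h (e i)" "oact P n (?h, s) x = x"
      using \<sigma> by blast
    have hG: "?h \<in> carrier G"
      using a kG by simp
    have "oact P n (k, s) (gact P n a x) = oact P n (k \<otimes> a, s) x"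
      using oact_oact[OF kG s(1) a S.one_closed x] s(1) by simp
    also have "k \<otimes> a = a \<otimes> ?h"
      using a kG by (simp add: m_assoc[symmetric])
    also have "oact P n (a \<otimes> ?h, s) x = gact P n a (oact P n (?h, s) x)"
      using oact_oact[OF a S.one_closed hG s(1) x] s(1) by simp
    finally show ?thesis
      using s by (intro bexI[of _ s]) (auto simp: hset_pullback_def)
  qed
  then have "fixes_graph P K (hset_pullback G a T) n e (gact P n a x)"
    using e gact_closed[OF a x] unfolding fixes_graph_def by (auto simp: hset_pullback_def)
  then show ?thesis
    unfolding admissible_def by blast
qed

end

section \<open>Left cosets, stabilizers and orbits\<close>

no_notation subset_mset (infix "<#" 50)

lemma hset_action_mono: "hset_action G H T \<Longrightarrow> M \<subseteq> H \<Longrightarrow> hset_action G M T"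
  by (simp add: hset_action_def subset_iff)

context group
begin

lemma lcoset_eq_iff:
  assumes K: "subgroup K G" and a: "a \<in> carrier G" and b: "b \<in> carrier G"
  shows "a <# K = b <# K \<longleftrightarrow> inv a \<otimes> b \<in> K"
proof
  assume "a <# K = b <# K"
  moreover have "b \<otimes> \<one> \<in> b <# K"
    using subgroup.one_closed[OF K] by (auto simp: l_coset_def)
  ultimately have "b \<in> a <# K"
    using b by simp
  then obtain k where k: "k \<in> K" "b = a \<otimes> k"
    by (auto simp: l_coset_def)
  then show "inv a \<otimes> b \<in> K"
    using a subgroup.mem_carrier[OF K] by (simp add: m_assoc[symmetric])
next
  assume k: "inv a \<otimes> b \<in> K"
  have "a \<otimes> (inv a \<otimes> b) = b"
    using a b by (simp add: m_assoc[symmetric])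
  then have "b \<in> a <# K"
    using k unfolding l_coset_def by force
  then show "a <# K = b <# K"
    by (rule l_repr_independence[OF _ a K])
qed

text \<open>Multiplying a coset by \<open>K\<close> is the projection from \<open>H/L\<close> to
  \<open>H/K\<close>, written without a choice of representatives.\<close>

lemma lcoset_set_mult:
  assumes "subgroup L G" "subgroup K G" "L \<subseteq> K" "a \<in> carrier G"
  shows "(a <# L) <#> K = a <# K"
proof -
  have "L <#> K = K"
  proof (intro subset_antisym subsetI)
    fix x assume "x \<in> L <#> K"
    then show "x \<in> K"
      using assms(3) subgroup.m_closed[OF assms(2)] by (auto simp: set_mult_def)
  next
    fix x assume "x \<in> K"
    then show "x \<in> L <#> K"
      using subgroup.one_closed[OF assms(1)] subgroup.mem_carrier[OF assms(2), of x]
      unfolding set_mult_def by force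
  qed
  then show ?thesis
    using setmult_lcos_assoc subgroup.subset[OF assms(1)] subgroup.subset[OF assms(2)] assms(4) by simp
qed

lemma lcoset_self_iff: "subgroup K G \<Longrightarrow> h \<in> carrier G \<Longrightarrow> h <# K = K \<longleftrightarrow> h \<in> K"
  using lcoset_eq_iff[of K \<one> h] subgroup.subset[of K G] by (auto simp: lcos_mult_one)

lemma inv_conj_mult:
  assumes "a \<in> carrier G" "k \<in> carrier G" "l \<in> carrier G"
  shows "inv a \<otimes> (k \<otimes> l) \<otimes> a = (inv a \<otimes> k \<otimes> a) \<otimes> (inv a \<otimes> l \<otimes> a)"
proof -
  have "(inv a \<otimes> k \<otimes> a) \<otimes> (inv a \<otimes> l \<otimes> a) = inv a \<otimes> k \<otimes> (a \<otimes> inv a) \<otimes> l \<otimes> a"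
    using assms by (simp only: m_assoc m_closed inv_closed)
  then show ?thesis
    using assms by (simp add: m_assoc)
qed

lemma inv_conj_conj:
  assumes "g \<in> carrier G" "h \<in> carrier G"
  shows "inv g \<otimes> (g \<otimes> h \<otimes> inv g) \<otimes> g = h"
proof -
  have "inv g \<otimes> (g \<otimes> h \<otimes> inv g) \<otimes> g = (inv g \<otimes> g) \<otimes> h \<otimes> (inv g \<otimes> g)"
    using assms by (simp only: m_assoc m_closed inv_closed)
  then show ?thesis
    using assms by simp
qed

lemma conj_subset_inv:
  assumes "g \<in> carrier G" "H \<subseteq> carrier G"
  shows "conj_subset G (inv g) (conj_subset G g H) = H"
proof -
  have "conj_subset G (inv g) (conj_subset G g H) = (\<lambda>h. h) ` H"
    unfolding conj_subset_image image_image
    by (rule image_cong[OF HOL.refl]) (use assms inv_conj_conj in auto)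
  then show ?thesis
    by simp
qed

lemma conj_subset_subset: "g \<in> carrier G \<Longrightarrow> H \<subseteq> carrier G \<Longrightarrow> conj_subset G g H \<subseteq> carrier G"
  by (auto simp: conj_subset_image)

lemma fst_coset_hset [simp]: "fst (coset_hset G H K) = (\<lambda>h. h <# K) ` H"
  by (simp add: coset_hset_def Let_def)

lemma snd_coset_hset:
  assumes "H \<subseteq> carrier G" "K \<subseteq> carrier G" "h \<in> H" "k \<in> H"
  shows "snd (coset_hset G H K) h (k <# K) = (h \<otimes> k) <# K"
  using assms by (simp add: coset_hset_def Let_def lcos_m_assoc subset_iff)

lemma snd_coset_hset_self:
  assumes "subgroup H G" "K \<subseteq> carrier G" "h \<in> H"
  shows "snd (coset_hset G H K) h K = h <# K"
  using snd_coset_hset[OF subgroup.subset[OF assms(1)] assms(2,3) subgroup.one_closed[OF assms(1)]]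
    subgroup.mem_carrier[OF assms(1,3)] assms(2) by (simp add: lcos_mult_one)

lemma snd_coset_hset_self_eq_iff:
  assumes "subgroup H G" "subgroup K G" "h \<in> H"
  shows "snd (coset_hset G H K) h K = K \<longleftrightarrow> h \<in> K"
  using snd_coset_hset_self[OF assms(1) subgroup.subset[OF assms(2)] assms(3)]
    lcoset_self_iff[OF assms(2) subgroup.mem_carrier[OF assms(1,3)]] by simp

lemma self_mem_coset_hset: "subgroup H G \<Longrightarrow> K \<subseteq> carrier G \<Longrightarrow> K \<in> fst (coset_hset G H K)"
  using lcos_mult_one[of K] subgroup.one_closed[of H G] unfolding fst_coset_hset by (metis imageI)

lemma hset_action_coset:
  assumes H: "subgroup H G" and K: "subgroup K G"
  shows "hset_action G H (coset_hset G H K)"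
proof -
  note sub = subgroup.subset[OF H] subgroup.subset[OF K]
  show ?thesis
    unfolding hset_action_def
  proof (intro conjI ballI)
    fix x assume x: "x \<in> fst (coset_hset G H K)"
    then obtain l where l: "l \<in> H" "x = l <# K"
      by auto
    have lG: "l \<in> carrier G"
      using sub(1) l(1) by blast
    show "snd (coset_hset G H K) \<one> x = x"
      using snd_coset_hset[OF sub subgroup.one_closed[OF H] l(1)] l lG by simp
    fix h assume h: "h \<in> H"
    show "snd (coset_hset G H K) h x \<in> fst (coset_hset G H K)"
      using snd_coset_hset[OF sub h l(1)] l subgroup.m_closed[OF H h l(1)] by simp
    fix k assume k: "k \<in> H"
    show "snd (coset_hset G H K) (h \<otimes> k) x = snd (coset_hset G H K) h (snd (coset_hset G H K) k x)"
      using snd_coset_hset[OF sub] l h k subgroup.m_closed[OF H] subgroup.mem_carrier[OF H]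
      by (simp add: m_assoc)
  qed
qed

lemma hset_action_pullback:
  assumes T: "hset_action G H T" and a: "a \<in> carrier G" and K: "K \<subseteq> carrier G" "conj_subset G (inv a) K \<subseteq> H"
  shows "hset_action G K (hset_pullback G a T)"
proof -
  have KG: "k \<in> carrier G" and KH: "inv a \<otimes> k \<otimes> a \<in> H" if "k \<in> K" for k
    using K a that by (auto simp: conj_subset_image)
  show ?thesis
    unfolding hset_action_def hset_pullback_def fst_conv snd_conv
    using T a KH inv_conj_mult[OF a KG KG] by (simp add: hset_action_def)
qed

lemma stabilizer_hset_subgroup:
  assumes H: "subgroup H G" and T: "hset_action G H T" and t: "t \<in> fst T"
  shows "subgroup {h \<in> H. snd T h t = t} G"
proof (rule subgroupI)
  have one: "snd T \<one> t = t" and mult: "\<And>h k. h \<in> H \<Longrightarrow> k \<in> H \<Longrightarrow> snd T (h \<otimes> k) t = snd T h (snd T k t)"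
    using T t by (auto simp: hset_action_def)
  show "{h \<in> H. snd T h t = t} \<subseteq> carrier G"
    using subgroup.subset[OF H] by blast
  show "{h \<in> H. snd T h t = t} \<noteq> {}"
    using subgroup.one_closed[OF H] one by blast
  fix a assume a: "a \<in> {h \<in> H. snd T h t = t}"
  then have aH: "a \<in> H" "inv a \<in> H" "a \<in> carrier G" "snd T a t = t"
    using subgroup.m_inv_closed[OF H] subgroup.mem_carrier[OF H] by auto
  then have "snd T (inv a) t = t"
    using mult[OF aH(2) aH(1)] one by simp
  then show "inv a \<in> {h \<in> H. snd T h t = t}"
    using aH by simp
  fix b assume "b \<in> {h \<in> H. snd T h t = t}"
  then show "a \<otimes> b \<in> {h \<in> H. snd T h t = t}"
    using aH mult subgroup.m_closed[OF H] by simp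
qed

text \<open>The orbit-stabilizer theorem in the form of an isomorphism of
  \<open>H\<close>-sets.\<close>

lemma coset_hset_iso_orbit:
  assumes H: "subgroup H G" and T: "hset_action G H T" and t: "t \<in> fst T"
  shows "hset_iso H (coset_hset G H {h \<in> H. snd T h t = t}) ((\<lambda>h. snd T h t) ` H, snd T)"
proof -
  define S where "S = {h \<in> H. snd T h t = t}"
  have S: "subgroup S G"
    unfolding S_def by (rule stabilizer_hset_subgroup[OF H T t])
  have mult: "\<And>h k. h \<in> H \<Longrightarrow> k \<in> H \<Longrightarrow> snd T (h \<otimes> k) t = snd T h (snd T k t)"
    and one: "snd T \<one> t = t"
    using T t by (auto simp: hset_action_def)
  \<comment> \<open>Any element of the coset may be applied to \<open>t\<close>, since two of them
    differ by an element that fixes \<open>t\<close>.\<close>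
  define f where "f A = snd T (SOME h. h \<in> A) t" for A
  have f: "f (h <# S) = snd T h t" if h: "h \<in> H" for h
  proof -
    have "h \<otimes> \<one> \<in> h <# S"
      using subgroup.one_closed[OF S] by (auto simp: l_coset_def)
    then have "(SOME x. x \<in> h <# S) \<in> h <# S"
      by (rule someI)
    then obtain s where "s \<in> H" "snd T s t = t" "(SOME x. x \<in> h <# S) = h \<otimes> s"
      by (auto simp: l_coset_def S_def)
    then show ?thesis
      using mult[OF h] by (simp add: f_def)
  qed
  have "hset_iso H (coset_hset G H S) ((\<lambda>h. snd T h t) ` H, snd T)"
    unfolding hset_iso_def
  proof (intro exI[of _ f] conjI ballI)
    have "h <# S = k <# S" if hk: "h \<in> H" "k \<in> H" "snd T h t = snd T k t" for h k
    proof -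
      have hG: "h \<in> carrier G" "k \<in> carrier G" and hi: "inv h \<in> H"
        using hk subgroup.mem_carrier[OF H] subgroup.m_inv_closed[OF H] by auto
      have "snd T (inv h \<otimes> k) t = snd T (inv h \<otimes> h) t"
        using mult[OF hi] hk by simp
      then have "inv h \<otimes> k \<in> S"
        using subgroup.m_closed[OF H hi hk(2)] hG one by (simp add: S_def)
      then show ?thesis
        using lcoset_eq_iff[OF S hG] by blast
    qed
    then have "inj_on f ((\<lambda>h. h <# S) ` H)"
      using f by (intro inj_onI) (elim imageE, metis)
    moreover have "f ` (\<lambda>h. h <# S) ` H = (\<lambda>h. snd T h t) ` H"
      by (simp add: image_image f)
    ultimately show "bij_betw f (fst (coset_hset G H S)) (fst ((\<lambda>h. snd T h t) ` H, snd T))"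
      by (simp add: bij_betw_def)
    fix h x assume h: "h \<in> H" and "x \<in> fst (coset_hset G H S)"
    then obtain k where k: "k \<in> H" "x = k <# S"
      by auto
    show "f (snd (coset_hset G H S) h x) = snd ((\<lambda>h. snd T h t) ` H, snd T) h (f x)"
      using snd_coset_hset[OF subgroup.subset[OF H] subgroup.subset[OF S] h k(1)] k h
        f subgroup.m_closed[OF H h k(1)] mult by simp
  qed
  then show ?thesis
    by (simp add: S_def)
qed

end

section \<open>Sets over \<open>H/K\<close>, coproducts and induction\<close>

context N_infinity_operad
begin

text \<open>\<open>H/K\<close> is a single orbit, and the coset \<open>K\<close> has stabilizer
  \<open>K\<close>. So the fibre over this one point is all that has to be examined.\<close>

lemma admissible_over_cosets:
  assumes H: "subgroup H G" and K: "subgroup K G" "K \<subseteq> H" and E: "hset_action G H E"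
    and adm: "admissible P H (coset_hset G H K)"
    and p: "\<And>z. z \<in> fst E \<Longrightarrow> p z \<in> (\<lambda>h. h <# K) ` H"
      "\<And>h z. h \<in> H \<Longrightarrow> z \<in> fst E \<Longrightarrow> p (snd E h z) = snd (coset_hset G H K) h (p z)"
    and fibre: "admissible P K ({z \<in> fst E. p z = K}, snd E)"
  shows "admissible P H E"
proof (rule admissible_fibration[OF H E hset_action_coset[OF H K(1)] adm, of p])
  note HG = subgroup.subset[OF H] and KG = subgroup.subset[OF K(1)]
  fix b assume "b \<in> fst (coset_hset G H K)"
  then obtain h where h: "h \<in> H" "b = h <# K"
    by auto
  have hG: "h \<in> carrier G" and hi: "inv h \<in> H"
    using HG h subgroup.m_inv_closed[OF H] by auto
  have b: "snd (coset_hset G H K) (inv h) b = K"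
    using snd_coset_hset[OF HG KG hi h(1)] h hG KG by (simp add: lcos_mult_one)
  have "{k \<in> H. snd (coset_hset G H K) k K = K} = K"
    using snd_coset_hset_self_eq_iff[OF H K(1)] K(2) by blast
  then show "\<exists>g \<in> H. admissible P {k \<in> H. snd (coset_hset G H K) k (snd (coset_hset G H K) g b) =
      snd (coset_hset G H K) g b} ({z \<in> fst E. p z = snd (coset_hset G H K) g b}, snd E)"
    using fibre hi b by (intro bexI[of _ "inv h"]) auto
qed (use p in auto)

text \<open>The fibre of the projection from \<open>H/L\<close> to \<open>H/K\<close> over the coset
  \<open>K\<close> is \<open>K/L\<close>.\<close>

lemma admissible_cosets_trans:
  assumes H: "subgroup H G" and K: "subgroup K G" "K \<subseteq> H" and L: "subgroup L G" "L \<subseteq> K"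
    and adm: "admissible P H (coset_hset G H K)" "admissible P K (coset_hset G K L)"
  shows "admissible P H (coset_hset G H L)"
proof (rule admissible_over_cosets[OF H K hset_action_coset[OF H L(1)] adm(1), of "\<lambda>A. A <#> K"])
  note HG = subgroup.subset[OF H] and KG = subgroup.subset[OF K(1)] and LG = subgroup.subset[OF L(1)]
  have p: "(h <# L) <#> K = h <# K" if "h \<in> H" for h
    using lcoset_set_mult[OF L(1) K(1) L(2)] HG that by blast
  show "z <#> K \<in> (\<lambda>h. h <# K) ` H" if "z \<in> fst (coset_hset G H L)" for z
    using that p by auto
  show "snd (coset_hset G H L) h z <#> K = snd (coset_hset G H K) h (z <#> K)"
    if h: "h \<in> H" and z: "z \<in> fst (coset_hset G H L)" for h z
  proof -
    obtain k where k: "k \<in> H" "z = k <# L"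
      using z by auto
    then show ?thesis
      using snd_coset_hset[OF HG LG h k(1)] snd_coset_hset[OF HG KG h k(1)]
        p subgroup.m_closed[OF H h k(1)] by simp
  qed
  have "h <# K = K \<longleftrightarrow> h \<in> K" if h: "h \<in> H" for h
    using lcoset_self_iff[OF K(1)] h HG by blast
  then have fib: "{z \<in> fst (coset_hset G H L). z <#> K = K} = fst (coset_hset G K L)"
    using p K(2) by (auto simp: image_iff)
  have "hset_iso K (coset_hset G K L) ({z \<in> fst (coset_hset G H L). z <#> K = K}, snd (coset_hset G H L))"
    unfolding hset_iso_def fib
  proof (intro exI[of _ id] conjI ballI)
    fix k x assume k: "k \<in> K" and "x \<in> fst (coset_hset G K L)"
    then obtain h where h: "h \<in> K" "x = h <# L"
      by auto
    then show "id (snd (coset_hset G K L) k x) = snd (fst (coset_hset G K L), snd (coset_hset G H L)) k (id x)"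
      using snd_coset_hset[OF HG LG, of k h] snd_coset_hset[OF KG LG, of k h] k K(2) by auto
  qed simp
  then show "admissible P K ({z \<in> fst (coset_hset G H L). z <#> K = K}, snd (coset_hset G H L))"
    using admissible_iso[OF adm(2)] by blast
qed

text \<open>The base is a two-point set with trivial action; \<open>isl\<close> maps the coproduct
  to it, with the two summands as fibres.\<close>

lemma admissible_coprod:
  assumes H: "subgroup H G" and S: "hset_action G H S" "admissible P H S"
    and T: "hset_action G H T" "admissible P H T"
  shows "admissible P H (hset_coprod S T)"
proof -
  let ?B = "(UNIV :: bool set, \<lambda>_ :: 'g. id :: bool \<Rightarrow> bool)"
  have sf: "fst (hset_coprod S T) = fst S <+> fst T" and
    sl: "snd (hset_coprod S T) h (Inl x) = Inl (snd S h x)" and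
    sr: "snd (hset_coprod S T) h (Inr y) = Inr (snd T h y)" for h x y
    by (simp_all add: hset_coprod_def)
  have act: "hset_action G H (hset_coprod S T)"
    using S(1) T(1) unfolding hset_action_def sf by (auto simp: sl sr)
  have B: "hset_action G H ?B"
    by (simp add: hset_action_def)
  show ?thesis
  proof (rule admissible_fibration[OF H act B, where p = isl])
    show "admissible P H ?B"
      by (rule admissible_trivial) (use subgroup.subset[OF H] in auto)
    show "isl (snd (hset_coprod S T) h z) = snd ?B h (isl z)" if "z \<in> fst (hset_coprod S T)" for h z
      using that unfolding sf by (auto simp: sl sr)
    fix b :: bool
    have "hset_iso H S ({z \<in> fst (hset_coprod S T). isl z}, snd (hset_coprod S T))"
      unfolding hset_iso_def by (intro exI[of _ Inl] conjI) (auto simp: bij_betw_def sf sl)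
    moreover have "hset_iso H T ({z \<in> fst (hset_coprod S T). \<not> isl z}, snd (hset_coprod S T))"
      unfolding hset_iso_def by (intro exI[of _ Inr] conjI) (auto simp: bij_betw_def sf sr)
    ultimately have "admissible P H ({z \<in> fst (hset_coprod S T). isl z = b}, snd (hset_coprod S T))"
      using admissible_iso[OF S(2)] admissible_iso[OF T(2)] by (cases b) simp_all
    then show "\<exists>h \<in> H. admissible P {k \<in> H. snd ?B k (snd ?B h b) = snd ?B h b}
        ({z \<in> fst (hset_coprod S T). isl z = snd ?B h b}, snd (hset_coprod S T))"
      using subgroup.one_closed[OF H] by auto
  qed auto
qed

text \<open>The induced set lies over \<open>H/K\<close>, and its fibre over the coset
  \<open>K\<close> is a copy of \<open>T\<close>.\<close>

lemma admissible_induced: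
  assumes H: "subgroup H G" and K: "subgroup K G" "K \<subseteq> H" and T: "hset_action G K T" "admissible P K T"
    and adm: "admissible P H (coset_hset G H K)"
  shows "admissible P H (induced_hset G H K T)"
proof -
  note HG = subgroup.subset[OF H] and KG = subgroup.subset[OF K(1)]
  \<comment> \<open>The class of \<open>(h, t)\<close>. Because \<open>K\<close> is a group, the
    relation in \<open>induced_hset\<close> already relates a pair to its entire class, without
    passing to a generated equivalence.\<close>
  define c where "c h t = (\<lambda>k. (h \<otimes> inv k, snd T k t)) ` K" for h t
  have Tc: "\<And>k t. k \<in> K \<Longrightarrow> t \<in> fst T \<Longrightarrow> snd T k t \<in> fst T" and T1: "\<And>t. t \<in> fst T \<Longrightarrow> snd T \<one> t = t"
    and Tm: "\<And>k l t. k \<in> K \<Longrightarrow> l \<in> K \<Longrightarrow> t \<in> fst T \<Longrightarrow> snd T (k \<otimes> l) t = snd T k (snd T l t)"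
    using T(1) by (auto simp: hset_action_def)
  have cls: "{((h \<otimes> k, t), (h, snd T k t)) | h k t. h \<in> H \<and> k \<in> K \<and> t \<in> fst T} `` {(h0, t0)} = c h0 t0"
    if h0: "h0 \<in> H" and t0: "t0 \<in> fst T" for h0 t0
  proof (intro subset_antisym subsetI)
    fix z assume "z \<in> {((h \<otimes> k, t), (h, snd T k t)) | h k t. h \<in> H \<and> k \<in> K \<and> t \<in> fst T} `` {(h0, t0)}"
    then obtain h k where hk: "h \<in> H" "k \<in> K" "h \<otimes> k = h0" "z = (h, snd T k t0)"
      by auto
    then have "h = h0 \<otimes> inv k"
      using HG KG by (metis inv_solve_right subgroup.mem_carrier[OF H] subgroup.mem_carrier[OF K(1)] h0)
    then show "z \<in> c h0 t0"
      using hk by (auto simp: c_def)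
  next
    fix z assume "z \<in> c h0 t0"
    then obtain k where k: "k \<in> K" "z = (h0 \<otimes> inv k, snd T k t0)"
      by (auto simp: c_def)
    have kG: "k \<in> carrier G" "h0 \<in> carrier G"
      using k h0 HG KG by auto
    have "h0 \<otimes> inv k \<in> H"
      using h0 k K(2) subgroup.m_closed[OF H] subgroup.m_inv_closed[OF H] by blast
    moreover have "h0 \<otimes> inv k \<otimes> k = h0"
      using kG by (simp add: m_assoc)
    ultimately have "((h0, t0), z) \<in> {((h \<otimes> k, t), (h, snd T k t)) | h k t. h \<in> H \<and> k \<in> K \<and> t \<in> fst T}"
      using k t0 by (auto intro!: exI[of _ "h0 \<otimes> inv k"] exI[of _ k])
    then show "z \<in> {((h \<otimes> k, t), (h, snd T k t)) | h k t. h \<in> H \<and> k \<in> K \<and> t \<in> fst T} `` {(h0, t0)}"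
      by (rule ImageI) simp
  qed
  define E where "E = induced_hset G H K T"
  have fE: "fst E = {c h t | h t. h \<in> H \<and> t \<in> fst T}"
  proof -
    let ?r = "{((h \<otimes> k, t), (h, snd T k t)) | h k t. h \<in> H \<and> k \<in> K \<and> t \<in> fst T}"
    have "fst E = (\<lambda>z. ?r `` {z}) ` (H \<times> fst T)"
      unfolding E_def induced_hset_def Let_def fst_conv quotient_def by (rule UNION_singleton_eq_range)
    also have "\<dots> = (\<lambda>(h, t). c h t) ` (H \<times> fst T)"
      by (rule image_cong[OF HOL.refl]) (use cls in \<open>clarsimp\<close>)
    also have "\<dots> = {c h t | h t. h \<in> H \<and> t \<in> fst T}"
      by (simp only: set_eq_iff image_iff) (simp add: Bex_def split_beta, blast)
    finally show ?thesis .
  qed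
  have sE: "snd E h (c h0 t) = c (h \<otimes> h0) t" if h: "h \<in> H" and h0: "h0 \<in> H" and t: "t \<in> fst T" for h h0 t
  proof -
    have "snd E h (c h0 t) = (\<lambda>(h', t). (h \<otimes> h', t)) ` c h0 t"
      using fE h0 t unfolding E_def induced_hset_def Let_def by auto
    also have "\<dots> = c (h \<otimes> h0) t"
      unfolding c_def image_image
      by (intro image_cong) (use h h0 HG KG in \<open>auto simp: m_assoc subset_iff\<close>)
    finally show ?thesis .
  qed
  have c_eq: "c (h \<otimes> k) t = c h (snd T k t)" if h: "h \<in> H" and k: "k \<in> K" and t: "t \<in> fst T" for h k t
  proof -
    have kG: "k \<in> carrier G" "h \<in> carrier G"
      using h k HG KG by auto
    have "c (h \<otimes> k) t = (\<lambda>l. (h \<otimes> k \<otimes> inv (l \<otimes> k), snd T (l \<otimes> k) t)) ` K"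
    proof -
      have "(\<lambda>l. l \<otimes> k) ` K = K"
      proof (intro subset_antisym subsetI)
        fix l assume l: "l \<in> K"
        then have "l \<otimes> inv k \<otimes> k = l"
          using kG KG by (auto simp: m_assoc)
        moreover have "l \<otimes> inv k \<in> K"
          using l k subgroup.m_closed[OF K(1)] subgroup.m_inv_closed[OF K(1)] by blast
        ultimately show "l \<in> (\<lambda>l. l \<otimes> k) ` K"
          by (metis imageI)
      qed (use k subgroup.m_closed[OF K(1)] in auto)
      then have "c (h \<otimes> k) t = (\<lambda>l. (h \<otimes> k \<otimes> inv l, snd T l t)) ` (\<lambda>l. l \<otimes> k) ` K"
        by (simp add: c_def)
      then show ?thesis
        by (simp add: image_image)
    qed
    also have "\<dots> = c h (snd T k t)"
      unfolding c_def
    proof (rule image_cong[OF HOL.refl])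
      fix l assume l: "l \<in> K"
      then have lG: "l \<in> carrier G"
        using KG by blast
      have "h \<otimes> k \<otimes> inv (l \<otimes> k) = h \<otimes> (k \<otimes> inv k) \<otimes> inv l"
        using kG lG by (simp only: inv_mult_group m_assoc m_closed inv_closed)
      then show "(h \<otimes> k \<otimes> inv (l \<otimes> k), snd T (l \<otimes> k) t) = (h \<otimes> inv l, snd T l (snd T k t))"
        using kG lG Tm[OF l k t] by simp
    qed
    finally show ?thesis .
  qed
  have act: "hset_action G H E"
    unfolding hset_action_def
  proof (intro conjI ballI)
    fix z assume "z \<in> fst E"
    then obtain h0 t where z: "h0 \<in> H" "t \<in> fst T" "z = c h0 t"
      unfolding fE by blast
    have h0G: "h0 \<in> carrier G"
      using z HG by blast
    show "snd E \<one> z = z"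
      using sE[OF subgroup.one_closed[OF H] z(1,2)] z(3) h0G by simp
    fix h assume h: "h \<in> H"
    show "snd E h z \<in> fst E"
      using sE[OF h z(1,2)] z subgroup.m_closed[OF H h z(1)] unfolding fE by blast
    fix k assume k: "k \<in> H"
    have "h \<otimes> k \<otimes> h0 = h \<otimes> (k \<otimes> h0)"
      using h k h0G HG by (simp add: m_assoc subset_iff)
    then show "snd E (h \<otimes> k) z = snd E h (snd E k z)"
      using sE[OF subgroup.m_closed[OF H h k] z(1,2)] sE[OF k z(1,2)]
        sE[OF h subgroup.m_closed[OF H k z(1)] z(2)] z(3) by simp
  qed
  \<comment> \<open>The projection to \<open>H/K\<close> sends a class to the set of its first
    coordinates, which is a coset.\<close>
  have fc: "fst ` c h t = h <# K" if "h \<in> H" for h t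
  proof -
    have "(\<lambda>k. h \<otimes> inv k) ` K = (\<lambda>k. h \<otimes> k) ` (\<lambda>k. inv k) ` K"
      by (simp add: image_image)
    also have "(\<lambda>k. inv k) ` K = K"
    proof (intro subset_antisym subsetI)
      fix k assume "k \<in> K"
      then have "inv k \<in> K" "k = inv (inv k)"
        using subgroup.m_inv_closed[OF K(1)] KG by auto
      then show "k \<in> (\<lambda>k. inv k) ` K"
        by (metis imageI)
    qed (use subgroup.m_inv_closed[OF K(1)] in auto)
    finally show ?thesis
      by (auto simp: c_def image_image l_coset_def)
  qed
  have stab: "h <# K = K \<longleftrightarrow> h \<in> K" if h: "h \<in> H" for h
    using lcoset_self_iff[OF K(1)] h HG by blast
  have "admissible P H E"
  proof (rule admissible_over_cosets[OF H K act adm, where p = "\<lambda>A. fst ` A"])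
    show "fst ` z \<in> (\<lambda>h. h <# K) ` H" if "z \<in> fst E" for z
      using that fc unfolding fE by auto
    show "fst ` snd E h z = snd (coset_hset G H K) h (fst ` z)" if h: "h \<in> H" and z: "z \<in> fst E" for h z
    proof -
      obtain h0 t where z: "h0 \<in> H" "t \<in> fst T" "z = c h0 t"
        using z unfolding fE by blast
      then show ?thesis
        using sE[OF h z(1,2)] fc[OF z(1)] fc[OF subgroup.m_closed[OF H h z(1)]]
          snd_coset_hset[OF HG KG h z(1)] by simp
    qed
    have c1: "c k t = c \<one> (snd T k t)" if "k \<in> K" "t \<in> fst T" for k t
      using c_eq[OF subgroup.one_closed[OF H] that] that KG by (simp add: subset_iff)
    have fib: "{z \<in> fst E. fst ` z = K} = c \<one> ` fst T"
    proof (intro subset_antisym subsetI)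
      fix z assume "z \<in> {z \<in> fst E. fst ` z = K}"
      then have zE: "z \<in> fst E" and zK: "fst ` z = K"
        by simp_all
      obtain h t where z: "h \<in> H" "t \<in> fst T" "z = c h t"
        using zE unfolding fE by blast
      have hK: "h \<in> K"
        using zK fc[OF z(1), of t] stab[OF z(1)] z(3) by simp
      show "z \<in> c \<one> ` fst T"
        using c1[OF hK z(2)] Tc[OF hK z(2)] z(3) by simp
    next
      fix z assume "z \<in> c \<one> ` fst T"
      then obtain t where t: "t \<in> fst T" "z = c \<one> t"
        by blast
      have "z \<in> fst E"
        using t subgroup.one_closed[OF H] unfolding fE by blast
      moreover have "fst ` z = K"
        using fc[OF subgroup.one_closed[OF H]] t KG by (simp add: lcos_mult_one)
      ultimately show "z \<in> {z \<in> fst E. fst ` z = K}"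
        by blast
    qed
    have "hset_iso K T ({z \<in> fst E. fst ` z = K}, snd E)"
      unfolding hset_iso_def fib fst_conv snd_conv
    proof (intro exI[of _ "c \<one>"] conjI ballI)
      have "t = t'" if t: "t \<in> fst T" "t' \<in> fst T" "c \<one> t = c \<one> t'" for t t'
      proof -
        \<comment> \<open>A class of this kind contains just one pair with first coordinate
          \<open>\<one>\<close>, from which \<open>t\<close> can be read off.\<close>
        have "(\<one>, snd T \<one> t) \<in> c \<one> t"
          using subgroup.one_closed[OF K(1)] unfolding c_def by force
        then obtain k where k: "k \<in> K" "\<one> = \<one> \<otimes> inv k" "snd T \<one> t = snd T k t'"
          unfolding t(3) by (auto simp: c_def)
        have "k = \<one>"
          using k(1,2) KG by (metis inv_closed inv_inv inv_one l_one subsetD)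
        then show ?thesis
          using k(3) T1 t by simp
      qed
      then show "bij_betw (c \<one>) (fst T) (c \<one> ` fst T)"
        by (simp add: bij_betw_def inj_on_def)
      fix k t assume k: "k \<in> K" and t: "t \<in> fst T"
      then show "c \<one> (snd T k t) = snd E k (c \<one> t)"
        using sE[of k \<one> t] c1[OF k t] K(2) KG subgroup.one_closed[OF H] by (simp add: subset_iff)
    qed
    then show "admissible P K ({z \<in> fst E. fst ` z = K}, snd E)"
      using admissible_iso[OF T(2)] by blast
  qed
  then show ?thesis
    by (simp add: E_def)
qed

end

section \<open>Decomposition into orbits and the rules for norms\<close>

context N_infinity_operad
begin

text \<open>An orbit is a sub-object, which gives one direction. For the other, \<open>T\<close> is
  mapped to the set of its orbits. This base carries the trivial action, so it is admissible, each
  of its points has stabilizer \<open>H\<close>, and the fibres are the orbits.\<close>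

lemma admissible_iff_orbits:
  fixes T :: "('a, 't) hset"
  assumes H: "subgroup H G" and T: "hset_action G H T" and fin: "finite (fst T)"
  shows "admissible P H T \<longleftrightarrow> (\<forall>t \<in> fst T. admissible P H (coset_hset G H {h \<in> H. snd T h t = t}))"
proof (intro iffI ballI)
  define orb where "orb t = (\<lambda>h. snd T h t) ` H" for t
  have Tc: "\<And>h t. h \<in> H \<Longrightarrow> t \<in> fst T \<Longrightarrow> snd T h t \<in> fst T" and T1: "\<And>t. t \<in> fst T \<Longrightarrow> snd T \<one> t = t"
    and Tm: "\<And>h k t. h \<in> H \<Longrightarrow> k \<in> H \<Longrightarrow> t \<in> fst T \<Longrightarrow> snd T (h \<otimes> k) t = snd T h (snd T k t)"
    using T by (auto simp: hset_action_def)
  have sub: "orb t \<subseteq> fst T" if "t \<in> fst T" for t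
    using Tc that by (auto simp: orb_def)
  have closed: "snd T h x \<in> orb t" if "h \<in> H" "x \<in> orb t" "t \<in> fst T" for h x t
  proof -
    obtain k where k: "k \<in> H" "x = snd T k t"
      using \<open>x \<in> orb t\<close> by (auto simp: orb_def)
    then have "snd T h x = snd T (h \<otimes> k) t"
      using Tm that by simp
    then show ?thesis
      using subgroup.m_closed[OF H that(1) k(1)] unfolding orb_def by blast
  qed
  {
    fix t assume adm: "admissible P H T" and t: "t \<in> fst T"
    have "hset_action G H (orb t, snd T)"
      unfolding hset_action_def using T1 Tm closed sub[OF t] t by (simp add: subset_iff)
    then have "admissible P H (orb t, snd T)"
      using sub[OF t] by (intro admissible_inj[OF H _ T adm, where f = id]) auto
    moreover have "hset_iso H (orb t, snd T) (coset_hset G H {h \<in> H. snd T h t = t})"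
      unfolding orb_def
      by (rule hset_iso_sym[OF coset_hset_iso_orbit[OF H T t]])
        (use hset_action_coset[OF H stabilizer_hset_subgroup[OF H T t]] in \<open>simp only: hset_action_def\<close>)
    ultimately show "admissible P H (coset_hset G H {h \<in> H. snd T h t = t})"
      by (rule admissible_iso)
  }
  assume orbs: "\<forall>t \<in> fst T. admissible P H (coset_hset G H {h \<in> H. snd T h t = t})"
  let ?B = "(orb ` fst T, \<lambda>_ :: 'a. id :: 't set \<Rightarrow> 't set)"
  have self: "t \<in> orb t" if "t \<in> fst T" for t
    using T1[OF that] subgroup.one_closed[OF H] unfolding orb_def by force
  have orb_eq: "orb (snd T h t) = orb t" if h: "h \<in> H" and t: "t \<in> fst T" for h t
  proof -
    have hi: "inv h \<in> H" and hG: "h \<in> carrier G"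
      using subgroup.m_inv_closed[OF H h] subgroup.mem_carrier[OF H h] .
    have "snd T k (snd T h t) = snd T (k \<otimes> h) t" if "k \<in> H" for k
      using Tm[OF that h t] by simp
    moreover have "snd T k t = snd T (k \<otimes> inv h) (snd T h t)" if k: "k \<in> H" for k
    proof -
      have "k \<otimes> inv h \<otimes> h = k"
        using hG subgroup.mem_carrier[OF H k] by (simp add: m_assoc)
      then show ?thesis
        using Tm[OF subgroup.m_closed[OF H k hi] h t] by simp
    qed
    moreover have "k \<otimes> inv h \<in> H" "k \<otimes> h \<in> H" if "k \<in> H" for k
      using subgroup.m_closed[OF H that] h hi by auto
    ultimately show ?thesis
      unfolding orb_def by (intro subset_antisym image_subsetI) (metis imageI)+
  qed
  show "admissible P H T"
  proof (rule admissible_fibration[OF H T, where B = ?B and p = orb])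
    show "hset_action G H ?B"
      by (simp add: hset_action_def)
    show "admissible P H ?B"
      by (rule admissible_trivial) (use fin subgroup.subset[OF H] in auto)
    show "orb (snd T h z) = snd ?B h (orb z)" if "h \<in> H" "z \<in> fst T" for h z
      using orb_eq that by simp
    fix b assume "b \<in> fst ?B"
    then obtain t where t: "t \<in> fst T" "b = orb t"
      by auto
    have "{z \<in> fst T. orb z = b} = orb t"
    proof (intro subset_antisym subsetI)
      fix z assume "z \<in> orb t"
      then obtain h where "h \<in> H" "z = snd T h t"
        by (auto simp: orb_def)
      then show "z \<in> {z \<in> fst T. orb z = b}"
        using orb_eq t Tc by simp
    qed (use self t in auto)
    moreover have "admissible P H (orb t, snd T)"
      using admissible_iso[OF bspec[OF orbs t(1)] coset_hset_iso_orbit[OF H T t(1)]] by (simp add: orb_def)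
    ultimately have "admissible P H ({z \<in> fst T. orb z = b}, snd T)"
      by simp
    then show "\<exists>h \<in> H. admissible P {k \<in> H. snd ?B k (snd ?B h b) = snd ?B h b}
        ({z \<in> fst T. orb z = snd ?B h b}, snd T)"
      using subgroup.one_closed[OF H] by auto
  qed auto
qed

lemma admissible_orbit:
  assumes "subgroup H G" "hset_action G H T" "admissible P H T" "t \<in> fst T"
  shows "admissible P H (coset_hset G H {h \<in> H. snd T h t = t})"
  using admissible_iff_orbits[OF assms(1,2) admissible_finite[OF assms(3)]] assms(3,4) by blast

text \<open>After restriction of \<open>H/K\<close> to \<open>M\<close>, the point \<open>K\<close>
  has stabilizer \<open>K \<inter> M\<close>, so its orbit is the set in question.\<close>

lemma admissible_cosets_restrict:
  assumes H: "subgroup H G" and K: "subgroup K G" and M: "subgroup M G" "M \<subseteq> H"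
    and adm: "admissible P H (coset_hset G H K)"
  shows "admissible P M (coset_hset G M (K \<inter> M))"
proof -
  note KG = subgroup.subset[OF K]
  have "admissible P M (coset_hset G M {h \<in> M. snd (coset_hset G H K) h K = K})"
    by (rule admissible_orbit[OF M(1) hset_action_mono[OF hset_action_coset[OF H K] M(2)]
          admissible_subgroup[OF adm M(2)] self_mem_coset_hset[OF H KG]])
  also have "{h \<in> M. snd (coset_hset G H K) h K = K} = K \<inter> M"
    using snd_coset_hset_self_eq_iff[OF H K] M(2) by blast
  finally show ?thesis .
qed

text \<open>In the pullback of \<open>H/K\<close> along conjugation by \<open>g\<close>, the
  stabilizer of the point \<open>K\<close> is the conjugate of \<open>K\<close>.\<close>

lemma admissible_cosets_conj:
  assumes H: "subgroup H G" and K: "subgroup K G" "K \<subseteq> H" and g: "g \<in> carrier G"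
    and adm: "admissible P H (coset_hset G H K)"
  shows "admissible P (conj_subset G g H) (coset_hset G (conj_subset G g H) (conj_subset G g K))"
proof -
  note HG = subgroup.subset[OF H] and KG = subgroup.subset[OF K(1)]
  let ?H = "conj_subset G g H" and ?T = "hset_pullback G g (coset_hset G H K)"
  note sub = conj_subset_subset[OF g HG] equalityD1[OF conj_subset_inv[OF g HG]]
  have "admissible P ?H (coset_hset G ?H {h \<in> ?H. snd ?T h K = K})"
    by (rule admissible_orbit[OF subgroup_conj_subset[OF g H] hset_action_pullback[OF hset_action_coset[OF H K(1)] g sub]
          admissible_pullback[OF adm g sub]]) (use self_mem_coset_hset[OF H KG] in \<open>simp add: hset_pullback_def\<close>)
  also have "{h \<in> ?H. snd ?T h K = K} = conj_subset G g K"
  proof -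
    have "snd ?T (g \<otimes> h \<otimes> inv g) K = K \<longleftrightarrow> h \<in> K" if h: "h \<in> H" for h
      using inv_conj_conj[OF g subsetD[OF HG h]] snd_coset_hset_self_eq_iff[OF H K(1) h]
      by (simp add: hset_pullback_def)
    then show ?thesis
      using K(2) unfolding conj_subset_image by auto
  qed
  finally show ?thesis .
qed

lemma admissible_cosets_self:
  assumes H: "subgroup H G"
  shows "admissible P H (coset_hset G H H)"
proof -
  note HG = subgroup.subset[OF H]
  have triv: "h <# H = H" if "h \<in> H" for h
    using lcoset_self_iff[OF H] that HG by blast
  then have fst: "fst (coset_hset G H H) = {H}"
    using subgroup.one_closed[OF H] by auto
  have snd: "snd (coset_hset G H H) h H = H" if "h \<in> H" for h
    using snd_coset_hset_self[OF H HG that] triv[OF that] by simp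
  show ?thesis
    by (rule admissible_trivial) (simp_all only: fst snd HG finite.intros singleton_iff)
qed

lemma norm_system_operad_norms: "norm_system G (operad_norms G P)"
  unfolding norm_system_def
proof (intro conjI allI impI)
  have D: "subgroup K G" "subgroup H G" "K \<subset> H" "admissible P H (coset_hset G H K)"
    if "(K, H) \<in> operad_norms G P" for K H
    using that unfolding operad_norms_eq norm_symbols_def by blast+
  have I: "(K, H) \<in> operad_norms G P"
    if "subgroup K G" "subgroup H G" "K \<subset> H" "admissible P H (coset_hset G H K)" for K H
    using that unfolding operad_norms_eq norm_symbols_def by blast
  show "operad_norms G P \<subseteq> norm_symbols G"
    unfolding operad_norms_eq by blast
  show "(conj_subset G g K, conj_subset G g H) \<in> operad_norms G P"
    if "(K, H) \<in> operad_norms G P \<and> g \<in> carrier G" for K H g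
  proof -
    have KH: "(K, H) \<in> operad_norms G P" and g: "g \<in> carrier G"
      using that by blast+
    note d = D[OF KH]
    have "conj_subset G g K \<subseteq> conj_subset G g H"
      using d(3) by (auto simp: conj_subset_image)
    moreover have "conj_subset G g K \<noteq> conj_subset G g H"
      using conj_subset_inv[OF g] subgroup.subset[OF d(1)] subgroup.subset[OF d(2)] d(3) by (metis psubset_eq)
    ultimately show ?thesis
      using I subgroup_conj_subset[OF g] d admissible_cosets_conj[OF d(2,1) _ g d(4)] by blast
  qed
  show "(K \<inter> M, M) \<in> operad_norms G P"
    if "(K, H) \<in> operad_norms G P \<and> subgroup M G \<and> M \<subset> H \<and> K \<inter> M \<noteq> M" for K H M
  proof -
    have KH: "(K, H) \<in> operad_norms G P" and M: "subgroup M G" "M \<subseteq> H" "K \<inter> M \<noteq> M"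
      using that by blast+
    note d = D[OF KH]
    show ?thesis
      by (rule I[OF subgroups_Inter_pair[OF d(1) M(1)] M(1) _
            admissible_cosets_restrict[OF d(2,1) M(1,2) d(4)]]) (use M(3) in blast)
  qed
  show "(L, H) \<in> operad_norms G P" if "(L, K) \<in> operad_norms G P \<and> (K, H) \<in> operad_norms G P" for L K H
  proof -
    have LK: "(L, K) \<in> operad_norms G P" and KH: "(K, H) \<in> operad_norms G P"
      using that by blast+
    note d = D[OF LK] D[OF KH]
    have "L \<subseteq> K" "K \<subseteq> H"
      using d by blast+
    then show ?thesis
      by (intro I d admissible_cosets_trans[OF d(6) d(2) _ d(1) _ d(8) d(4)]) (use d in blast)+
  qed
qed

text \<open>Reinstates the identity norms, which \<open>operad_norms\<close> does not
  record.\<close>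

lemma admissible_coset_iff_norm:
  assumes H: "subgroup H G" and K: "subgroup K G" "K \<subseteq> H"
  shows "admissible P H (coset_hset G H K) \<longleftrightarrow> K = H \<or> (K, H) \<in> operad_norms G P"
  using admissible_cosets_self[OF H] assms unfolding operad_norms_eq norm_symbols_def by auto

lemma indexing_system_operad: "indexing_system G (operad_indexing_system G P)"
proof
  note [simp] = operad_indexing_system_iff
  fix H assume H: "subgroup H G"
  note HG = subgroup.subset[OF H]
  note act = finite_hset_action[OF is_group H]
  show "finite_hset G H T" if "T \<in> operad_indexing_system G P H" for T
    using that H by simp
  show "T \<in> operad_indexing_system G P H"
    if "S \<in> operad_indexing_system G P H" "finite_hset G H T" "hset_iso H S T" for S T
    using that(1,2) H admissible_iso[OF _ that(3), of P] by simp
  show "T \<in> operad_indexing_system G P H" if "finite_hset G H T" "fst T = {}" for T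
    using that H HG admissible_trivial[of T H] by simp
  show "hset_in (operad_indexing_system G P) H (hset_coprod S T)"
    if "S \<in> operad_indexing_system G P H" "T \<in> operad_indexing_system G P H" for S T
    unfolding hset_in_iff_admissible[OF H]
    using that H by (intro admissible_coprod[OF H act _ act]) simp_all
  show "hset_in (operad_indexing_system G P) H (coset_hset G H H)"
    unfolding hset_in_iff_admissible[OF H] by (rule admissible_cosets_self[OF H])
  show "S \<in> operad_indexing_system G P H"
    if T: "T \<in> operad_indexing_system G P H" and S: "finite_hset G H S" "fst S \<subseteq> fst T"
      "\<And>h x. h \<in> H \<Longrightarrow> x \<in> fst S \<Longrightarrow> snd S h x = snd T h x" for S T
  proof -
    have T: "finite_hset G H T" "admissible P H T"
      using T H by simp_all
    have "admissible P H S"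
      by (rule admissible_inj[OF H act[OF S(1)] act[OF T(1)] T(2), where f = id]) (use S(2,3) in auto)
    then show ?thesis
      using H S(1) by simp
  qed
  fix K assume K: "subgroup K G"
  show "hset_in (operad_indexing_system G P) H (induced_hset G H K T)"
    if "K \<subseteq> H" "T \<in> operad_indexing_system G P K" "hset_in (operad_indexing_system G P) H (coset_hset G H K)" for T
    using that K unfolding hset_in_iff_admissible[OF H]
    by (intro admissible_induced[OF H K _ finite_hset_action[OF is_group K]]) simp_all
  show "hset_pullback G a T \<in> operad_indexing_system G P K"
    if a: "a \<in> carrier G" and sub: "conj_subset G (inv a) K \<subseteq> H" and T: "T \<in> operad_indexing_system G P H" for a T
  proof -
    have T: "finite_hset G H T" "admissible P H T"
      using T H by simp_all
    have hom: "group_hom (G\<lparr>carrier := H\<rparr>) (BijGroup (fst T)) (snd T)"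
      using T(1) by (simp add: finite_hset_def group_action_def)
    have KG: "k \<in> carrier G" if "k \<in> K" for k
      using subgroup.mem_carrier[OF K that] .
    have conj: "inv a \<otimes> k \<otimes> a \<in> H" if "k \<in> K" for k
      using sub that a by (auto simp: conj_subset_image)
    have "group_hom (G\<lparr>carrier := K\<rparr>) (BijGroup (fst T)) (\<lambda>k. snd T (inv a \<otimes> k \<otimes> a))"
      unfolding group_hom_def group_hom_axioms_def hom_def
      using subgroup.subgroup_is_group[OF K is_group] group_BijGroup conj inv_conj_mult[OF a KG KG]
        group_hom.hom_closed[OF hom] group_hom.hom_mult[OF hom] by simp
    then have "finite_hset G K (hset_pullback G a T)"
      using T(1) by (simp add: finite_hset_def hset_pullback_def group_action_def)
    moreover have "admissible P K (hset_pullback G a T)"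
      using admissible_pullback[OF T(2) a subgroup.subset[OF K] sub] .
    ultimately show ?thesis
      using K by simp
  qed
qed

end

text \<open>A subgroup that fixes an operation of \<open>P\<close> is the graph of an action of some
  \<open>H\<close> on \<open>{..<n}\<close>. The orbits of this action are admissible for
  \<open>P\<close>, hence given by norms of \<open>P\<close> or by identity norms. So they are
  admissible for \<open>Q\<close>, and by the orbit criterion so is the whole set.\<close>

lemma fixed_set_of_norms:
  assumes P: "N_infinity_operad G P" and Q: "N_infinity_operad G Q"
    and norms: "operad_norms G P \<subseteq> operad_norms G Q"
    and \<Gamma>: "subgroup \<Gamma> (G \<times>\<times> Sym n)" and ne: "fixed_set P n \<Gamma> \<noteq> {}"
  shows "fixed_set Q n \<Gamma> \<noteq> {}"
proof -
  interpret P: N_infinity_operad G P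
    by (rule P)
  interpret Q: N_infinity_operad G Q
    by (rule Q)
  interpret S: group "Sym n"
    by (rule group_Sym)
  obtain x where x: "x \<in> ops P n" "\<And>\<gamma>. \<gamma> \<in> \<Gamma> \<Longrightarrow> oact P n \<gamma> x = x"
    using ne by (auto simp: fixed_set_def)
  have \<Gamma>c: "h \<in> carrier G" "\<sigma> \<in> carrier (Sym n)" if "(h, \<sigma>) \<in> \<Gamma>" for h \<sigma>
    using subgroup.mem_carrier[OF \<Gamma> that] by (auto simp: DirProd_def)
  define H where "H = fst ` \<Gamma>"
  have "group_hom (G \<times>\<times> Sym n) G fst"
    unfolding group_hom_def group_hom_axioms_def hom_def
    using P.group_DirProd_Sym P.is_group by (auto simp: DirProd_def)
  then have H: "subgroup H G"
    unfolding H_def by (rule group_hom.subgroup_img_is_subgroup[OF _ \<Gamma>])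
  have "\<forall>h \<in> H. \<exists>\<sigma>. (h, \<sigma>) \<in> \<Gamma>"
    by (auto simp: H_def)
  then obtain \<rho> where \<rho>: "\<And>h. h \<in> H \<Longrightarrow> (h, \<rho> h) \<in> \<Gamma>"
    by metis
  \<comment> \<open>By freeness of \<open>P\<close>, at most one permutation lies over each group
    element.\<close>
  have uniq: "\<sigma> = \<rho> h" if "(h, \<sigma>) \<in> \<Gamma>" for h \<sigma>
  proof -
    have h: "(h, \<rho> h) \<in> \<Gamma>"
      using \<rho> that by (force simp: H_def)
    show ?thesis
      using P.oact_eq_imp_eq[OF \<Gamma>c(1)[OF that] \<Gamma>c(2)[OF that] \<Gamma>c(2)[OF h] x(1)] x(2)[OF that] x(2)[OF h]
      by simp
  qed
  let ?T = "({..<n}, \<rho>)"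
  have mult: "\<rho> (h \<otimes>\<^bsub>G\<^esub> k) i = \<rho> h (\<rho> k i)" if "h \<in> H" "k \<in> H" "i < n" for h k i
  proof -
    have "(h \<otimes>\<^bsub>G\<^esub> k, \<rho> h \<otimes>\<^bsub>Sym n\<^esub> \<rho> k) \<in> \<Gamma>"
      using subgroup.m_closed[OF \<Gamma> \<rho>[OF that(1)] \<rho>[OF that(2)]] by (simp add: DirProd_def)
    then have "\<rho> h \<otimes>\<^bsub>Sym n\<^esub> \<rho> k = \<rho> (h \<otimes>\<^bsub>G\<^esub> k)"
      by (rule uniq)
    then show ?thesis
      using mult_Sym_apply[OF \<Gamma>c(2)[OF \<rho>[OF that(1)]] \<Gamma>c(2)[OF \<rho>[OF that(2)]] that(3)] by simp
  qed
  have "(\<one>\<^bsub>G\<^esub>, \<one>\<^bsub>Sym n\<^esub>) \<in> \<Gamma>"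
    using subgroup.one_closed[OF \<Gamma>] by simp
  then have "\<rho> \<one>\<^bsub>G\<^esub> = \<one>\<^bsub>Sym n\<^esub>"
    using uniq by simp
  then have T: "hset_action G H ?T"
    using mult Sym_apply_less[OF \<Gamma>c(2)[OF \<rho>]] by (auto simp: hset_action_def one_Sym)
  have fin: "finite (fst ?T)"
    by simp
  have "fixes_graph P H ?T n id x"
    unfolding fixes_graph_def using x \<rho> \<Gamma>c(2)[OF \<rho>] by auto
  then have "admissible P H ?T"
    unfolding admissible_def by blast
  then have *: "admissible P H (coset_hset G H {h \<in> H. snd ?T h t = t})" if "t \<in> fst ?T" for t
    using P.admissible_iff_orbits[OF H T fin] that by blast
  have "admissible Q H (coset_hset G H {h \<in> H. snd ?T h t = t})" if t: "t \<in> fst ?T" for t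
  proof -
    have S: "subgroup {h \<in> H. snd ?T h t = t} G" "{h \<in> H. snd ?T h t = t} \<subseteq> H"
      using P.stabilizer_hset_subgroup[OF H T t] by auto
    show ?thesis
      using *[OF t] P.admissible_coset_iff_norm[OF H S] Q.admissible_coset_iff_norm[OF H S] norms by blast
  qed
  then have "admissible Q H ?T"
    using Q.admissible_iff_orbits[OF H T fin] by blast
  then obtain m e y where y: "bij_betw e {..<m} {..<n}" "y \<in> ops Q m"
    "\<And>h. h \<in> H \<Longrightarrow> \<exists>\<sigma> \<in> carrier (Sym m). (\<forall>i<m. e (\<sigma> i) = \<rho> h (e i)) \<and> oact Q m (h, \<sigma>) y = y"
    unfolding admissible_def fixes_graph_def by auto
  have mn: "m = n"
    using bij_betw_same_card[OF y(1)] by simp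
  \<comment> \<open>Admissibility for \<open>Q\<close> comes with an ordering \<open>e\<close> of
    its own. Acting on \<open>y\<close> by \<open>e\<close>, read as a permutation, changes the
    fixing subgroup from the graph in this ordering to \<open>\<Gamma>\<close> itself.\<close>
  define s where "s = restrict e {..<n}"
  have s: "s \<in> carrier (Sym n)"
    using y(1) mn by (simp add: s_def carrier_Sym Bij_def)
  have "oact Q n \<gamma> (sact G Q n s y) = sact G Q n s y" if \<gamma>: "\<gamma> \<in> \<Gamma>" for \<gamma>
  proof -
    obtain h where h: "\<gamma> = (h, \<rho> h)" "h \<in> H"
      using uniq \<gamma> by (metis H_def image_eqI prod.collapse fst_conv)
    have hG: "h \<in> carrier G" and \<rho>h: "\<rho> h \<in> carrier (Sym n)"
      using \<Gamma>c[OF \<rho>[OF h(2)]] .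
    obtain t where t: "t \<in> carrier (Sym n)" "\<And>i. i < n \<Longrightarrow> e (t i) = \<rho> h (e i)" "oact Q n (h, t) y = y"
      using y(3)[OF h(2)] mn by blast
    have yn: "y \<in> ops Q n"
      using y(2) mn by simp
    have "\<rho> h \<otimes>\<^bsub>Sym n\<^esub> s = s \<otimes>\<^bsub>Sym n\<^esub> t"
    proof (rule Sym_eqI[OF S.m_closed[OF \<rho>h s] S.m_closed[OF s t(1)]])
      fix i assume i: "i < n"
      show "(\<rho> h \<otimes>\<^bsub>Sym n\<^esub> s) i = (s \<otimes>\<^bsub>Sym n\<^esub> t) i"
        unfolding mult_Sym_apply[OF \<rho>h s i] mult_Sym_apply[OF s t(1) i]
        using t(2)[OF i] Sym_apply_less[OF t(1) i] i by (simp add: s_def)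
    qed
    then have "oact Q n (h, \<rho> h) (sact G Q n s y) = sact G Q n s (oact Q n (h, t) y)"
      using Q.oact_oact[OF hG \<rho>h P.one_closed s yn] Q.oact_oact[OF P.one_closed s hG t(1) yn] hG by simp
    then show ?thesis
      using t(3) h by simp
  qed
  moreover have "sact G Q n s y \<in> ops Q n"
    using Q.sact_closed[OF s] y(2) mn by simp
  ultimately show ?thesis
    unfolding fixed_set_def by blast
qed

section \<open>Operads with indiscrete spaces\<close>

text \<open>Bijectivity comes for free, since inverse elements act by inverse functions.\<close>

lemma group_actionI:
  assumes A: "group A" and ext: "\<And>a. a \<in> carrier A \<Longrightarrow> \<phi> a \<in> extensional E"
    and closed: "\<And>a x. a \<in> carrier A \<Longrightarrow> x \<in> E \<Longrightarrow> \<phi> a x \<in> E"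
    and one: "\<And>x. x \<in> E \<Longrightarrow> \<phi> \<one>\<^bsub>A\<^esub> x = x"
    and mult: "\<And>a b x. a \<in> carrier A \<Longrightarrow> b \<in> carrier A \<Longrightarrow> x \<in> E \<Longrightarrow> \<phi> (a \<otimes>\<^bsub>A\<^esub> b) x = \<phi> a (\<phi> b x)"
  shows "group_action A E \<phi>"
proof -
  interpret A: group A
    by (rule A)
  have bij: "\<phi> a \<in> Bij E" if a: "a \<in> carrier A" for a
  proof -
    have "bij_betw (\<phi> a) E E"
    proof (rule bij_betw_byWitness[where f' = "\<phi> (inv\<^bsub>A\<^esub> a)"])
      show "\<forall>x \<in> E. \<phi> (inv\<^bsub>A\<^esub> a) (\<phi> a x) = x" "\<forall>x \<in> E. \<phi> a (\<phi> (inv\<^bsub>A\<^esub> a) x) = x"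
        using a one by (simp_all add: mult[symmetric])
    qed (use a closed in auto)
    then show ?thesis
      using ext[OF a] by (simp add: Bij_def)
  qed
  have "\<phi> (a \<otimes>\<^bsub>A\<^esub> b) = \<phi> a \<otimes>\<^bsub>BijGroup E\<^esub> \<phi> b" if "a \<in> carrier A" "b \<in> carrier A" for a b
  proof (rule extensionalityI[of _ E])
    show "\<phi> a \<otimes>\<^bsub>BijGroup E\<^esub> \<phi> b \<in> extensional E"
      using bij that by (simp add: BijGroup_def)
  qed (use that bij mult ext in \<open>simp_all add: BijGroup_def compose_def\<close>)
  then have "group_hom A (BijGroup E) \<phi>"
    unfolding group_hom_def group_hom_axioms_def hom_def
    using A group_BijGroup bij by (auto simp: BijGroup_def)
  then show ?thesis
    by (simp add: group_action_def)
qed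

lemma length_block_slice:
  assumes "length ms = sum_list ns" "i < length ns"
  shows "length (block_slice ns ms i) = ns ! i"
  using block_start_mono[of "Suc i" "length ns" ns] assms
  by (simp add: block_slice_def block_start_Suc block_start_length)

lemma nth_block_slice:
  assumes "length ms = sum_list ns" "i < length ns" "r < ns ! i"
  shows "block_slice ns ms i ! r = ms ! (block_start ns i + r)"
  using block_pos_less[OF assms(2,3)] assms by (simp add: block_slice_def)

text \<open>Consecutive slices of \<open>ms\<close> concatenate to an initial segment of it.\<close>

lemma sum_list_block_slices_upt:
  fixes ms :: "nat list"
  assumes "m \<le> length ns"
  shows "sum_list (map (\<lambda>i. sum_list (block_slice ns ms i)) [0..<m]) = sum_list (take (block_start ns m) ms)"
  using assms
  by (induction m) (simp_all add: block_start_Suc take_add block_slice_def, simp add: block_start_def)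

lemma sum_list_block_slices:
  fixes ms :: "nat list"
  shows "length ms = sum_list ns \<Longrightarrow>
    sum_list (map (\<lambda>i. sum_list (block_slice ns ms i)) [0..<length ns]) = sum_list ms"
  by (simp add: sum_list_block_slices_upt block_start_length)

lemma inputsI:
  "(\<And>i. i < length ns \<Longrightarrow> f i \<in> ops P (ns ! i)) \<Longrightarrow> (\<lambda>i \<in> {..<length ns}. f i) \<in> inputs P ns"
  by auto

lemma inputsD: "y \<in> inputs P ns \<Longrightarrow> i < length ns \<Longrightarrow> y i \<in> ops P (ns ! i)"
  by auto

text \<open>The axioms are equations, so a jointly injective family of structure preserving functions
  to operads pulls them back.\<close>

lemma G_operad_pulled_back:
  fixes R :: "('g, 'a) operad_data" and Q :: "'i \<Rightarrow> ('g, 'b) operad_data"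
  assumes G: "group G" and Q: "\<And>i. G_operad G (Q i)"
    and ind: "\<And>n. ospace R n = indiscrete (ops R n)"
    and ext: "\<And>n a. oact R n a \<in> extensional (ops R n)"
    and act_closed: "\<And>n a x. a \<in> carrier (G \<times>\<times> Sym n) \<Longrightarrow> x \<in> ops R n \<Longrightarrow> oact R n a x \<in> ops R n"
    and unit_closed: "ounit R \<in> ops R 1"
    and comp_closed: "\<And>ns x y. x \<in> ops R (length ns) \<Longrightarrow> y \<in> inputs R ns \<Longrightarrow> ocomp R ns x y \<in> ops R (sum_list ns)"
    and \<phi>: "\<And>i n x. x \<in> ops R n \<Longrightarrow> \<phi> i n x \<in> ops (Q i) n"
    and \<phi>_act: "\<And>i n a x. a \<in> carrier (G \<times>\<times> Sym n) \<Longrightarrow> x \<in> ops R n \<Longrightarrow>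
      \<phi> i n (oact R n a x) = oact (Q i) n a (\<phi> i n x)"
    and \<phi>_unit: "\<And>i. \<phi> i 1 (ounit R) = ounit (Q i)"
    and \<phi>_comp: "\<And>i ns x y. x \<in> ops R (length ns) \<Longrightarrow> y \<in> inputs R ns \<Longrightarrow>
      \<phi> i (sum_list ns) (ocomp R ns x y) =
      ocomp (Q i) ns (\<phi> i (length ns) x) (\<lambda>j \<in> {..<length ns}. \<phi> i (ns ! j) (y j))"
    and inj: "\<And>n x y. x \<in> ops R n \<Longrightarrow> y \<in> ops R n \<Longrightarrow> (\<And>i. \<phi> i n x = \<phi> i n y) \<Longrightarrow> x = y"
  shows "G_operad G R"
proof -
  interpret G: group G
    by (rule G)
  interpret Q: G_operad G "Q i" for i
    by (rule Q)
  have A: "group (G \<times>\<times> Sym n)" for n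
    by (rule G.group_DirProd_Sym)
  have gc: "(g, \<one>\<^bsub>Sym n\<^esub>) \<in> carrier (G \<times>\<times> Sym n)" if "g \<in> carrier G" for g n
    using that group.is_monoid[OF group_Sym, of n] by (simp add: DirProd_def monoid.one_closed)
  have sc: "(\<one>\<^bsub>G\<^esub>, \<sigma>) \<in> carrier (G \<times>\<times> Sym n)" if "\<sigma> \<in> carrier (Sym n)" for \<sigma> n
    using that by (simp add: DirProd_def)
  note [simp] = \<phi>_act[OF gc] \<phi>_act[OF sc] act_closed[OF gc] act_closed[OF sc]
  have \<Phi>: "(\<lambda>j \<in> {..<length ns}. \<phi> i (ns ! j) (y j)) \<in> inputs (Q i) ns" if "y \<in> inputs R ns" for i ns y
    using inputsD[OF that] \<phi> by (intro inputsI) blast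
  show ?thesis
  proof
    fix n
    have "group_action (G \<times>\<times> Sym n) (ops R n) (oact R n)"
    proof (rule group_actionI[OF A ext])
      fix a b x assume a: "a \<in> carrier (G \<times>\<times> Sym n)" and b: "b \<in> carrier (G \<times>\<times> Sym n)" and x: "x \<in> ops R n"
      show "oact R n a x \<in> ops R n"
        using act_closed a x .
      have ab: "a \<otimes>\<^bsub>G \<times>\<times> Sym n\<^esub> b \<in> carrier (G \<times>\<times> Sym n)"
        using monoid.m_closed[OF group.is_monoid[OF A] a b] .
      show "oact R n (a \<otimes>\<^bsub>G \<times>\<times> Sym n\<^esub> b) x = oact R n a (oact R n b x)"
      proof (rule inj)
        show "\<phi> i n (oact R n (a \<otimes>\<^bsub>G \<times>\<times> Sym n\<^esub> b) x) = \<phi> i n (oact R n a (oact R n b x))" for i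
          using \<phi>_act[OF ab x] \<phi>_act[OF a act_closed[OF b x]] \<phi>_act[OF b x]
            group_action.composition_rule[OF Q.group_action_ops \<phi>[OF x] a b] by simp
      qed (use act_closed[OF ab x] act_closed[OF a act_closed[OF b x]] in auto)
    next
      fix x assume x: "x \<in> ops R n"
      have one: "\<one>\<^bsub>G \<times>\<times> Sym n\<^esub> \<in> carrier (G \<times>\<times> Sym n)"
        using monoid.one_closed[OF group.is_monoid[OF A]] .
      show "oact R n \<one>\<^bsub>G \<times>\<times> Sym n\<^esub> x = x"
      proof (rule inj)
        show "\<phi> i n (oact R n \<one>\<^bsub>G \<times>\<times> Sym n\<^esub> x) = \<phi> i n x" for i
          using \<phi>_act[OF one x] Q.oact_one[OF \<phi>[OF x]] by simp
      qed (use act_closed[OF one x] x in auto)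
    qed
    moreover have "continuous_map (ospace R n) (ospace R n) (oact R n a)" if "a \<in> carrier (G \<times>\<times> Sym n)" for a
      \<comment> \<open>Only the target space is rewritten as an indiscrete one, whereupon
        continuity means that values stay in it.\<close>
      by (subst (2) ind) (use act_closed that in auto)
    ultimately show "continuous_action (G \<times>\<times> Sym n) (ospace R n) (oact R n)"
      by (simp add: continuous_action_def)
  next
    show "ounit R \<in> ops R 1"
      by (rule unit_closed)
    show "gact R 1 g (ounit R) = ounit R" if g: "g \<in> carrier G" for g
    proof (rule inj)
      show "\<phi> i 1 (gact R 1 g (ounit R)) = \<phi> i 1 (ounit R)" for i
        using \<phi>_act[OF gc[OF g] unit_closed] Q.unit_fixed[OF g] \<phi>_unit by simp
    qed (use act_closed[OF gc[OF g] unit_closed] unit_closed in auto)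
  next
    fix ns
    show "continuous_map (prod_topology (ospace R (length ns))
            (product_topology (\<lambda>i. ospace R (ns ! i)) {..<length ns}))
         (ospace R (sum_list ns)) (\<lambda>(x, y). ocomp R ns x y)"
      by (subst (3) ind) (use comp_closed in auto)
  next
    fix g ns x y
    assume g: "g \<in> carrier G" and x: "x \<in> ops R (length ns)" and y: "y \<in> inputs R ns"
    have gx: "gact R (length ns) g x \<in> ops R (length ns)"
      using g x by simp
    have gy: "(\<lambda>i \<in> {..<length ns}. gact R (ns ! i) g (y i)) \<in> inputs R ns"
      using g inputsD[OF y] by (intro inputsI) simp
    show "gact R (sum_list ns) g (ocomp R ns x y) =
         ocomp R ns (gact R (length ns) g x) (\<lambda>i \<in> {..<length ns}. gact R (ns ! i) g (y i))"
    proof (rule inj)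
      fix i
      have "\<phi> i (sum_list ns) (gact R (sum_list ns) g (ocomp R ns x y)) =
          gact (Q i) (sum_list ns) g (ocomp (Q i) ns (\<phi> i (length ns) x) (\<lambda>j \<in> {..<length ns}. \<phi> i (ns ! j) (y j)))"
        using g comp_closed[OF x y] by (simp add: \<phi>_comp[OF x y])
      also have "\<dots> = ocomp (Q i) ns (gact (Q i) (length ns) g (\<phi> i (length ns) x))
          (\<lambda>j \<in> {..<length ns}. gact (Q i) (ns ! j) g ((\<lambda>j \<in> {..<length ns}. \<phi> i (ns ! j) (y j)) j))"
        by (rule Q.comp_equivariant[OF g \<phi>[OF x] \<Phi>[OF y]])
      also have "\<dots> = \<phi> i (sum_list ns) (ocomp R ns (gact R (length ns) g x) (\<lambda>i \<in> {..<length ns}. gact R (ns ! i) g (y i)))"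
        unfolding \<phi>_comp[OF gx gy] using g x inputsD[OF y]
        by (intro arg_cong2[where f = "ocomp (Q i) ns"] restrict_ext) simp_all
      finally show "\<phi> i (sum_list ns) (gact R (sum_list ns) g (ocomp R ns x y)) = \<dots>" .
    qed (use g comp_closed[OF x y] comp_closed[OF gx gy] in auto)
  next
    fix n x assume x: "x \<in> ops R n"
    have y: "(\<lambda>i \<in> {..<1}. x) \<in> inputs R [n]"
      using x by auto
    have u: "ounit R \<in> ops R (length [n])"
      using unit_closed by simp
    show "ocomp R [n] (ounit R) (\<lambda>i \<in> {..<1}. x) = x"
    proof (rule inj)
      fix i
      have s: "sum_list [n] = n" "length [n] = 1"
        by simp_all
      have "\<phi> i n (ocomp R [n] (ounit R) (\<lambda>i \<in> {..<1}. x)) =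
          ocomp (Q i) [n] (\<phi> i 1 (ounit R)) (\<lambda>j \<in> {..<1}. \<phi> i ([n] ! j) ((\<lambda>i \<in> {..<1}. x) j))"
        using \<phi>_comp[OF u y, of i] unfolding s .
      also have "(\<lambda>j \<in> {..<1}. \<phi> i ([n] ! j) ((\<lambda>i \<in> {..<1}. x) j)) = (\<lambda>j \<in> {..<1}. \<phi> i n x)"
        by (intro restrict_ext) simp
      finally show "\<phi> i n (ocomp R [n] (ounit R) (\<lambda>i \<in> {..<1}. x)) = \<phi> i n x"
        by (simp only: Q.unit_left[OF \<phi>[OF x]] \<phi>_unit)
    qed (use comp_closed[OF u y] x in auto)
  next
    fix n x assume x: "x \<in> ops R n"
    let ?ns = "replicate n (1::nat)"
    have s: "sum_list ?ns = n" "length ?ns = n"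
      by (simp_all add: sum_list_replicate)
    have y: "(\<lambda>i \<in> {..<n}. ounit R) \<in> inputs R ?ns" and x': "x \<in> ops R (length ?ns)"
      using unit_closed x by auto
    show "ocomp R ?ns x (\<lambda>i \<in> {..<n}. ounit R) = x"
    proof (rule inj)
      fix i
      have "\<phi> i n (ocomp R ?ns x (\<lambda>i \<in> {..<n}. ounit R)) =
          ocomp (Q i) ?ns (\<phi> i n x) (\<lambda>j \<in> {..<n}. \<phi> i (?ns ! j) ((\<lambda>i \<in> {..<n}. ounit R) j))"
        using \<phi>_comp[OF x' y, of i] unfolding s .
      also have "(\<lambda>j \<in> {..<n}. \<phi> i (?ns ! j) ((\<lambda>i \<in> {..<n}. ounit R) j)) = (\<lambda>j \<in> {..<n}. ounit (Q i))"
        using \<phi>_unit by (intro restrict_ext) simp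
      finally show "\<phi> i n (ocomp R ?ns x (\<lambda>i \<in> {..<n}. ounit R)) = \<phi> i n x"
        by (simp only: Q.unit_right[OF \<phi>[OF x]])
    qed (use comp_closed[OF x' y] s x in auto)
  next
    fix ns ms x y z
    assume x: "x \<in> ops R (length ns)" and y: "y \<in> inputs R ns"
      and len: "length ms = sum_list ns" and z: "z \<in> inputs R ms"
    let ?s = "block_slice ns ms"
    let ?ks = "map (\<lambda>i. sum_list (?s i)) [0..<length ns]"
    let ?z = "\<lambda>i. \<lambda>r \<in> {..<ns ! i}. z (block_start ns i + r)"
    note ls = length_block_slice[OF len] and nths = nth_block_slice[OF len]
    have zi: "?z i \<in> inputs R (?s i)" "y i \<in> ops R (length (?s i))" if i: "i < length ns" for i
    proof -
      have "z (block_start ns i + r) \<in> ops R (?s i ! r)" if r: "r < ns ! i" for r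
        using inputsD[OF z, of "block_start ns i + r"] block_pos_less[OF i r] nths[OF i r] len by simp
      then show "?z i \<in> inputs R (?s i)"
        using inputsI[of "?s i"] ls[OF i] by metis
      show "y i \<in> ops R (length (?s i))"
        using inputsD[OF y i] ls[OF i] by simp
    qed
    have lk: "length ?ks = length ns" "\<And>i. i < length ns \<Longrightarrow> ?ks ! i = sum_list (?s i)"
      by simp_all
    have inner: "(\<lambda>i \<in> {..<length ns}. ocomp R (?s i) (y i) (?z i)) \<in> inputs R ?ks"
      using comp_closed[OF zi(2,1)] lk inputsI[of ?ks] by auto
    have x': "x \<in> ops R (length ?ks)"
      using x by simp
    have outer: "ocomp R ns x y \<in> ops R (length ms)"
      using comp_closed[OF x y] len by simp
    have sum: "sum_list ?ks = sum_list ms"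
      by (rule sum_list_block_slices[OF len])
    show "ocomp R ms (ocomp R ns x y) z = ocomp R ?ks x (\<lambda>i \<in> {..<length ns}. ocomp R (?s i) (y i) (?z i))"
    proof (rule inj)
      fix i
      let ?Y = "\<lambda>j \<in> {..<length ns}. \<phi> i (ns ! j) (y j)" and ?Z = "\<lambda>j \<in> {..<length ms}. \<phi> i (ms ! j) (z j)"
      have "\<phi> i (sum_list ms) (ocomp R ms (ocomp R ns x y) z) =
          ocomp (Q i) ms (ocomp (Q i) ns (\<phi> i (length ns) x) ?Y) ?Z"
        using \<phi>_comp[OF outer z] \<phi>_comp[OF x y] len by simp
      also have "\<dots> = ocomp (Q i) ?ks (\<phi> i (length ns) x) (\<lambda>j \<in> {..<length ns}.
          ocomp (Q i) (?s j) (?Y j) (\<lambda>r \<in> {..<ns ! j}. ?Z (block_start ns j + r)))"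
        by (rule Q.comp_assoc[OF \<phi>[OF x] \<Phi>[OF y] len \<Phi>[OF z]])
      also have "(\<lambda>j \<in> {..<length ns}. ocomp (Q i) (?s j) (?Y j) (\<lambda>r \<in> {..<ns ! j}. ?Z (block_start ns j + r))) =
          (\<lambda>j \<in> {..<length ns}. \<phi> i (?ks ! j) ((\<lambda>i \<in> {..<length ns}. ocomp R (?s i) (y i) (?z i)) j))"
      proof (rule restrict_ext)
        fix j assume "j \<in> {..<length ns}"
        then have j: "j < length ns"
          by simp
        have "(\<lambda>r \<in> {..<ns ! j}. ?Z (block_start ns j + r)) = (\<lambda>r \<in> {..<length (?s j)}. \<phi> i (?s j ! r) (?z j r))"
          unfolding ls[OF j] using nths[OF j] block_pos_less[OF j] len by (intro restrict_ext) simp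
        then show "ocomp (Q i) (?s j) (?Y j) (\<lambda>r \<in> {..<ns ! j}. ?Z (block_start ns j + r)) =
            \<phi> i (?ks ! j) ((\<lambda>i \<in> {..<length ns}. ocomp R (?s i) (y i) (?z i)) j)"
          using \<phi>_comp[OF zi(2,1)[OF j]] j ls[OF j] by simp
      qed
      also have "ocomp (Q i) ?ks (\<phi> i (length ns) x) \<dots> =
          \<phi> i (sum_list ?ks) (ocomp R ?ks x (\<lambda>i \<in> {..<length ns}. ocomp R (?s i) (y i) (?z i)))"
        using \<phi>_comp[OF x' inner] by simp
      finally show "\<phi> i (sum_list ms) (ocomp R ms (ocomp R ns x y) z) =
          \<phi> i (sum_list ms) (ocomp R ?ks x (\<lambda>i \<in> {..<length ns}. ocomp R (?s i) (y i) (?z i)))"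
        unfolding sum .
    qed (use comp_closed[OF outer z] comp_closed[OF x' inner] sum in auto)
  next
    fix ns \<sigma> x y
    assume \<sigma>: "\<sigma> \<in> carrier (Sym (length ns))" and x: "x \<in> ops R (length ns)" and y: "y \<in> inputs R ns"
    let ?ms = "permute_list_by \<sigma> ns"
    have s: "sum_list ?ms = sum_list ns"
      by (rule sum_list_permute_list_by[OF \<sigma>])
    have x': "x \<in> ops R (length ?ms)"
      using x by simp
    have y': "(\<lambda>i \<in> {..<length ns}. y (\<sigma> i)) \<in> inputs R ?ms"
      using inputsI[of ?ms "\<lambda>i. y (\<sigma> i)" R] inputsD[OF y Sym_apply_less[OF \<sigma>]] by simp
    have c: "ocomp R ?ms x (\<lambda>i \<in> {..<length ns}. y (\<sigma> i)) \<in> ops R (sum_list ns)"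
      using comp_closed[OF x' y'] s by simp
    have sx: "sact G R (length ns) \<sigma> x \<in> ops R (length ns)"
      using \<sigma> x by simp
    show "ocomp R ns (sact G R (length ns) \<sigma> x) y =
         sact G R (sum_list ns) (block_perm ns \<sigma>) (ocomp R ?ms x (\<lambda>i \<in> {..<length ns}. y (\<sigma> i)))"
    proof (rule inj)
      fix i
      let ?Y = "\<lambda>j \<in> {..<length ns}. \<phi> i (ns ! j) (y j)"
      have "\<phi> i (sum_list ns) (ocomp R ns (sact G R (length ns) \<sigma> x) y) =
          ocomp (Q i) ns (sact G (Q i) (length ns) \<sigma> (\<phi> i (length ns) x)) ?Y"
        using \<phi>_comp[OF sx y] \<sigma> x by simp
      also have "\<dots> = sact G (Q i) (sum_list ns) (block_perm ns \<sigma>)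
          (ocomp (Q i) ?ms (\<phi> i (length ns) x) (\<lambda>j \<in> {..<length ns}. ?Y (\<sigma> j)))"
        by (rule Q.comp_outer_symmetry[OF \<sigma> \<phi>[OF x] \<Phi>[OF y]])
      also have "(\<lambda>j \<in> {..<length ns}. ?Y (\<sigma> j)) =
          (\<lambda>j \<in> {..<length ?ms}. \<phi> i (?ms ! j) ((\<lambda>i \<in> {..<length ns}. y (\<sigma> i)) j))"
        unfolding length_permute_list_by using Sym_apply_less[OF \<sigma>] by (intro restrict_ext) simp
      also have "ocomp (Q i) ?ms (\<phi> i (length ns) x) \<dots> =
          \<phi> i (sum_list ns) (ocomp R ?ms x (\<lambda>i \<in> {..<length ns}. y (\<sigma> i)))"
        using \<phi>_comp[OF x' y', of i] s by simp
      also have "sact G (Q i) (sum_list ns) (block_perm ns \<sigma>) \<dots> =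
          \<phi> i (sum_list ns) (sact G R (sum_list ns) (block_perm ns \<sigma>) (ocomp R ?ms x (\<lambda>i \<in> {..<length ns}. y (\<sigma> i))))"
        using block_perm_closed[OF \<sigma>] c by simp
      finally show "\<phi> i (sum_list ns) (ocomp R ns (sact G R (length ns) \<sigma> x) y) = \<dots>" .
    qed (use comp_closed[OF sx y] block_perm_closed[OF \<sigma>] c in auto)
  next
    fix ns \<tau> x y
    assume \<tau>: "\<And>i. i < length ns \<Longrightarrow> \<tau> i \<in> carrier (Sym (ns ! i))"
      and x: "x \<in> ops R (length ns)" and y: "y \<in> inputs R ns"
    have ty: "(\<lambda>i \<in> {..<length ns}. sact G R (ns ! i) (\<tau> i) (y i)) \<in> inputs R ns"
      using \<tau> inputsD[OF y] by (intro inputsI) simp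
    have bs: "block_sum ns \<tau> \<in> carrier (Sym (sum_list ns))"
      using \<tau> by (rule block_sum_closed)
    show "ocomp R ns x (\<lambda>i \<in> {..<length ns}. sact G R (ns ! i) (\<tau> i) (y i)) =
         sact G R (sum_list ns) (block_sum ns \<tau>) (ocomp R ns x y)"
    proof (rule inj)
      fix i
      let ?Y = "\<lambda>j \<in> {..<length ns}. \<phi> i (ns ! j) (y j)"
      have "\<phi> i (sum_list ns) (ocomp R ns x (\<lambda>i \<in> {..<length ns}. sact G R (ns ! i) (\<tau> i) (y i))) =
          ocomp (Q i) ns (\<phi> i (length ns) x) (\<lambda>j \<in> {..<length ns}. sact G (Q i) (ns ! j) (\<tau> j) (?Y j))"
        unfolding \<phi>_comp[OF x ty] using \<tau> inputsD[OF y]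
        by (intro arg_cong2[where f = "ocomp (Q i) ns"] restrict_ext HOL.refl) simp
      also have "\<dots> = sact G (Q i) (sum_list ns) (block_sum ns \<tau>) (ocomp (Q i) ns (\<phi> i (length ns) x) ?Y)"
        by (rule Q.comp_inner_symmetry[OF \<tau> \<phi>[OF x] \<Phi>[OF y]])
      also have "\<dots> = \<phi> i (sum_list ns) (sact G R (sum_list ns) (block_sum ns \<tau>) (ocomp R ns x y))"
        using bs comp_closed[OF x y] \<phi>_comp[OF x y] by simp
      finally show "\<phi> i (sum_list ns) (ocomp R ns x (\<lambda>i \<in> {..<length ns}. sact G R (ns ! i) (\<tau> i) (y i))) = \<dots>" .
    qed (use comp_closed[OF x ty] comp_closed[OF x y] bs in auto)
  qed
qed

text \<open>A copy of the operations \<open>W n\<close> of \<open>B\<close> inside the type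
  \<open>'a\<close>, made indiscrete. One injection on the union of all arities is used, so that
  decoding does not depend on the arity.\<close>

definition encode_operad ::
  "('b \<Rightarrow> 'a) \<Rightarrow> (nat \<Rightarrow> 'b set) \<Rightarrow> ('g, 'b) operad_data \<Rightarrow> ('g, 'a) operad_data" where
  "encode_operad enc W B =
     (let dec = inv_into (\<Union>n. W n) enc in
      \<lparr>ospace = \<lambda>n. indiscrete (enc ` W n),
       oact = \<lambda>n a. \<lambda>z \<in> enc ` W n. enc (oact B n a (dec z)),
       ounit = enc (ounit B),
       ocomp = \<lambda>ns x y. enc (ocomp B ns (dec x) (\<lambda>i \<in> {..<length ns}. dec (y i)))\<rparr>)"

text \<open>It is used three times: with all operations of \<open>P\<close> and the identity, with
  pairs of operations and a pairing function, and with norm trees inside the operad of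
  words.\<close>

locale suboperad = B: G_operad G B for G :: "('g, 'm) monoid_scheme" and B :: "('g, 'b) operad_data" +
  fixes W :: "nat \<Rightarrow> 'b set" and enc :: "'b \<Rightarrow> 'a"
  assumes W_subset: "W n \<subseteq> ops B n"
    and W_act: "a \<in> carrier (G \<times>\<times> Sym n) \<Longrightarrow> w \<in> W n \<Longrightarrow> oact B n a w \<in> W n"
    and W_unit: "ounit B \<in> W 1"
    and W_comp: "x \<in> W (length ns) \<Longrightarrow> y \<in> (\<Pi>\<^sub>E i \<in> {..<length ns}. W (ns ! i)) \<Longrightarrow>
      ocomp B ns x y \<in> W (sum_list ns)"
    and enc_inj: "inj_on enc (\<Union>n. W n)"
begin

abbreviation R :: "('g, 'a) operad_data" where "R \<equiv> encode_operad enc W B"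

abbreviation dec :: "'a \<Rightarrow> 'b" where "dec \<equiv> inv_into (\<Union>n. W n) enc"

lemma dec_enc [simp]: "w \<in> W n \<Longrightarrow> dec (enc w) = w"
  using enc_inj by (intro inv_into_f_f) auto

lemma ops_R: "ops R n = enc ` W n"
  and ospace_R: "ospace R n = indiscrete (enc ` W n)"
  and ounit_R: "ounit R = enc (ounit B)"
  and ocomp_R: "ocomp R ns x y = enc (ocomp B ns (dec x) (\<lambda>i \<in> {..<length ns}. dec (y i)))"
  by (simp_all add: encode_operad_def Let_def)

lemma oact_R: "oact R n a = (\<lambda>z \<in> enc ` W n. enc (oact B n a (dec z)))"
  by (simp add: encode_operad_def Let_def)

lemma oact_R_enc: "w \<in> W n \<Longrightarrow> oact R n a (enc w) = enc (oact B n a w)"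
  by (simp add: oact_R)

lemma dec_R: "x \<in> ops R n \<Longrightarrow> dec x \<in> W n \<and> enc (dec x) = x"
  by (auto simp: ops_R)

lemma G_operad_R: "G_operad G R"
\<comment> \<open>A one-element family is enough, because \<open>dec\<close> alone is
  injective.\<close>
proof (rule G_operad_pulled_back[where Q = "\<lambda>_ :: unit. B" and \<phi> = "\<lambda>_ _. dec"])
  fix ns x y assume x: "x \<in> ops R (length ns)" and y: "y \<in> inputs R ns"
  have "(\<lambda>i \<in> {..<length ns}. dec (y i)) \<in> (\<Pi>\<^sub>E i \<in> {..<length ns}. W (ns ! i))"
    using dec_R[OF inputsD[OF y]] by auto
  then have W: "ocomp B ns (dec x) (\<lambda>i \<in> {..<length ns}. dec (y i)) \<in> W (sum_list ns)"
    using W_comp dec_R[OF x] by blast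
  then show "ocomp R ns x y \<in> ops R (sum_list ns)"
    by (simp add: ops_R ocomp_R)
  show "dec (ocomp R ns x y) = ocomp B ns (dec x) (\<lambda>j \<in> {..<length ns}. dec (y j))"
    using W by (simp add: ocomp_R)
next
  fix n a x assume a: "a \<in> carrier (G \<times>\<times> Sym n)" and x: "x \<in> ops R n"
  have W: "oact B n a (dec x) \<in> W n"
    using W_act[OF a] dec_R[OF x] by blast
  then show "oact R n a x \<in> ops R n" "dec (oact R n a x) = oact B n a (dec x)"
    using x by (auto simp: oact_R ops_R)
next
  fix n x y assume "x \<in> ops R n" "y \<in> ops R n" and "\<And>i :: unit. dec x = dec y"
  then show "x = y"
    using dec_R by metis
next
  show "dec (ounit R) = ounit B"
    using W_unit by (simp add: ounit_R)
qed (use W_unit W_subset[THEN subsetD] dec_R B.is_group in \<open>auto simp: ospace_R ounit_R oact_R ops_R B.G_operad_axioms\<close>)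

lemma fixed_set_R:
  assumes "\<Gamma> \<subseteq> carrier (G \<times>\<times> Sym n)"
  shows "fixed_set R n \<Gamma> = enc ` {w \<in> W n. \<forall>\<gamma> \<in> \<Gamma>. oact B n \<gamma> w = w}"
proof -
  have "oact R n \<gamma> (enc w) = enc w \<longleftrightarrow> oact B n \<gamma> w = w" if "w \<in> W n" "\<gamma> \<in> \<Gamma>" for w \<gamma>
    using W_act[of \<gamma> n w] that assms dec_enc oact_R_enc by (metis subsetD)
  then have "{w \<in> W n. \<forall>\<gamma> \<in> \<Gamma>. oact R n \<gamma> (enc w) = enc w} = {w \<in> W n. \<forall>\<gamma> \<in> \<Gamma>. oact B n \<gamma> w = w}"
    by blast
  moreover have "fixed_set R n \<Gamma> = enc ` {w \<in> W n. \<forall>\<gamma> \<in> \<Gamma>. oact R n \<gamma> (enc w) = enc w}"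
    unfolding fixed_set_def ops_R by blast
  ultimately show ?thesis
    by simp
qed

lemma N_infinity_operad_R:
  assumes free: "\<And>n \<sigma> w. \<sigma> \<in> carrier (Sym n) \<Longrightarrow> w \<in> W n \<Longrightarrow> sact G B n \<sigma> w = w \<Longrightarrow> \<sigma> = \<one>\<^bsub>Sym n\<^esub>"
    and fixed: "\<And>n. \<exists>w \<in> W n. \<forall>g \<in> carrier G. gact B n g w = w"
  shows "N_infinity_operad G R"
proof (rule N_infinity_operad_indiscreteI[OF G_operad_R])
  fix n \<sigma> x assume \<sigma>: "\<sigma> \<in> carrier (Sym n)" and x: "x \<in> ops R n" and eq: "sact G R n \<sigma> x = x"
  have "(\<one>\<^bsub>G\<^esub>, \<sigma>) \<in> carrier (G \<times>\<times> Sym n)"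
    using \<sigma> by (simp add: DirProd_def)
  then have "sact G B n \<sigma> (dec x) = dec x"
    using oact_R_enc[of "dec x" n] W_act[of _ n "dec x"] dec_R[OF x] eq dec_enc by metis
  then show "\<sigma> = \<one>\<^bsub>Sym n\<^esub>"
    using free[OF \<sigma>] dec_R[OF x] by blast
next
  fix n
  obtain w where "w \<in> W n" "\<forall>g \<in> carrier G. gact B n g w = w"
    using fixed by blast
  then show "\<exists>x \<in> ops R n. \<forall>g \<in> carrier G. gact R n g x = x"
    by (intro bexI[of _ "enc w"]) (simp_all add: oact_R_enc ops_R)
qed (simp add: ospace_R)

text \<open>The target is indiscrete, so functions on \<open>W\<close> that respect the operad
  structure become operad maps once their arguments are decoded.\<close>

lemma operad_maps_RI:
  assumes Q: "\<And>n. ospace Q n = indiscrete (ops Q n)"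
    and \<psi>: "\<And>n w. w \<in> W n \<Longrightarrow> \<psi> n w \<in> ops Q n"
    and \<psi>_act: "\<And>n a w. a \<in> carrier (G \<times>\<times> Sym n) \<Longrightarrow> w \<in> W n \<Longrightarrow> \<psi> n (oact B n a w) = oact Q n a (\<psi> n w)"
    and \<psi>_unit: "\<psi> 1 (ounit B) = ounit Q"
    and \<psi>_comp: "\<And>ns x y. x \<in> W (length ns) \<Longrightarrow> y \<in> (\<Pi>\<^sub>E i \<in> {..<length ns}. W (ns ! i)) \<Longrightarrow>
      \<psi> (sum_list ns) (ocomp B ns x y) = ocomp Q ns (\<psi> (length ns) x) (\<lambda>i \<in> {..<length ns}. \<psi> (ns ! i) (y i))"
  shows "(\<lambda>n. \<lambda>z \<in> ops R n. \<psi> n (dec z)) \<in> operad_maps G R Q"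
  unfolding operad_maps_def
proof (intro CollectI conjI allI ballI)
  fix n
  have "(\<lambda>z \<in> ops R n. \<psi> n (dec z)) \<in> topspace (ospace R n) \<rightarrow> ops Q n"
    using \<psi> dec_R by auto
  then show "continuous_map (ospace R n) (ospace Q n) (\<lambda>z \<in> ops R n. \<psi> n (dec z))"
    by (subst Q) simp
  fix a x assume a: "a \<in> carrier (G \<times>\<times> Sym n)" and x: "x \<in> ops R n"
  have w: "dec x \<in> W n" "enc (dec x) = x"
    using dec_R[OF x] by auto
  have "oact R n a x = enc (oact B n a (dec x))"
    using oact_R_enc[OF w(1)] w(2) by simp
  then show "(\<lambda>z \<in> ops R n. \<psi> n (dec z)) (oact R n a x) = oact Q n a ((\<lambda>z \<in> ops R n. \<psi> n (dec z)) x)"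
    using W_act[OF a w(1)] \<psi>_act[OF a w(1)] x by (simp add: ops_R)
next
  show "(\<lambda>z \<in> ops R 1. \<psi> 1 (dec z)) (ounit R) = ounit Q"
    using W_unit \<psi>_unit by (simp add: ounit_R ops_R)
next
  fix ns x y assume x: "x \<in> ops R (length ns)" and y: "y \<in> inputs R ns"
  let ?y = "\<lambda>i \<in> {..<length ns}. dec (y i)"
  have Y: "?y \<in> (\<Pi>\<^sub>E i \<in> {..<length ns}. W (ns ! i))"
    using dec_R[OF inputsD[OF y]] by auto
  have X: "dec x \<in> W (length ns)"
    using dec_R[OF x] by blast
  have "(\<lambda>z \<in> ops R (sum_list ns). \<psi> (sum_list ns) (dec z)) (ocomp R ns x y) =
      \<psi> (sum_list ns) (ocomp B ns (dec x) ?y)"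
    using W_comp[OF X Y] by (simp add: ocomp_R ops_R)
  also have "\<dots> = ocomp Q ns (\<psi> (length ns) (dec x)) (\<lambda>i \<in> {..<length ns}. \<psi> (ns ! i) (?y i))"
    by (rule \<psi>_comp[OF X Y])
  also have "(\<lambda>i \<in> {..<length ns}. \<psi> (ns ! i) (?y i)) =
      (\<lambda>i \<in> {..<length ns}. (\<lambda>z \<in> ops R (ns ! i). \<psi> (ns ! i) (dec z)) (y i))"
    using inputsD[OF y] by (intro restrict_ext) simp
  finally show "(\<lambda>z \<in> ops R (sum_list ns). \<psi> (sum_list ns) (dec z)) (ocomp R ns x y) =
      ocomp Q ns ((\<lambda>z \<in> ops R (length ns). \<psi> (length ns) (dec z)) x)
        (\<lambda>i \<in> {..<length ns}. (\<lambda>z \<in> ops R (ns ! i). \<psi> (ns ! i) (dec z)) (y i))"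
    by (simp only: restrict_apply'[OF x])
qed auto

end

section \<open>Indiscrete and product operads\<close>

definition indiscrete_operad :: "('g, 'a) operad_data \<Rightarrow> ('g, 'a) operad_data" where
  "indiscrete_operad P = encode_operad id (ops P) P"

definition pair_operad :: "('g, 'a) operad_data \<Rightarrow> ('g, 'a) operad_data \<Rightarrow> ('g, 'a \<times> 'a) operad_data" where
  "pair_operad P Q =
     \<lparr>ospace = \<lambda>n. indiscrete (ops P n \<times> ops Q n),
      oact = \<lambda>n a. \<lambda>z \<in> ops P n \<times> ops Q n. (oact P n a (fst z), oact Q n a (snd z)),
      ounit = (ounit P, ounit Q),
      ocomp = \<lambda>ns x y. (ocomp P ns (fst x) (\<lambda>i \<in> {..<length ns}. fst (y i)),
                         ocomp Q ns (snd x) (\<lambda>i \<in> {..<length ns}. snd (y i)))\<rparr>"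

lemma ops_pair: "ops (pair_operad P Q) n = ops P n \<times> ops Q n"
  by (simp add: pair_operad_def)

text \<open>The two projections, indexed by \<open>bool\<close>, are jointly injective.\<close>

lemma G_operad_pair:
  assumes P: "G_operad G P" and Q: "G_operad G Q"
  shows "G_operad G (pair_operad P Q)"
proof -
  interpret P: G_operad G P
    by (rule P)
  interpret Q: G_operad G Q
    by (rule Q)
  let ?Q = "\<lambda>b. if b then P else Q" and ?\<phi> = "\<lambda>b (_ :: nat) z. if b then fst z else snd z"
  show ?thesis
  proof (rule G_operad_pulled_back[where Q = ?Q and \<phi> = ?\<phi>])
    fix ns x y assume x: "x \<in> ops (pair_operad P Q) (length ns)" and y: "y \<in> inputs (pair_operad P Q) ns"
    have y': "y i \<in> ops P (ns ! i) \<times> ops Q (ns ! i)" if "i < length ns" for i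
      using inputsD[OF y that] by (simp add: ops_pair)
    have "(\<lambda>i \<in> {..<length ns}. fst (y i)) \<in> inputs P ns"
      by (rule inputsI) (use y' in \<open>simp add: mem_Times_iff\<close>)
    moreover have "(\<lambda>i \<in> {..<length ns}. snd (y i)) \<in> inputs Q ns"
      by (rule inputsI) (use y' in \<open>simp add: mem_Times_iff\<close>)
    ultimately show "ocomp (pair_operad P Q) ns x y \<in> ops (pair_operad P Q) (sum_list ns)"
      using P.ocomp_closed[of "fst x" ns] Q.ocomp_closed[of "snd x" ns] x
      unfolding ops_pair by (simp add: pair_operad_def mem_Times_iff)
    show "?\<phi> b (sum_list ns) (ocomp (pair_operad P Q) ns x y) =
        ocomp (?Q b) ns (?\<phi> b (length ns) x) (\<lambda>j \<in> {..<length ns}. ?\<phi> b (ns ! j) (y j))" for b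
      by (simp add: pair_operad_def)
  next
    fix n a x assume ax: "a \<in> carrier (G \<times>\<times> Sym n)" "x \<in> ops (pair_operad P Q) n"
    then show "oact (pair_operad P Q) n a x \<in> ops (pair_operad P Q) n"
      using P.oact_mem_ops Q.oact_mem_ops unfolding ops_pair by (auto simp: pair_operad_def)
    show "?\<phi> b n (oact (pair_operad P Q) n a x) = oact (?Q b) n a (?\<phi> b n x)" for b
      using ax unfolding ops_pair by (auto simp: pair_operad_def)
  next
    fix n x y assume "\<And>b. ?\<phi> b n x = ?\<phi> b n y"
    from this[of True] this[of False] show "x = y"
      by (simp add: prod_eq_iff)
  qed (use P Q P.is_group P.unit_closed Q.unit_closed in \<open>auto simp: pair_operad_def\<close>)
qed

lemma suboperad_indiscrete:
  assumes "G_operad G P"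
  shows "suboperad G P (ops P) id"
proof -
  interpret G_operad G P
    by (rule assms)
  show ?thesis
    by unfold_locales (use oact_mem_ops unit_closed ocomp_closed in auto)
qed

lemma suboperad_pair:
  assumes "G_operad G P" "G_operad G Q" "inj enc"
  shows "suboperad G (pair_operad P Q) (ops (pair_operad P Q)) enc"
proof -
  interpret G_operad G "pair_operad P Q"
    by (rule G_operad_pair[OF assms(1,2)])
  show ?thesis
    by unfold_locales (use oact_mem_ops unit_closed ocomp_closed assms(3) in \<open>auto intro: inj_on_subset\<close>)
qed

text \<open>The identity is continuous towards the indiscrete topology and leaves the sets of fixed
  operations as they are.\<close>

lemma indiscrete_operad_iso:
  assumes P: "N_infinity_operad G P"
  shows "(P, indiscrete_operad P) \<in> homotopy_iso G" "N_infinity_operad G (indiscrete_operad P)"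
proof -
  interpret P: N_infinity_operad G P
    by (rule P)
  interpret S: suboperad G P "ops P" id
    by (rule suboperad_indiscrete[OF P.G_operad_axioms])
  note R = indiscrete_operad_def[of P, symmetric]
  show N: "N_infinity_operad G (indiscrete_operad P)"
    unfolding indiscrete_operad_def by (rule S.N_infinity_operad_R[OF P.free ex_G_fixed[OF P]])
  let ?\<phi> = "\<lambda>n. \<lambda>x \<in> ops P n. x"
  have dec: "S.dec x = x" if "x \<in> ops P n" for x n
    using S.dec_enc[OF that] by simp
  have "?\<phi> \<in> operad_maps G P (indiscrete_operad P)"
    unfolding operad_maps_def
  proof (intro CollectI conjI allI ballI)
    fix n
    show "continuous_map (ospace P n) (ospace (indiscrete_operad P) n) (?\<phi> n)"
      using S.ospace_R by (simp add: R)
    fix a x assume "a \<in> carrier (G \<times>\<times> Sym n)" "x \<in> ops P n"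
    then show "?\<phi> n (oact P n a x) = oact (indiscrete_operad P) n a (?\<phi> n x)"
      using S.oact_R_enc[of x n a] P.oact_mem_ops by (simp add: R)
  next
    show "?\<phi> 1 (ounit P) = ounit (indiscrete_operad P)"
      using S.ounit_R P.unit_closed by (simp add: R)
  next
    fix ns x y assume x: "x \<in> ops P (length ns)" and y: "y \<in> inputs P ns"
    have "(\<lambda>i \<in> {..<length ns}. S.dec ((\<lambda>i \<in> {..<length ns}. ?\<phi> (ns ! i) (y i)) i)) = y"
      using inputsD[OF y] dec y by (intro extensionalityI[of _ "{..<length ns}"]) (auto simp: PiE_iff)
    then show "?\<phi> (sum_list ns) (ocomp P ns x y) =
        ocomp (indiscrete_operad P) ns (?\<phi> (length ns) x) (\<lambda>i \<in> {..<length ns}. ?\<phi> (ns ! i) (y i))"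
      using S.ocomp_R[of ns x "\<lambda>i \<in> {..<length ns}. ?\<phi> (ns ! i) (y i)"] P.ocomp_closed[OF x y] x dec[OF x]
      by (simp add: R)
  qed auto
  moreover have "fixed_set (indiscrete_operad P) n \<Gamma> = fixed_set P n \<Gamma>" if "subgroup \<Gamma> (G \<times>\<times> Sym n)" for n \<Gamma>
    using S.fixed_set_R[OF subgroup.subset[OF that]] by (simp add: R fixed_set_def)
  ultimately have "?\<phi> \<in> operad_weqs G P (indiscrete_operad P)"
    by (intro operad_weqsI[OF P N]) auto
  then show "(P, indiscrete_operad P) \<in> homotopy_iso G"
    by (rule operad_weqs_homotopy_iso[OF P N])
qed

text \<open>A pair is fixed exactly if both components are. With equal norms the product therefore
  has fixed points for the same subgroups as either factor, and both projections become weak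
  equivalences onto the factors with indiscrete topology.\<close>

lemma homotopy_iso_of_norms:
  fixes P Q :: "('g, 'a) operad_data"
  assumes P: "N_infinity_operad G P" and Q: "N_infinity_operad G Q"
    and norms: "operad_norms G P = operad_norms G Q" and enc: "inj (enc :: 'a \<times> 'a \<Rightarrow> 'a)"
  shows "(P, Q) \<in> homotopy_iso G"
proof -
  interpret P: N_infinity_operad G P
    by (rule P)
  interpret Q: N_infinity_operad G Q
    by (rule Q)
  let ?B = "pair_operad P Q"
  interpret S: suboperad G ?B "ops ?B" enc
    by (rule suboperad_pair[OF P.G_operad_axioms Q.G_operad_axioms enc])
  have oact: "oact ?B n a (x, y) = (oact P n a x, oact Q n a y)" if "(x, y) \<in> ops ?B n" for n a x y
    using that unfolding ops_pair by (simp add: pair_operad_def)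
  have N: "N_infinity_operad G S.R"
  proof (rule S.N_infinity_operad_R)
    fix n \<sigma> w assume \<sigma>: "\<sigma> \<in> carrier (Sym n)" and w: "w \<in> ops ?B n" and eq: "sact G ?B n \<sigma> w = w"
    obtain x y where xy: "w = (x, y)"
      by (cases w)
    then have "x \<in> ops P n" "sact G P n \<sigma> x = x"
      using w eq oact[of x y n] by (auto simp: ops_pair)
    then show "\<sigma> = \<one>\<^bsub>Sym n\<^esub>"
      using P.free[OF \<sigma>] by blast
  next
    fix n
    obtain x where x: "x \<in> ops P n" "\<forall>g \<in> carrier G. gact P n g x = x"
      using ex_G_fixed[OF P] by blast
    obtain y where y: "y \<in> ops Q n" "\<forall>g \<in> carrier G. gact Q n g y = y"
      using ex_G_fixed[OF Q] by blast
    have "(x, y) \<in> ops ?B n"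
      using x y by (simp add: ops_pair)
    then show "\<exists>w \<in> ops ?B n. \<forall>g \<in> carrier G. gact ?B n g w = w"
      using x y oact by (intro bexI[of _ "(x, y)"]) simp_all
  qed
  have fixed_pair: "fixed_set S.R n \<Gamma> \<noteq> {}"
    if \<Gamma>: "subgroup \<Gamma> (G \<times>\<times> Sym n)" and ne: "fixed_set P n \<Gamma> \<noteq> {}" "fixed_set Q n \<Gamma> \<noteq> {}" for n \<Gamma>
  proof -
    obtain x y where "x \<in> fixed_set P n \<Gamma>" "y \<in> fixed_set Q n \<Gamma>"
      using ne by blast
    then have "(x, y) \<in> {w \<in> ops ?B n. \<forall>\<gamma> \<in> \<Gamma>. oact ?B n \<gamma> w = w}"
      using oact[of x y n] by (auto simp: fixed_set_def ops_pair)
    then show ?thesis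
      unfolding S.fixed_set_R[OF subgroup.subset[OF \<Gamma>]] by blast
  qed
  \<comment> \<open>Stated for an abstract projection \<open>\<psi>\<close> to a factor
    \<open>T\<close>, to be applied to \<open>fst\<close> and to \<open>snd\<close>.\<close>
  have proj: "(S.R, indiscrete_operad T) \<in> homotopy_iso G"
    if T: "N_infinity_operad G T" and norms: "operad_norms G T = operad_norms G P"
      and \<psi>: "\<And>n w. w \<in> ops ?B n \<Longrightarrow> \<psi> w \<in> ops T n"
        "\<And>n a w. a \<in> carrier (G \<times>\<times> Sym n) \<Longrightarrow> w \<in> ops ?B n \<Longrightarrow> \<psi> (oact ?B n a w) = oact T n a (\<psi> w)"
        "\<psi> (ounit ?B) = ounit T"
        "\<And>ns x y. \<psi> (ocomp ?B ns x y) = ocomp T ns (\<psi> x) (\<lambda>i \<in> {..<length ns}. \<psi> (y i))"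
    for T :: "('g, 'a) operad_data" and \<psi>
  proof -
    interpret T: N_infinity_operad G T
      by (rule T)
    interpret I: suboperad G T "ops T" id
      by (rule suboperad_indiscrete[OF T.G_operad_axioms])
    note R = indiscrete_operad_def[of T, symmetric]
    note NI = indiscrete_operad_iso(2)[OF T]
    have dec: "I.dec x = x" if "x \<in> ops T n" for x n
      using I.dec_enc[OF that] by simp
    have "(\<lambda>n. \<lambda>z \<in> ops S.R n. \<psi> (S.dec z)) \<in> operad_maps G S.R (indiscrete_operad T)"
    proof (rule S.operad_maps_RI)
      show "ospace (indiscrete_operad T) n = indiscrete (ops (indiscrete_operad T) n)" for n
        using I.ospace_R by (simp add: R)
      show "\<psi> w \<in> ops (indiscrete_operad T) n" if "w \<in> ops ?B n" for n w
        using \<psi>(1)[OF that] I.ops_R by (simp add: R)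
      show "\<psi> (oact ?B n a w) = oact (indiscrete_operad T) n a (\<psi> w)"
        if "a \<in> carrier (G \<times>\<times> Sym n)" "w \<in> ops ?B n" for n a w
        using \<psi>(2)[OF that] I.oact_R_enc[OF \<psi>(1)[OF that(2)]] by (simp add: R)
      show "\<psi> (ounit ?B) = ounit (indiscrete_operad T)"
        using \<psi>(3) I.ounit_R by (simp add: R)
      fix ns x y assume x: "x \<in> ops ?B (length ns)" and y: "y \<in> (\<Pi>\<^sub>E i \<in> {..<length ns}. ops ?B (ns ! i))"
      have "(\<lambda>i \<in> {..<length ns}. I.dec ((\<lambda>i \<in> {..<length ns}. \<psi> (y i)) i)) = (\<lambda>i \<in> {..<length ns}. \<psi> (y i))"
      proof (rule restrict_ext)
        fix i assume i: "i \<in> {..<length ns}"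
        then have "y i \<in> ops ?B (ns ! i)"
          using inputsD[OF y] by simp
        then show "I.dec ((\<lambda>i \<in> {..<length ns}. \<psi> (y i)) i) = \<psi> (y i)"
          using dec[OF \<psi>(1)] i by simp
      qed
      then show "\<psi> (ocomp ?B ns x y) = ocomp (indiscrete_operad T) ns (\<psi> x) (\<lambda>i \<in> {..<length ns}. \<psi> (y i))"
        using \<psi>(4) I.ocomp_R[of ns "\<psi> x"] dec[OF \<psi>(1)[OF x]] by (simp add: R)
    qed
    moreover have "fixed_set S.R n \<Gamma> \<noteq> {}"
      if \<Gamma>: "subgroup \<Gamma> (G \<times>\<times> Sym n)" and ne: "fixed_set (indiscrete_operad T) n \<Gamma> \<noteq> {}" for n \<Gamma>
    proof -
      have "fixed_set (indiscrete_operad T) n \<Gamma> = fixed_set T n \<Gamma>"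
        using I.fixed_set_R[OF subgroup.subset[OF \<Gamma>]] by (simp add: R fixed_set_def)
      then have "fixed_set T n \<Gamma> \<noteq> {}"
        using ne by simp
      \<comment> \<open>Since the norms agree, a subgroup that fixes an operation of
        \<open>T\<close> also fixes one of \<open>P\<close> and one of \<open>Q\<close>, hence a
        pair.\<close>
      then show ?thesis
        using fixed_pair[OF \<Gamma> fixed_set_of_norms[OF T P _ \<Gamma>] fixed_set_of_norms[OF T Q _ \<Gamma>]] norms
          \<open>operad_norms G P = operad_norms G Q\<close> by simp
    qed
    ultimately have "(\<lambda>n. \<lambda>z \<in> ops S.R n. \<psi> (S.dec z)) \<in> operad_weqs G S.R (indiscrete_operad T)"
      by (intro operad_weqsI[OF N NI])
    then show ?thesis
      by (rule operad_weqs_homotopy_iso[OF N NI])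
  qed
  have "(S.R, indiscrete_operad P) \<in> homotopy_iso G"
    by (rule proj[OF P, where \<psi> = fst]) (auto simp: pair_operad_def)
  moreover have "(S.R, indiscrete_operad Q) \<in> homotopy_iso G"
    by (rule proj[OF Q, where \<psi> = snd]) (use norms in \<open>auto simp: pair_operad_def\<close>)
  ultimately show ?thesis
    using indiscrete_operad_iso(1)[OF P] indiscrete_operad_iso(1)[OF Q]
    by (meson homotopy_iso_sym homotopy_iso_trans)
qed

section \<open>The operad of words\<close>

type_synonym 'g letter = "nat \<times> 'g set \<times> 'g set"

definition word_act :: "('g, 'm) monoid_scheme \<Rightarrow> 'g \<Rightarrow> 'g letter list \<Rightarrow> 'g letter list" where
  "word_act G g = map (\<lambda>(k, c, d). (k, g <#\<^bsub>G\<^esub> c, g <#\<^bsub>G\<^esub> d))"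

definition words :: "('g, 'm) monoid_scheme \<Rightarrow> 'g letter list set" where
  "words G = {u. \<forall>(k, c, d) \<in> set u. c \<subseteq> carrier G \<and> d \<subseteq> carrier G}"

text \<open>An \<open>n\<close>-ary operation is a family of \<open>n\<close> words, to be thought of as the \<open>n\<close> leaves of a tree.
  Composition grafts trees by concatenating words.\<close>

definition word_operad :: "('g, 'm) monoid_scheme \<Rightarrow> ('g, nat \<Rightarrow> 'g letter list) operad_data" where
  "word_operad G =
     \<lparr>ospace = \<lambda>n. indiscrete (\<Pi>\<^sub>E i \<in> {..<n}. words G),
      oact = \<lambda>n a. \<lambda>f \<in> (\<Pi>\<^sub>E i \<in> {..<n}. words G).
        \<lambda>j \<in> {..<n}. word_act G (fst a) (f ((inv\<^bsub>Sym n\<^esub> (snd a)) j)),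
      ounit = \<lambda>j \<in> {..<1}. [],
      ocomp = \<lambda>ns x y. \<lambda>j \<in> {..<sum_list ns}.
        x (block_of ns j) @ y (block_of ns j) (j - block_start ns (block_of ns j))\<rparr>"

lemma ops_word: "ops (word_operad G) n = (\<Pi>\<^sub>E i \<in> {..<n}. words G)"
  by (simp add: word_operad_def)

lemma ocomp_word:
  "i < length ns \<Longrightarrow> r < ns ! i \<Longrightarrow> ocomp (word_operad G) ns x y (block_start ns i + r) = x i @ y i r"
  by (simp add: word_operad_def block_pos_less block_of_pos)

lemma ocomp_word_extensional: "ocomp (word_operad G) ns x y \<in> extensional {..<sum_list ns}"
  by (simp add: word_operad_def)

lemma word_act_append: "word_act G g (u @ v) = word_act G g u @ word_act G g v"
  and word_act_Nil [simp]: "word_act G g [] = []"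
  and word_act_Cons [simp]: "word_act G g ((k, c, d) # u) = (k, g <#\<^bsub>G\<^esub> c, g <#\<^bsub>G\<^esub> d) # word_act G g u"
  by (simp_all add: word_act_def)

lemma words_append: "u \<in> words G \<Longrightarrow> v \<in> words G \<Longrightarrow> u @ v \<in> words G"
  by (auto simp: words_def)

text \<open>The two sides of associativity cut the same positions in two ways, directly into the
  blocks of \<open>ms\<close> or first into groups of blocks. This translates between them.\<close>

lemma block_start_slices:
  fixes ms :: "nat list"
  assumes "length ms = sum_list ns" "i < length ns" "r < ns ! i"
  shows "block_start ms (block_start ns i + r) =
    block_start (map (\<lambda>i. sum_list (block_slice ns ms i)) [0..<length ns]) i + block_start (block_slice ns ms i) r"
  using assms sum_list_block_slices_upt[of i ns ms]
  by (simp add: block_start_def[of ms] block_start_def[of "map _ _"] block_start_def[of "block_slice ns ms i"]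
      take_map take_add) (simp add: block_slice_def)

section \<open>The operad axioms for words\<close>

context group
begin

lemma word_act_one: "u \<in> words G \<Longrightarrow> word_act G \<one> u = u"
  unfolding word_act_def words_def by (rule map_idI) (auto simp: lcos_mult_one)

lemma word_act_mult:
  "u \<in> words G \<Longrightarrow> g \<in> carrier G \<Longrightarrow> h \<in> carrier G \<Longrightarrow> word_act G (g \<otimes> h) u = word_act G g (word_act G h u)"
  unfolding word_act_def words_def map_map by (rule map_cong) (auto simp: lcos_m_assoc)

lemma word_act_closed: "u \<in> words G \<Longrightarrow> g \<in> carrier G \<Longrightarrow> word_act G g u \<in> words G"
  by (simp add: words_def word_act_def split_beta l_coset_subset_G)

abbreviation W :: "('a, nat \<Rightarrow> 'a letter list) operad_data" where "W \<equiv> word_operad G"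

lemmas ocomp_W = ocomp_word[of _ _ _ G]

text \<open>Reading the action at \<open>\<sigma> j\<close> avoids the inverse in its definition and
  fits the way in which \<open>block_perm\<close> and \<open>block_sum\<close> are
  evaluated.\<close>

lemma oact_word_apply:
  assumes "f \<in> ops W n" "\<sigma> \<in> carrier (Sym n)" "j < n"
  shows "oact W n (g, \<sigma>) f (\<sigma> j) = word_act G g (f j)"
  using assms Sym_apply_less[OF assms(2,3)] inv_Sym_apply(1)[OF assms(2,3)]
  by (simp add: word_operad_def)

lemma oact_word_extensional:
  assumes "f \<in> ops W n"
  shows "oact W n a f \<in> extensional {..<n}"
  using assms by (simp add: word_operad_def)

lemma oact_word_closed:
  assumes "f \<in> ops W n" "g \<in> carrier G" "\<sigma> \<in> carrier (Sym n)"
  shows "oact W n (g, \<sigma>) f \<in> ops W n"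
proof -
  have "word_act G g (f ((inv\<^bsub>Sym n\<^esub> \<sigma>) j)) \<in> words G" if "j < n" for j
    using word_act_closed[OF _ assms(2)] Sym_apply_less[OF group.inv_closed[OF group_Sym assms(3)] that] assms(1)
    by (auto simp: ops_word)
  then show ?thesis
    using assms(1) by (auto simp: word_operad_def)
qed

lemma eq_oact_wordI:
  assumes F: "F \<in> extensional {..<n}" and f: "f \<in> ops W n" and \<sigma>: "\<sigma> \<in> carrier (Sym n)"
    and eq: "\<And>j. j < n \<Longrightarrow> F (\<sigma> j) = word_act G g (f j)"
  shows "F = oact W n (g, \<sigma>) f"
proof (rule extensionalityI[OF F oact_word_extensional[OF f]])
  fix j assume "j \<in> {..<n}"
  then have j: "j < n"
    by simp
  let ?i = "(inv\<^bsub>Sym n\<^esub> \<sigma>) j"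
  have i: "?i < n" "\<sigma> ?i = j"
    using Sym_apply_less[OF group.inv_closed[OF group_Sym \<sigma>] j] inv_Sym_apply(2)[OF \<sigma> j] .
  show "F j = oact W n (g, \<sigma>) f j"
    using eq[OF i(1)] oact_word_apply[OF f \<sigma> i(1), of g] i(2) by simp
qed

lemma oact_word_eq_iff:
  assumes f: "f \<in> ops W n" and \<sigma>: "\<sigma> \<in> carrier (Sym n)"
  shows "oact W n (g, \<sigma>) f = f \<longleftrightarrow> (\<forall>j<n. f (\<sigma> j) = word_act G g (f j))"
proof
  show "\<forall>j<n. f (\<sigma> j) = word_act G g (f j)" if "oact W n (g, \<sigma>) f = f"
    using oact_word_apply[OF f \<sigma>, of _ g] that by simp
  show "oact W n (g, \<sigma>) f = f" if "\<forall>j<n. f (\<sigma> j) = word_act G g (f j)"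
    using eq_oact_wordI[of f n f \<sigma> g] f \<sigma> that by (simp add: ops_word PiE_iff)
qed

lemma ocomp_word_closed:
  assumes x: "x \<in> ops W (length ns)" and y: "y \<in> inputs W ns"
  shows "ocomp W ns x y \<in> ops W (sum_list ns)"
proof -
  have "ocomp W ns x y j \<in> words G" if "j < sum_list ns" for j
  proof -
    obtain i r where i: "i < length ns" "r < ns ! i" "j = block_start ns i + r"
      using block_cases[OF \<open>j < sum_list ns\<close>] .
    then show ?thesis
      using x inputsD[OF y i(1)] by (auto simp: ocomp_W ops_word intro!: words_append)
  qed
  then show ?thesis
    using ocomp_word_extensional[of G ns x y] by (auto simp: ops_word PiE_iff)
qed

lemma ocomp_word_eqI:
  assumes "F \<in> extensional {..<sum_list ns}"
    and "\<And>i r. i < length ns \<Longrightarrow> r < ns ! i \<Longrightarrow> F (block_start ns i + r) = x i @ y i r"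
  shows "F = ocomp W ns x y"
proof (rule extensionalityI[OF assms(1) ocomp_word_extensional])
  fix j assume "j \<in> {..<sum_list ns}"
  then have "j < sum_list ns"
    by simp
  then show "F j = ocomp W ns x y j"
    by (rule block_cases) (simp add: assms(2) ocomp_W)
qed

text \<open>All axioms are compared leaf by leaf. There they come down to concatenation being
  associative, having the empty word as unit, and commuting with the letterwise action.\<close>

lemma G_operad_word: "G_operad G W"
proof
  note one = word_act_one
  have osp: "ospace W n = indiscrete (ops W n)" for n
    by (simp add: word_operad_def)
  have oneS: "\<one>\<^bsub>Sym n\<^esub> \<in> carrier (Sym n)" for n
    using monoid.one_closed[OF group.is_monoid[OF group_Sym]] .
  have oneS_apply: "\<one>\<^bsub>Sym n\<^esub> j = j" if "j < n" for n j
    using that by (simp add: one_Sym)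
  have w: "f j \<in> words G" if "f \<in> ops W n" "j < n" for f n j
    using that by (auto simp: ops_word)
  have gact: "gact W n g f j = word_act G g (f j)" if "f \<in> ops W n" "j < n" for f n g j
    using oact_word_apply[OF that(1) oneS that(2), of g] oneS_apply[OF that(2)] by simp
  {
    fix n
    have "group_action (G \<times>\<times> Sym n) (ops W n) (oact W n)"
    proof (rule group_actionI[OF group_DirProd_Sym])
      show "oact W n a \<in> extensional (ops W n)" for a
        by (simp add: word_operad_def)
      fix a x assume a: "a \<in> carrier (G \<times>\<times> Sym n)" and x: "x \<in> ops W n"
      obtain g \<sigma> where g: "a = (g, \<sigma>)" "g \<in> carrier G" "\<sigma> \<in> carrier (Sym n)"
        using a by (auto simp: DirProd_def)
      show "oact W n a x \<in> ops W n"
        using oact_word_closed[OF x g(2,3)] g(1) by simp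
      fix b assume b: "b \<in> carrier (G \<times>\<times> Sym n)"
      obtain h \<tau> where h: "b = (h, \<tau>)" "h \<in> carrier G" "\<tau> \<in> carrier (Sym n)"
        using b by (auto simp: DirProd_def)
      have hx: "oact W n (h, \<tau>) x \<in> ops W n"
        using oact_word_closed[OF x h(2,3)] .
      have st: "\<sigma> \<otimes>\<^bsub>Sym n\<^esub> \<tau> \<in> carrier (Sym n)"
        using monoid.m_closed[OF group.is_monoid[OF group_Sym] g(3) h(3)] .
      have "oact W n (g, \<sigma>) (oact W n (h, \<tau>) x) = oact W n (g \<otimes> h, \<sigma> \<otimes>\<^bsub>Sym n\<^esub> \<tau>) x"
      proof (rule eq_oact_wordI[OF oact_word_extensional[OF hx] x st])
        fix j assume j: "j < n"
        show "oact W n (g, \<sigma>) (oact W n (h, \<tau>) x) ((\<sigma> \<otimes>\<^bsub>Sym n\<^esub> \<tau>) j) = word_act G (g \<otimes> h) (x j)"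
          using oact_word_apply[OF hx g(3) Sym_apply_less[OF h(3) j]] oact_word_apply[OF x h(3) j]
          by (simp add: mult_Sym_apply[OF g(3) h(3) j] word_act_mult[OF w[OF x j] g(2) h(2)])
      qed
      then show "oact W n (a \<otimes>\<^bsub>G \<times>\<times> Sym n\<^esub> b) x = oact W n a (oact W n b x)"
        using g h by (simp add: DirProd_def)
    next
      fix x assume x: "x \<in> ops W n"
      have "oact W n (\<one>, \<one>\<^bsub>Sym n\<^esub>) x = x"
        unfolding oact_word_eq_iff[OF x oneS] using oneS_apply one[OF w[OF x]] by simp
      then show "oact W n \<one>\<^bsub>G \<times>\<times> Sym n\<^esub> x = x"
        by simp
    qed
    moreover have "continuous_map (ospace W n) (ospace W n) (oact W n a)" if "a \<in> carrier (G \<times>\<times> Sym n)" for a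
      using that oact_word_closed by (subst (2) osp) (auto simp: DirProd_def)
    ultimately show "continuous_action (G \<times>\<times> Sym n) (ospace W n) (oact W n)"
      by (simp add: continuous_action_def)
  }
  show u: "ounit W \<in> ops W 1"
    by (auto simp: word_operad_def words_def)
  show "gact W 1 g (ounit W) = ounit W" for g
    unfolding oact_word_eq_iff[OF u oneS] using oneS_apply by (simp add: word_operad_def)
  show "continuous_map (prod_topology (ospace W (length ns))
            (product_topology (\<lambda>i. ospace W (ns ! i)) {..<length ns}))
         (ospace W (sum_list ns)) (\<lambda>(x, y). ocomp W ns x y)" for ns
    by (subst (3) osp) (use ocomp_word_closed in auto)
  show "gact W (sum_list ns) g (ocomp W ns x y) =
         ocomp W ns (gact W (length ns) g x) (\<lambda>i \<in> {..<length ns}. gact W (ns ! i) g (y i))"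
    if x: "x \<in> ops W (length ns)" and y: "y \<in> inputs W ns" for g ns x y
  proof (rule ocomp_word_eqI[OF oact_word_extensional[OF ocomp_word_closed[OF x y]]])
    fix i r assume i: "i < length ns" "r < ns ! i"
    show "gact W (sum_list ns) g (ocomp W ns x y) (block_start ns i + r) =
        gact W (length ns) g x i @ (\<lambda>i \<in> {..<length ns}. gact W (ns ! i) g (y i)) i r"
      using gact[OF ocomp_word_closed[OF x y] block_pos_less[OF i]] gact[OF x i(1)] gact[OF inputsD[OF y i(1)] i(2)] i
      by (simp add: ocomp_W word_act_append)
  qed
  show "ocomp W [n] (ounit W) (\<lambda>i \<in> {..<1}. x) = x" if x: "x \<in> ops W n" for n x
    by (rule ocomp_word_eqI[symmetric])
      (use x in \<open>auto simp: ops_word PiE_iff block_start_def word_operad_def\<close>)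
  show "ocomp W (replicate n 1) x (\<lambda>i \<in> {..<n}. ounit W) = x" if x: "x \<in> ops W n" for n x
  proof (rule ocomp_word_eqI[symmetric])
    show "x \<in> extensional {..<sum_list (replicate n 1)}"
      using x by (simp add: ops_word PiE_iff sum_list_replicate)
    show "x (block_start (replicate n 1) i + r) = x i @ (\<lambda>i \<in> {..<n}. ounit W) i r"
      if "i < length (replicate n (1::nat))" "r < replicate n 1 ! i" for i r
      using that by (simp add: block_start_def sum_list_replicate word_operad_def)
  qed
  show "ocomp W ms (ocomp W ns x y) z =
         ocomp W (map (\<lambda>i. sum_list (block_slice ns ms i)) [0..<length ns]) x
           (\<lambda>i \<in> {..<length ns}.
              ocomp W (block_slice ns ms i) (y i) (\<lambda>r \<in> {..<ns ! i}. z (block_start ns i + r)))"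
    (is "?L = ocomp W ?ks x ?y")
    if x: "x \<in> ops W (length ns)" and y: "y \<in> inputs W ns"
      and len: "length ms = sum_list ns" and z: "z \<in> inputs W ms" for ns ms x y z
  proof (rule ocomp_word_eqI)
    show "?L \<in> extensional {..<sum_list ?ks}"
      unfolding sum_list_block_slices[OF len] by (rule ocomp_word_extensional)
    fix i q assume "i < length ?ks" "q < ?ks ! i"
    then have i: "i < length ns" and q: "q < sum_list (block_slice ns ms i)"
      by simp_all
    obtain r s where r: "r < length (block_slice ns ms i)" "s < block_slice ns ms i ! r"
        "q = block_start (block_slice ns ms i) r + s"
      using block_cases[OF q] .
    have r': "r < ns ! i" "s < ms ! (block_start ns i + r)"
      using r length_block_slice[OF len i] nth_block_slice[OF len i] by auto
    have b: "block_start ns i + r < length ms"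
      using block_pos_less[OF i r'(1)] len by simp
    have "?L (block_start ?ks i + q) = ?L (block_start ms (block_start ns i + r) + s)"
      using block_start_slices[OF len i r'(1)] r(3) by (simp add: add.assoc)
    also have "\<dots> = (x i @ y i r) @ z (block_start ns i + r) s"
      using ocomp_W[OF b r'(2)] ocomp_W[OF i r'(1)] by simp
    finally show "?L (block_start ?ks i + q) = x i @ ?y i q"
      using ocomp_W[OF r(1,2)] i r(3) r'(1) by simp
  qed
  show "ocomp W ns (sact G W (length ns) \<sigma> x) y =
         sact G W (sum_list ns) (block_perm ns \<sigma>)
           (ocomp W (permute_list_by \<sigma> ns) x (\<lambda>i \<in> {..<length ns}. y (\<sigma> i)))"
    if \<sigma>: "\<sigma> \<in> carrier (Sym (length ns))" and x: "x \<in> ops W (length ns)" and y: "y \<in> inputs W ns" for ns \<sigma> x y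
  proof (rule eq_oact_wordI[OF ocomp_word_extensional _ block_perm_closed[OF \<sigma>]])
    let ?ms = "permute_list_by \<sigma> ns"
    have s: "sum_list ?ms = sum_list ns"
      by (rule sum_list_permute_list_by[OF \<sigma>])
    have y': "(\<lambda>i \<in> {..<length ns}. y (\<sigma> i)) \<in> inputs W ?ms"
      using inputsI[of ?ms "\<lambda>i. y (\<sigma> i)" W] inputsD[OF y Sym_apply_less[OF \<sigma>]] by simp
    have "x \<in> ops W (length ?ms)"
      using x by simp
    from ocomp_word_closed[OF this y'] show c: "ocomp W ?ms x (\<lambda>i \<in> {..<length ns}. y (\<sigma> i)) \<in> ops W (sum_list ns)"
      unfolding s .
    fix j assume j: "j < sum_list ns"
    obtain i r where i: "i < length ns" "r < ns ! \<sigma> i" "j = block_start ?ms i + r"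
      using block_cases[of j ?ms] j unfolding s by (metis length_permute_list_by nth_permute_list_by)
    have "ocomp W ns (sact G W (length ns) \<sigma> x) y (block_perm ns \<sigma> j) = sact G W (length ns) \<sigma> x (\<sigma> i) @ y (\<sigma> i) r"
      using block_perm_apply[OF \<sigma> i(1,2)] ocomp_W[OF Sym_apply_less[OF \<sigma> i(1)] i(2)] i(3) by simp
    also have "\<dots> = x i @ y (\<sigma> i) r"
      using oact_word_apply[OF x \<sigma> i(1)] one[OF w[OF x i(1)]] by simp
    also have "\<dots> = ocomp W ?ms x (\<lambda>i \<in> {..<length ns}. y (\<sigma> i)) j"
      using ocomp_W[of i ?ms r] i by simp
    finally show "ocomp W ns (sact G W (length ns) \<sigma> x) y (block_perm ns \<sigma> j) =
        word_act G \<one> (ocomp W ?ms x (\<lambda>i \<in> {..<length ns}. y (\<sigma> i)) j)"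
      using one[OF w[OF c j]] by simp
  qed
  show "ocomp W ns x (\<lambda>i \<in> {..<length ns}. sact G W (ns ! i) (\<tau> i) (y i)) =
         sact G W (sum_list ns) (block_sum ns \<tau>) (ocomp W ns x y)"
    if \<tau>: "\<And>i. i < length ns \<Longrightarrow> \<tau> i \<in> carrier (Sym (ns ! i))"
      and x: "x \<in> ops W (length ns)" and y: "y \<in> inputs W ns" for ns \<tau> x y
  proof (rule eq_oact_wordI[OF ocomp_word_extensional ocomp_word_closed[OF x y] block_sum_closed[OF \<tau>]])
    fix j assume j: "j < sum_list ns"
    obtain i r where i: "i < length ns" "r < ns ! i" "j = block_start ns i + r"
      using block_cases[OF j] .
    have "ocomp W ns x (\<lambda>i \<in> {..<length ns}. sact G W (ns ! i) (\<tau> i) (y i)) (block_sum ns \<tau> j) =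
        x i @ sact G W (ns ! i) (\<tau> i) (y i) (\<tau> i r)"
      using block_sum_apply[OF i(1,2)] ocomp_W[OF i(1) Sym_apply_less[OF \<tau>[OF i(1)] i(2)]] i by simp
    also have "\<dots> = x i @ y i r"
      using oact_word_apply[OF inputsD[OF y i(1)] \<tau>[OF i(1)] i(2)] one[OF w[OF inputsD[OF y i(1)] i(2)]] by simp
    also have "\<dots> = ocomp W ns x y j"
      using ocomp_W[OF i(1,2)] i by simp
    finally show "ocomp W ns x (\<lambda>i \<in> {..<length ns}. sact G W (ns ! i) (\<tau> i) (y i)) (block_sum ns \<tau> j) =
        word_act G \<one> (ocomp W ns x y j)"
      using one[OF w[OF ocomp_word_closed[OF x y] j]] by simp
  qed
qed

end

section \<open>Realizing a norm system\<close>

text \<open>A letter \<open>(k, c, d)\<close> stands for a point of an orbit \<open>H/K\<close> with label \<open>k\<close>, where \<open>H\<close> and \<open>K\<close>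
  are the stabilizers of \<open>c\<close> and \<open>d\<close>. The first different letters of diverging words share \<open>c\<close>, so
  an element that moves one of these words to the other lies in \<open>H\<close>.\<close>

definition diverge :: "'g letter list \<Rightarrow> 'g letter list \<Rightarrow> bool" where
  "diverge u v \<longleftrightarrow>
     (\<exists>p k c d u' k' d' v'. u = p @ (k, c, d) # u' \<and> v = p @ (k', c, d') # v' \<and> (k, d) \<noteq> (k', d'))"

text \<open>Defined for arbitrary subsets, so that letters need not consist of cosets of prescribed
  subgroups. A coset \<open>gK\<close> of a subgroup has the stabilizer \<open>gKg^-1\<close>, and
  the empty set is stabilized by all of \<open>G\<close>.\<close>

definition left_stabilizer :: "('g, 'm) monoid_scheme \<Rightarrow> 'g set \<Rightarrow> 'g set" where
  "left_stabilizer G c = {g \<in> carrier G. g <#\<^bsub>G\<^esub> c = c}"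

text \<open>Equal stabilizers represent an identity norm. They admit letters that do no more than
  carry a label.\<close>

definition norm_words :: "('g, 'm) monoid_scheme \<Rightarrow> ('g set \<times> 'g set) set \<Rightarrow> 'g letter list set" where
  "norm_words G X = {u \<in> words G. \<forall>(k, c, d) \<in> set u.
     left_stabilizer G d = left_stabilizer G c \<or> (left_stabilizer G d, left_stabilizer G c) \<in> X}"

text \<open>Leaves are required to diverge, not merely to differ. If one leaf were a prefix of
  another, grafting could make leaves coincide, and freeness would be lost.\<close>

definition norm_trees ::
  "('g, 'm) monoid_scheme \<Rightarrow> ('g set \<times> 'g set) set \<Rightarrow> nat \<Rightarrow> (nat \<Rightarrow> 'g letter list) set" where
  "norm_trees G X n = {f \<in> (\<Pi>\<^sub>E i \<in> {..<n}. norm_words G X).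
     \<forall>i<n. \<forall>j<n. i \<noteq> j \<longrightarrow> diverge (f i) (f j)}"

lemma diverge_neq: "diverge u v \<Longrightarrow> u \<noteq> v"
  by (auto simp: diverge_def)

lemma diverge_append: "diverge u v \<Longrightarrow> diverge (u @ w) (v @ w')"
  unfolding diverge_def by (metis append_Cons append_assoc)

lemma diverge_prefix: "diverge u v \<Longrightarrow> diverge (w @ u) (w @ v)"
  unfolding diverge_def by (metis append_assoc)

text \<open>Whether the words part at the first letter or later, their first letters have the same
  middle component \<open>c\<close>.\<close>

lemma diverge_Cons:
  assumes "diverge ((k, c, d) # u) ((k', c', d') # v)"
  shows "c = c' \<and> ((k, d) \<noteq> (k', d') \<or> diverge u v)"
proof -
  obtain p l e f u' l' f' v' where eq: "(k, c, d) # u = p @ (l, e, f) # u'" "(k', c', d') # v = p @ (l', e, f') # v'"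
    and ne: "(l, f) \<noteq> (l', f')"
    using assms unfolding diverge_def by blast
  show ?thesis
  proof (cases p)
    case Nil
    then show ?thesis
      using eq ne by auto
  next
    case (Cons a p')
    then have "u = p' @ (l, e, f) # u'" "v = p' @ (l', e, f') # v'" "(k, c, d) = (k', c', d')"
      using eq by auto
    then show ?thesis
      using ne unfolding diverge_def by blast
  qed
qed

lemma norm_words_Nil: "[] \<in> norm_words G X"
  and norm_words_append: "u \<in> norm_words G X \<Longrightarrow> v \<in> norm_words G X \<Longrightarrow> u @ v \<in> norm_words G X"
  by (auto simp: norm_words_def words_def)

lemma norm_systemD:
  assumes "norm_system G X" "(K, H) \<in> X"
  shows norm_system_conj: "g \<in> carrier G \<Longrightarrow> (conj_subset G g K, conj_subset G g H) \<in> X"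
    and norm_system_restrict: "subgroup M G \<Longrightarrow> M \<subset> H \<Longrightarrow> K \<inter> M \<noteq> M \<Longrightarrow> (K \<inter> M, M) \<in> X"
    and norm_system_trans: "(L, K) \<in> X \<Longrightarrow> (L, H) \<in> X"
    and norm_system_symbols: "subgroup K G \<and> subgroup H G \<and> K \<subset> H"
proof -
  note n = assms(1)[unfolded norm_system_def]
  have "(K, H) \<in> norm_symbols G"
    using conjunct1[OF n] assms(2) by (rule subsetD)
  then show "subgroup K G \<and> subgroup H G \<and> K \<subset> H"
    by (simp add: norm_symbols_def)
  show "(conj_subset G g K, conj_subset G g H) \<in> X" if "g \<in> carrier G"
    using n[THEN conjunct2, THEN conjunct1, rule_format, OF conjI[OF assms(2) that]] .
  show "(K \<inter> M, M) \<in> X" if "subgroup M G" "M \<subset> H" "K \<inter> M \<noteq> M"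
    using n[THEN conjunct2, THEN conjunct2, THEN conjunct1, rule_format,
        OF conjI[OF assms(2) conjI[OF that(1) conjI[OF that(2,3)]]]] .
  show "(L, H) \<in> X" if "(L, K) \<in> X"
    using n[THEN conjunct2, THEN conjunct2, THEN conjunct2, rule_format, OF conjI[OF that assms(2)]] .
qed

section \<open>Stabilizers, trees and their norms\<close>

context group
begin

lemma lcoset_inj:
  assumes "g \<in> carrier G" "c \<subseteq> carrier G" "d \<subseteq> carrier G" "g <# c = g <# d"
  shows "c = d"
proof -
  have "inv g <# (g <# c) = inv g <# (g <# d)"
    using assms(4) by simp
  then show ?thesis
    using assms(1-3) by (simp add: lcos_m_assoc lcos_mult_one)
qed

lemma left_stabilizer_lcoset:
  assumes g: "g \<in> carrier G" and c: "c \<subseteq> carrier G"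
  shows "left_stabilizer G (g <# c) = conj_subset G g (left_stabilizer G c)"
proof (intro subset_antisym subsetI)
  fix x assume "x \<in> left_stabilizer G (g <# c)"
  then have x: "x \<in> carrier G" "x <# (g <# c) = g <# c"
    by (auto simp: left_stabilizer_def)
  have "inv g <# (x <# (g <# c)) = c"
    unfolding x(2) using g c by (simp add: lcos_m_assoc lcos_mult_one)
  then have "(inv g \<otimes> x \<otimes> g) <# c = c"
    using g c x(1) by (simp add: lcos_m_assoc m_assoc l_coset_subset_G)
  then have s: "inv g \<otimes> x \<otimes> g \<in> left_stabilizer G c"
    using g x(1) by (simp add: left_stabilizer_def)
  have "g \<otimes> (inv g \<otimes> x \<otimes> g) \<otimes> inv g = (g \<otimes> inv g) \<otimes> x \<otimes> (g \<otimes> inv g)"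
    using g x(1) by (simp only: m_assoc m_closed inv_closed)
  then have "x = g \<otimes> (inv g \<otimes> x \<otimes> g) \<otimes> inv g"
    using g x(1) by simp
  then show "x \<in> conj_subset G g (left_stabilizer G c)"
    unfolding conj_subset_image using s by blast
next
  fix x assume "x \<in> conj_subset G g (left_stabilizer G c)"
  then obtain h where h: "h \<in> carrier G" "h <# c = c" "x = g \<otimes> h \<otimes> inv g"
    by (auto simp: conj_subset_image left_stabilizer_def)
  have xg: "x \<in> carrier G" "x \<otimes> g = g \<otimes> h"
    using g h by (simp_all add: m_assoc)
  have "x <# (g <# c) = g <# (h <# c)"
    by (simp only: lcos_m_assoc[OF c xg(1) g] lcos_m_assoc[OF c g h(1)] xg(2))
  then have "x <# (g <# c) = g <# c"
    by (simp only: h(2))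
  then show "x \<in> left_stabilizer G (g <# c)"
    using g h by (simp add: left_stabilizer_def)
qed

lemma left_stabilizer_subgroup:
  assumes H: "subgroup H G"
  shows "left_stabilizer G H = H"
  using lcoset_self_iff[OF H] subgroup.subset[OF H] by (auto simp: left_stabilizer_def)

lemma conj_subset_self:
  assumes H: "subgroup H G" and g: "g \<in> H"
  shows "conj_subset G g H = H"
proof -
  have gG: "g \<in> carrier G"
    using subgroup.mem_carrier[OF H g] .
  have "g <# H = H"
    using lcoset_self_iff[OF H gG] g by blast
  then show ?thesis
    using left_stabilizer_lcoset[OF gG subgroup.subset[OF H]] left_stabilizer_subgroup[OF H] by simp
qed

text \<open>Translation conjugates both stabilizers of a letter, so this is the conjugation
  rule.\<close>

lemma word_act_norm_words:
  assumes X: "norm_system G X" and u: "u \<in> norm_words G X" and g: "g \<in> carrier G"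
  shows "word_act G g u \<in> norm_words G X"
proof -
  have uw: "u \<in> words G"
    using u by (simp add: norm_words_def)
  have "left_stabilizer G (g <# d) = left_stabilizer G (g <# c) \<or>
      (left_stabilizer G (g <# d), left_stabilizer G (g <# c)) \<in> X" if "(k, c, d) \<in> set u" for k c d
  proof -
    have "c \<subseteq> carrier G" "d \<subseteq> carrier G"
      using uw that by (auto simp: words_def)
    moreover have "left_stabilizer G d = left_stabilizer G c \<or> (left_stabilizer G d, left_stabilizer G c) \<in> X"
      using u that by (auto simp: norm_words_def)
    ultimately show ?thesis
      using norm_system_conj[OF X _ g] left_stabilizer_lcoset[OF g] by auto
  qed
  then have "\<forall>(k, c, d) \<in> set (word_act G g u). left_stabilizer G d = left_stabilizer G c \<or>
      (left_stabilizer G d, left_stabilizer G c) \<in> X"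
    unfolding word_act_def by fastforce
  then show ?thesis
    using word_act_closed[OF uw g] unfolding norm_words_def by blast
qed

lemma diverge_word_act:
  assumes g: "g \<in> carrier G" and u: "u \<in> words G" and v: "v \<in> words G" and uv: "diverge u v"
  shows "diverge (word_act G g u) (word_act G g v)"
proof -
  obtain p k c d u' k' d' v' where eq: "u = p @ (k, c, d) # u'" "v = p @ (k', c, d') # v'"
    and ne: "(k, d) \<noteq> (k', d')"
    using uv unfolding diverge_def by blast
  have "d \<subseteq> carrier G" "d' \<subseteq> carrier G"
    using u v eq by (auto simp: words_def)
  then have ne': "(k, g <# d) \<noteq> (k', g <# d')"
    using ne lcoset_inj[OF g] by auto
  show ?thesis
    unfolding diverge_def eq word_act_append word_act_Cons
    by (intro exI conjI) (rule HOL.refl, rule HOL.refl, rule ne')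
qed

lemma norm_trees_subset: "norm_trees G X n \<subseteq> ops W n"
  by (auto simp: norm_trees_def ops_word norm_words_def)

lemma oact_norm_trees:
  assumes X: "norm_system G X" and a: "a \<in> carrier (G \<times>\<times> Sym n)" and f: "f \<in> norm_trees G X n"
  shows "oact W n a f \<in> norm_trees G X n"
proof -
  obtain g \<sigma> where g: "a = (g, \<sigma>)" "g \<in> carrier G" "\<sigma> \<in> carrier (Sym n)"
    using a by (auto simp: DirProd_def)
  have fW: "f \<in> ops W n"
    using f norm_trees_subset by blast
  have ap: "oact W n a f j = word_act G g (f ((inv\<^bsub>Sym n\<^esub> \<sigma>) j))" if "j < n" for j
    using oact_word_apply[OF fW g(3) Sym_apply_less[OF group.inv_closed[OF group_Sym g(3)] that], of g]
      inv_Sym_apply(2)[OF g(3) that] g(1) by simp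
  have inv: "(inv\<^bsub>Sym n\<^esub> \<sigma>) j < n" if "j < n" for j
    using Sym_apply_less[OF group.inv_closed[OF group_Sym g(3)] that] .
  have inv_inj: "(inv\<^bsub>Sym n\<^esub> \<sigma>) i \<noteq> (inv\<^bsub>Sym n\<^esub> \<sigma>) j" if "i < n" "j < n" "i \<noteq> j" for i j
    using inv_Sym_apply(2)[OF g(3)] that by metis
  have fn: "f j \<in> norm_words G X" "f j \<in> words G" if "j < n" for j
  proof -
    show "f j \<in> norm_words G X"
      using f that by (auto simp: norm_trees_def)
    then show "f j \<in> words G"
      by (simp add: norm_words_def)
  qed
  have fd: "diverge (f i) (f j)" if "i < n" "j < n" "i \<noteq> j" for i j
    using f that by (simp add: norm_trees_def)
  show ?thesis
    unfolding norm_trees_def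
  proof (intro CollectI conjI allI impI)
    show "oact W n a f \<in> (\<Pi>\<^sub>E i \<in> {..<n}. norm_words G X)"
      using oact_word_extensional[OF fW] ap word_act_norm_words[OF X fn(1)[OF inv] g(2)] by (simp add: PiE_iff)
    show "diverge (oact W n a f i) (oact W n a f j)" if "i < n" "j < n" "i \<noteq> j" for i j
      unfolding ap[OF that(1)] ap[OF that(2)]
      by (rule diverge_word_act[OF g(2) fn(2)[OF inv[OF that(1)]] fn(2)[OF inv[OF that(2)]]
            fd[OF inv[OF that(1)] inv[OF that(2)] inv_inj[OF that]]])
  qed
qed

text \<open>Leaves grafted onto the same leaf of \<open>x\<close> diverge after that common prefix,
  the others already inside \<open>x\<close>.\<close>

lemma ocomp_norm_trees:
  assumes x: "x \<in> norm_trees G X (length ns)" and y: "y \<in> (\<Pi>\<^sub>E i \<in> {..<length ns}. norm_trees G X (ns ! i))"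
  shows "ocomp W ns x y \<in> norm_trees G X (sum_list ns)"
  unfolding norm_trees_def
proof (intro CollectI conjI allI impI)
  have xn: "x i \<in> norm_words G X" and yn: "r < ns ! i \<Longrightarrow> y i r \<in> norm_words G X" if "i < length ns" for i r
    using x y that by (auto simp: norm_trees_def PiE_iff)
  have "ocomp W ns x y j \<in> norm_words G X" if j: "j < sum_list ns" for j
    using j
  proof (rule block_cases)
    fix i r assume "i < length ns" "r < ns ! i" "j = block_start ns i + r"
    then show "ocomp W ns x y j \<in> norm_words G X"
      using xn yn by (simp add: ocomp_W norm_words_append)
  qed
  then show "ocomp W ns x y \<in> (\<Pi>\<^sub>E j \<in> {..<sum_list ns}. norm_words G X)"
    using ocomp_word_extensional[of G ns x y] by (simp add: PiE_iff)
  fix j j' assume j: "j < sum_list ns" "j' < sum_list ns" "j \<noteq> j'"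
  obtain i r where i: "i < length ns" "r < ns ! i" "j = block_start ns i + r"
    using block_cases[OF j(1)] .
  obtain i' r' where i': "i' < length ns" "r' < ns ! i'" "j' = block_start ns i' + r'"
    using block_cases[OF j(2)] .
  show "diverge (ocomp W ns x y j) (ocomp W ns x y j')"
  proof (cases "i = i'")
    case True
    then have "diverge (y i r) (y i r')"
      using y i i' j(3) by (auto simp: norm_trees_def PiE_iff)
    then show ?thesis
      using i i' True by (simp add: ocomp_W diverge_prefix)
  next
    case False
    then have "diverge (x i) (x i')"
      using x i i' by (simp add: norm_trees_def)
    then show ?thesis
      using i i' by (simp add: ocomp_W diverge_append)
  qed
qed

lemma suboperad_norm_trees:
  assumes X: "norm_system G X" and enc: "inj_on enc (\<Union>n. norm_trees G X n)"
  shows "suboperad G W (norm_trees G X) enc"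
proof -
  interpret W: G_operad G W
    by (rule G_operad_word)
  have "ounit W \<in> norm_trees G X 1"
    by (auto simp: norm_trees_def word_operad_def norm_words_Nil)
  then show ?thesis
    by unfold_locales (use norm_trees_subset oact_norm_trees[OF X] ocomp_norm_trees enc in blast)+
qed

text \<open>Each letter shrinks the stabilizer of the prefix by a restriction of its norm.\<close>

lemma word_stabilizer:
  assumes X: "norm_system G X" and H: "subgroup H G" and u: "u \<in> norm_words G X"
    and div: "\<And>h. h \<in> H \<Longrightarrow> word_act G h u = u \<or> diverge u (word_act G h u)"
  shows "{h \<in> H. word_act G h u = u} = H \<or> ({h \<in> H. word_act G h u = u}, H) \<in> X"
  using H u div
proof (induction u arbitrary: H)
  case (Cons l u)
  obtain k c d where l: "l = (k, c, d)"
    by (cases l)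
  note H = Cons.prems(1)
  have HG: "H \<subseteq> carrier G"
    by (rule subgroup.subset[OF H])
  have u: "u \<in> norm_words G X" and cd: "c \<subseteq> carrier G" "d \<subseteq> carrier G"
    and X_cd: "left_stabilizer G d = left_stabilizer G c \<or> (left_stabilizer G d, left_stabilizer G c) \<in> X"
    using Cons.prems(2) by (auto simp: l norm_words_def words_def)
  \<comment> \<open>If \<open>h\<close> fixes the word, it fixes its first letter. If the word
    diverges from its translate, the first letters still share \<open>c\<close>.\<close>
  have fix_c: "h <# c = c" if "h \<in> H" for h
    using Cons.prems(3)[OF that] diverge_Cons[of k c d u k "h <# c" "h <# d"] by (auto simp: l)
  define M where "M = left_stabilizer G d \<inter> H"
  have M_eq: "M = {h \<in> H. h <# d = d}"
    using HG by (auto simp: M_def left_stabilizer_def)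
  have H_sub: "H \<subseteq> left_stabilizer G c"
    using fix_c HG by (auto simp: left_stabilizer_def)
  \<comment> \<open>\<open>M\<close> is the stabilizer of the first letter in \<open>H\<close>. The
    norm of the letter is restricted from the stabilizer of \<open>c\<close> to its subgroup
    \<open>H\<close>. The restriction rule covers proper subgroups and results other than identity
    norms only, hence the cases.\<close>
  have MH: "M = H \<or> (M, H) \<in> X"
  proof (cases "M = H \<or> left_stabilizer G d = left_stabilizer G c")
    case True
    then show ?thesis
      using H_sub by (auto simp: M_def)
  next
    case False
    then have dc: "(left_stabilizer G d, left_stabilizer G c) \<in> X"
      using X_cd by blast
    show ?thesis
    proof (cases "H = left_stabilizer G c")
      case True
      then have "M = left_stabilizer G d"
        using norm_system_symbols[OF X dc] by (auto simp: M_def)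
      then show ?thesis
        using dc True by simp
    next
      case False
      then have "H \<subset> left_stabilizer G c"
        using H_sub by blast
      then show ?thesis
        using norm_system_restrict[OF X dc H] \<open>\<not> (M = H \<or> _)\<close> unfolding M_def by blast
    qed
  qed
  have M: "subgroup M G"
    using MH H norm_system_symbols[OF X] by blast
  have eq: "{h \<in> H. word_act G h (l # u) = l # u} = {h \<in> M. word_act G h u = u}"
    unfolding M_eq l word_act_Cons using fix_c by auto
  \<comment> \<open>Elements of \<open>M\<close> fix the first letter, so the divergence of the word
    from its translate has to occur in the rest.\<close>
  have "{h \<in> M. word_act G h u = u} = M \<or> ({h \<in> M. word_act G h u = u}, M) \<in> X"
  proof (rule Cons.IH[OF M u])
    fix h assume "h \<in> M"
    then have h: "h \<in> H" "h <# d = d"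
      by (auto simp: M_eq)
    show "word_act G h u = u \<or> diverge u (word_act G h u)"
      using Cons.prems(3)[OF h(1)] diverge_Cons[of k c d u k "h <# c" "h <# d"] h(2) fix_c[OF h(1)] by (auto simp: l)
  qed
  then show ?case
    unfolding eq using MH norm_system_trans[OF X] by auto
qed simp

text \<open>If \<open>H/K\<close> is admissible, the leaf at the position of the coset
  \<open>K\<close> has stabilizer \<open>K\<close> in \<open>H\<close>, and
  \<open>word_stabilizer\<close> yields the norm. Conversely, a norm in \<open>X\<close> is realized
  by a tree with a single node whose leaves are the points of \<open>H/K\<close>.\<close>

lemma operad_norms_norm_trees:
  assumes X: "norm_system G X" and fin: "finite (carrier G)" and enc: "inj_on enc (\<Union>n. norm_trees G X n)"
  defines "R \<equiv> encode_operad enc (norm_trees G X) W"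
  shows "N_infinity_operad G R" "operad_norms G R = X"
proof -
  interpret S: suboperad G W "norm_trees G X" enc
    by (rule suboperad_norm_trees[OF X enc])
  have tree_act: "f (\<sigma> j) = word_act G g (f j)"
    if "f \<in> norm_trees G X n" "\<sigma> \<in> carrier (Sym n)" "oact W n (g, \<sigma>) f = f" "j < n" for f n \<sigma> g j
    using oact_word_eq_iff[OF subsetD[OF norm_trees_subset that(1)] that(2)] that(3,4) by blast
  show N: "N_infinity_operad G R"
    unfolding R_def
  proof (rule S.N_infinity_operad_R)
    fix n \<sigma> w assume \<sigma>: "\<sigma> \<in> carrier (Sym n)" and w: "w \<in> norm_trees G X n" and eq: "sact G W n \<sigma> w = w"
    show "\<sigma> = \<one>\<^bsub>Sym n\<^esub>"
    proof (rule Sym_eqI[OF \<sigma> monoid.one_closed[OF group.is_monoid[OF group_Sym]]])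
      fix j assume j: "j < n"
      have "w j \<in> words G"
        using w j by (auto simp: norm_trees_def norm_words_def)
      then have "w (\<sigma> j) = w j"
        using tree_act[OF w \<sigma> eq j] word_act_one by simp
      then have "\<sigma> j = j"
        using w j Sym_apply_less[OF \<sigma> j] diverge_neq unfolding norm_trees_def by blast
      then show "\<sigma> j = \<one>\<^bsub>Sym n\<^esub> j"
        using j by (simp add: one_Sym)
    qed
  next
    fix n :: nat
    \<comment> \<open>Empty sets are fixed by every translation and have equal stabilizers. Distinct
      labels make the leaves diverge.\<close>
    let ?w = "\<lambda>i \<in> {..<n}. [(i, {} :: 'a set, {} :: 'a set)]"
    have "[(i, {}, {})] \<in> norm_words G X" for i
      by (simp add: norm_words_def words_def)
    moreover have "diverge [(i, {}, {} :: 'a set)] [(j, {} :: 'a set, {})]" if "i \<noteq> j" for i j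
      using that unfolding diverge_def by (intro exI[of _ "[]"]) auto
    ultimately have w: "?w \<in> norm_trees G X n"
      by (auto simp: norm_trees_def)
    moreover have "gact W n g ?w = ?w" for g
      unfolding oact_word_eq_iff[OF subsetD[OF norm_trees_subset w] monoid.one_closed[OF group.is_monoid[OF group_Sym]]]
      by (simp add: one_Sym l_coset_def)
    ultimately show "\<exists>w \<in> norm_trees G X n. \<forall>g \<in> carrier G. gact W n g w = w"
      by blast
  qed
  interpret R: N_infinity_operad G R
    by (rule N)
  have "(K, H) \<in> X" if KH: "(K, H) \<in> operad_norms G R" for K H
  proof -
    have K: "subgroup K G" and H: "subgroup H G" and KsH: "K \<subset> H" and "admissible R H (coset_hset G H K)"
      using KH unfolding R.operad_norms_eq norm_symbols_def by blast+
    then obtain n e x where e: "bij_betw e {..<n} (fst (coset_hset G H K))" and x: "x \<in> ops R n"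
      and \<sigma>: "\<And>h. h \<in> H \<Longrightarrow> \<exists>\<sigma> \<in> carrier (Sym n).
        (\<forall>i<n. e (\<sigma> i) = snd (coset_hset G H K) h (e i)) \<and> oact R n (h, \<sigma>) x = x"
      unfolding admissible_def fixes_graph_def by blast
    have HG: "H \<subseteq> carrier G" and KG: "K \<subseteq> carrier G"
      using subgroup.subset[OF H] subgroup.subset[OF K] .
    obtain f where f: "f \<in> norm_trees G X n" "x = enc f"
      using x S.ops_R unfolding R_def by auto
    have "K \<in> fst (coset_hset G H K)"
      using subgroup.one_closed[OF H] KG lcos_mult_one[OF KG] by (metis fst_coset_hset imageI)
    then have "K \<in> e ` {..<n}"
      unfolding bij_betw_imp_surj_on[OF e] .
    then obtain i where i: "i < n" "e i = K"
      by auto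
    \<comment> \<open>Leaf \<open>i\<close> stands for the coset \<open>K\<close>, and
      \<open>h\<close> moves it to the leaf for \<open>hK\<close>, which is the same leaf exactly
      for \<open>h\<close> in \<open>K\<close>.\<close>
    have act: "\<exists>j<n. word_act G h (f i) = f j \<and> (j = i \<longleftrightarrow> h \<in> K)" if h: "h \<in> H" for h
    proof -
      obtain s where s: "s \<in> carrier (Sym n)" "\<And>i. i < n \<Longrightarrow> e (s i) = snd (coset_hset G H K) h (e i)"
          "oact R n (h, s) x = x"
        using \<sigma>[OF h] by blast
      have hG: "h \<in> carrier G"
        using h HG by blast
      have hs: "(h, s) \<in> carrier (G \<times>\<times> Sym n)"
        using hG s(1) by (simp add: DirProd_def)
      have "enc (oact W n (h, s) f) = enc f"
        using s(3) S.oact_R_enc[OF f(1)] f(2) unfolding R_def by simp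
      then have "oact W n (h, s) f = f"
        using S.dec_enc[OF f(1)] S.dec_enc[OF S.W_act[OF hs f(1)]] by metis
      then have "word_act G h (f i) = f (s i)"
        using tree_act[OF f(1) s(1) _ i(1)] by simp
      moreover have "e (s i) = h <# K"
        using s(2)[OF i(1)] i(2) snd_coset_hset[OF HG KG h subgroup.one_closed[OF H]] hG
        by (simp add: lcos_mult_one[OF KG])
      moreover have "h <# K = K \<longleftrightarrow> h \<in> K"
        using left_stabilizer_subgroup[OF K] hG by (auto simp: left_stabilizer_def)
      moreover have "e (s i) = e i \<longleftrightarrow> s i = i"
        using e Sym_apply_less[OF s(1) i(1)] i(1) by (auto simp: bij_betw_def inj_on_def)
      ultimately show ?thesis
        using Sym_apply_less[OF s(1) i(1)] i(2) by auto
    qed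
    have dv: "diverge (f i) (f j)" if "j < n" "j \<noteq> i" for j
      using f(1) i(1) that by (simp add: norm_trees_def)
    have "{h \<in> H. word_act G h (f i) = f i} = K"
    proof (intro subset_antisym subsetI)
      fix h assume "h \<in> {h \<in> H. word_act G h (f i) = f i}"
      then show "h \<in> K"
        using act[of h] dv diverge_neq by force
    next
      fix h assume "h \<in> K"
      then show "h \<in> {h \<in> H. word_act G h (f i) = f i}"
        using act[of h] KsH by auto
    qed
    moreover have "f i \<in> norm_words G X"
      using f(1) i(1) by (auto simp: norm_trees_def)
    moreover have "word_act G h (f i) = f i \<or> diverge (f i) (word_act G h (f i))" if "h \<in> H" for h
      using act[OF that] dv by metis
    ultimately have "K = H \<or> (K, H) \<in> X"
      using word_stabilizer[OF X H, of "f i"] by simp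
    then show ?thesis
      using KsH by blast
  qed
  moreover have "(K, H) \<in> operad_norms G R" if KH: "(K, H) \<in> X" for K H
  proof -
    have K: "subgroup K G" and H: "subgroup H G" and KsH: "K \<subset> H"
      using norm_system_symbols[OF X KH] by auto
    have HG: "H \<subseteq> carrier G" and KG: "K \<subseteq> carrier G"
      using subgroup.subset[OF H] subgroup.subset[OF K] .
    let ?T = "coset_hset G H K"
    have "finite (fst ?T)"
      using finite_subset[OF HG fin] by simp
    then obtain n :: nat and e where e: "bij_betw e {..<n} (fst ?T)"
      using ex_bij_betw_nat_finite[of "fst ?T"] unfolding atLeast0LessThan by blast
    \<comment> \<open>One node with stabilizer \<open>H\<close>, whose outgoing edges are the cosets
      themselves. All labels can be 0, since the cosets are already distinct.\<close>
    define w where "w = (\<lambda>i \<in> {..<n}. [(0 :: nat, H, e i)])"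
    have eT: "\<exists>h \<in> H. e i = h <# K" if "i < n" for i
      using bij_betwE[OF e] that by auto
    have "[(0, H, e i)] \<in> norm_words G X" if i: "i < n" for i
    proof -
      obtain h where h: "h \<in> H" "e i = h <# K"
        using eT[OF i] by blast
      have hG: "h \<in> carrier G"
        using h HG by blast
      \<comment> \<open>The stabilizer of \<open>hK\<close> is the conjugate of \<open>K\<close> by
        \<open>h\<close>. As \<open>h\<close> lies in \<open>H\<close>, the norm for this letter is
        the conjugate of \<open>(K, H)\<close> by \<open>h\<close>, with \<open>H\<close>
        unchanged.\<close>
      have "(left_stabilizer G (e i), left_stabilizer G H) \<in> X"
        using norm_system_conj[OF X KH hG] left_stabilizer_lcoset[OF hG KG]
          left_stabilizer_subgroup[OF K] left_stabilizer_subgroup[OF H] conj_subset_self[OF H h(1)] h(2) by simp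
      then show ?thesis
        using HG l_coset_subset_G[OF KG hG] h(2) by (simp add: norm_words_def words_def)
    qed
    moreover have "diverge [(0, H, e i)] [(0, H, e j)]" if "i < n" "j < n" "i \<noteq> j" for i j
    proof -
      have "e i \<noteq> e j"
        using e that by (auto simp: bij_betw_def inj_on_def)
      then show ?thesis
        unfolding diverge_def by (intro exI[of _ "[]"]) auto
    qed
    ultimately have w: "w \<in> norm_trees G X n"
      by (auto simp: norm_trees_def w_def)
    have "\<exists>\<sigma> \<in> carrier (Sym n). (\<forall>i<n. e (\<sigma> i) = snd ?T h (e i)) \<and> oact R n (h, \<sigma>) (enc w) = enc w"
      if h: "h \<in> H" for h
    proof -
      have hG: "h \<in> carrier G"
        using h HG by blast
      have act: "snd ?T h (e i) = h <# e i" "h <# e i \<in> fst ?T" if "i < n" for i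
      proof -
        obtain k where k: "k \<in> H" "e i = k <# K"
          using eT[OF \<open>i < n\<close>] by blast
        have "h <# (k <# K) = (h \<otimes> k) <# K"
          using lcos_m_assoc[OF KG hG] k(1) HG by blast
        then show "snd ?T h (e i) = h <# e i" "h <# e i \<in> fst ?T"
          using snd_coset_hset[OF HG KG h k(1)] k subgroup.m_closed[OF H h k(1)] by auto
      qed
      \<comment> \<open>The permutation that \<open>h\<close> induces on the cosets, read in the
        ordering \<open>e\<close>.\<close>
      define s where "s = (\<lambda>i \<in> {..<n}. inv_into {..<n} e (h <# e i))"
      have s: "s i < n" "e (s i) = h <# e i" if "i < n" for i
      proof -
        have "h <# e i \<in> e ` {..<n}"
          using act(2)[OF that] e by (simp add: bij_betw_def)
        then show "s i < n" "e (s i) = h <# e i"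
          using that inv_into_into[of "h <# e i" e "{..<n}"] by (auto simp: s_def f_inv_into_f)
      qed
      have sS: "s \<in> carrier (Sym n)"
      proof (rule SymI)
        show "s \<in> extensional {..<n}"
          by (simp add: s_def)
        fix i j assume ij: "i < n" "j < n" "s i = s j"
        have sub: "e l \<subseteq> carrier G" if l: "l < n" for l
        proof -
          obtain k where "k \<in> carrier G" "e l = k <# K"
            using eT[OF l] HG by blast
          then show ?thesis
            using l_coset_subset_G[OF KG] by simp
        qed
        have "h <# e i = h <# e j"
          using s(2)[OF ij(1)] s(2)[OF ij(2)] ij(3) by simp
        then have "e i = e j"
          by (rule lcoset_inj[OF hG sub[OF ij(1)] sub[OF ij(2)]])
        then show "i = j"
          using e ij by (auto simp: bij_betw_def inj_on_def)
      qed (rule s)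
      have "h <# H = H"
        using left_stabilizer_subgroup[OF H] h by (auto simp: left_stabilizer_def)
      then have "oact W n (h, s) w = w"
        unfolding oact_word_eq_iff[OF subsetD[OF norm_trees_subset w] sS] using s by (simp add: w_def)
      then show ?thesis
        using sS s act(1) S.oact_R_enc[OF w, of "(h, s)"] unfolding R_def by (intro bexI[of _ s]) auto
    qed
    moreover have "enc w \<in> ops R n"
      using w S.ops_R unfolding R_def by simp
    ultimately have "fixes_graph R H ?T n e (enc w)"
      using e unfolding fixes_graph_def by blast
    then show ?thesis
      unfolding R.operad_norms_eq norm_symbols_def admissible_def using K H KsH by blast
  qed
  ultimately show "operad_norms G R = X"
    by (intro subset_antisym subrelI)
qed

text \<open>A finite group has finitely many subsets, so there are countably many letters, words and
  finite families of words.\<close>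

lemma countable_norm_trees:
  assumes "finite (carrier G)"
  shows "countable (\<Union>n. norm_trees G X n)"
proof -
  have "words G \<subseteq> lists (UNIV \<times> Pow (carrier G) \<times> Pow (carrier G))"
    by (auto simp: words_def)
  moreover have "countable (lists ((UNIV :: nat set) \<times> Pow (carrier G) \<times> Pow (carrier G)))"
    using assms by (intro countable_lists countable_SIGMA countableI_type countable_finite) auto
  ultimately have "countable (words G)"
    by (rule countable_subset)
  then have "countable (ops W n)" for n
    unfolding ops_word by (intro countable_PiE) auto
  then show ?thesis
    by (intro countable_UN countable_subset[OF norm_trees_subset]) auto
qed

end

section \<open>Homotopy classes\<close>

lemma homotopy_iso_norms:
  assumes "(P, Q) \<in> homotopy_iso G"
  shows "operad_norms G P = operad_norms G Q"
proof -
  have "operad_indexing_system G P = operad_indexing_system G Q"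
    by (rule ext) (simp only: operad_indexing_system_def homotopy_iso_family[OF assms])
  then show ?thesis
    by (simp add: operad_norms_def)
qed

text \<open>The classes are the fibres of \<open>operad_norms\<close>: isomorphic operads have the
  same families, and operads with the same norms are isomorphic.\<close>

lemma homotopy_class_eq:
  fixes P :: "('g, 'a) operad_data"
  assumes "inj (enc :: 'a \<times> 'a \<Rightarrow> 'a)" "N_infinity_operad G P"
  shows "homotopy_iso G `` {P} = {Q. N_infinity_operad G Q \<and> operad_norms G Q = operad_norms G P}"
proof (intro subset_antisym subsetI)
  fix Q assume "Q \<in> homotopy_iso G `` {P}"
  then have PQ: "(P, Q) \<in> homotopy_iso G"
    by simp
  show "Q \<in> {Q. N_infinity_operad G Q \<and> operad_norms G Q = operad_norms G P}"
    using homotopy_iso_N_infinity[OF PQ] homotopy_iso_norms[OF PQ] by simp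
next
  fix Q :: "('g, 'a) operad_data"
  assume "Q \<in> {Q. N_infinity_operad G Q \<and> operad_norms G Q = operad_norms G P}"
  then have "(P, Q) \<in> homotopy_iso G"
    using homotopy_iso_of_norms[OF assms(2) _ _ assms(1)] by simp
  then show "Q \<in> homotopy_iso G `` {P}"
    by simp
qed

text \<open>A spanning subgraph has the vertices, tails and heads of the ambient graph, so its arcs
  determine it.\<close>

lemma bij_betw_norm_digraph:
  assumes "group G"
  shows "bij_betw (norm_digraph G) {X. norm_system G X}
    {D. spanning D (subgroup_lattice_digraph G) \<and> norm_system G (arcs D)}"
proof (rule bij_betw_byWitness[where f' = arcs])
  have sub: "X \<subseteq> norm_symbols G" if "norm_system G X" for X
    using that by (simp add: norm_system_def)
  have wf: "wf_digraph (norm_digraph G X)" if "X \<subseteq> norm_symbols G" for X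
  proof
    fix e assume "e \<in> arcs (norm_digraph G X)"
    then have "e \<in> norm_symbols G"
      using that by (auto simp: norm_digraph_def)
    then show "tail (norm_digraph G X) e \<in> verts (norm_digraph G X)"
      "head (norm_digraph G X) e \<in> verts (norm_digraph G X)"
      by (auto simp: norm_digraph_def norm_symbols_def)
  qed
  show "\<forall>X \<in> {X. norm_system G X}. arcs (norm_digraph G X) = X"
    by (simp add: norm_digraph_def)
  show "\<forall>D \<in> {D. spanning D (subgroup_lattice_digraph G) \<and> norm_system G (arcs D)}. norm_digraph G (arcs D) = D"
    by (auto simp: spanning_def subgraph_def compatible_def subgroup_lattice_digraph_def norm_digraph_def)
  have "spanning (norm_digraph G X) (subgroup_lattice_digraph G)" if "norm_system G X" for X
    using wf[OF sub[OF that]] wf[OF subset_refl] sub[OF that]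
    by (simp add: spanning_def subgraph_def compatible_def subgroup_lattice_digraph_def, simp add: norm_digraph_def)
  then show "norm_digraph G ` {X. norm_system G X} \<subseteq>
      {D. spanning D (subgroup_lattice_digraph G) \<and> norm_system G (arcs D)}"
    by (auto simp: norm_digraph_def)
qed auto

lemma ex_pairing_function:
  assumes "infinite (UNIV :: 'a set)"
  obtains f :: "'a \<times> 'a \<Rightarrow> 'a" where "inj f"
proof -
  obtain f where "bij_betw f ((UNIV :: 'a set) \<times> (UNIV :: 'a set)) (UNIV :: 'a set)"
    using card_of_ordIso[THEN iffD2, OF card_of_Times_same_infinite[OF assms]] by blast
  then show thesis
    using that by (auto simp: bij_betw_def)
qed

lemma ex_inj_on_countable:
  assumes "infinite (UNIV :: 'a set)" "countable A"
  obtains f :: "'b \<Rightarrow> 'a" where "inj_on f A"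
proof -
  obtain e :: "nat \<Rightarrow> 'a" where "inj e"
    using infinite_countable_subset[OF assms(1)] by blast
  then have "inj_on (e \<circ> to_nat_on A) A"
    using inj_on_to_nat_on[OF assms(2)] by (intro comp_inj_on) (auto intro: inj_on_subset)
  then show thesis
    by (rule that)
qed

theorem corollary8:
  fixes G :: "('g, 'm) monoid_scheme"
  assumes "group G" and "finite (carrier G)"
    and "(UNIV :: real set) \<lesssim> (UNIV :: 'a set)"
  shows "(\<forall>P :: ('g, 'a) operad_data.
            N_infinity_operad G P \<longrightarrow> indexing_system G (operad_indexing_system G P)) \<and>
         operad_norms G respects (homotopy_iso G :: ('g, 'a) operad_data rel) \<and>
         bij_betw (\<lambda>c. \<Union>P \<in> c. operad_norms G P)
           (homotopy_classes G :: ('g, 'a) operad_data set set)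
           {X. norm_system G X} \<and>
         bij_betw (\<lambda>c. norm_digraph G (\<Union>P \<in> c. operad_norms G P))
           (homotopy_classes G :: ('g, 'a) operad_data set set)
           {D. spanning D (subgroup_lattice_digraph G) \<and> norm_system G (arcs D)}"
proof -
  interpret group G
    by (rule assms)
  let ?N = "\<lambda>c :: ('g, 'a) operad_data set. \<Union>P \<in> c. operad_norms G P"
  \<comment> \<open>An infinite type has a pairing function for products and room for the countably
    many trees.\<close>
  have inf: "infinite (UNIV :: 'a set)"
    using assms(3) infinite_UNIV_char_0[where 'a = real] unfolding lepoll_def
    by (metis finite_imageD finite_subset)
  obtain pair :: "'a \<times> 'a \<Rightarrow> 'a" where pair: "inj pair"
    using ex_pairing_function[OF inf] .
  note cls = homotopy_class_eq[OF pair]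
  \<comment> \<open>All members of a class have the same norms, so the union over the class is their
    common value.\<close>
  have N: "?N (homotopy_iso G `` {P}) = operad_norms G P" if "N_infinity_operad G P" for P :: "('g, 'a) operad_data"
    unfolding cls[OF that] using that by blast
  have bij: "bij_betw ?N (homotopy_classes G) {X. norm_system G X}"
    unfolding bij_betw_def
  proof (intro conjI inj_onI)
    fix c c' :: "('g, 'a) operad_data set"
    assume c: "c \<in> homotopy_classes G" and c': "c' \<in> homotopy_classes G" and eq: "?N c = ?N c'"
    obtain P where P: "N_infinity_operad G P" "c = homotopy_iso G `` {P}"
      using c by (auto simp: homotopy_classes_def elim: quotientE)
    obtain P' where P': "N_infinity_operad G P'" "c' = homotopy_iso G `` {P'}"
      using c' by (auto simp: homotopy_classes_def elim: quotientE)
    have "operad_norms G P = operad_norms G P'"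
      using eq N P P' by simp
    then show "c = c'"
      unfolding P(2) P'(2) cls[OF P(1)] cls[OF P'(1)] by simp
  next
    show "?N ` homotopy_classes G = {X. norm_system G X}"
    proof (intro subset_antisym subsetI)
      fix X assume "X \<in> ?N ` homotopy_classes G"
      then obtain P :: "('g, 'a) operad_data" where P: "N_infinity_operad G P" "X = ?N (homotopy_iso G `` {P})"
        by (auto simp: homotopy_classes_def elim: quotientE)
      then show "X \<in> {X. norm_system G X}"
        using N[OF P(1)] N_infinity_operad.norm_system_operad_norms[OF P(1)] by simp
    next
      fix X assume "X \<in> {X. norm_system G X}"
      then have X: "norm_system G X"
        by simp
      obtain enc :: "(nat \<Rightarrow> 'g letter list) \<Rightarrow> 'a" where enc: "inj_on enc (\<Union>n. norm_trees G X n)"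
        using ex_inj_on_countable[OF inf countable_norm_trees[OF assms(2)]] .
      note R = operad_norms_norm_trees[OF X assms(2) enc]
      have "homotopy_iso G `` {encode_operad enc (norm_trees G X) W} \<in> homotopy_classes G"
        unfolding homotopy_classes_def using R(1) by (intro quotientI) simp
      then show "X \<in> ?N ` homotopy_classes G"
        using N[OF R(1)] R(2) by (metis imageI)
    qed
  qed
  have "indexing_system G (operad_indexing_system G P)" if "N_infinity_operad G P" for P :: "('g, 'a) operad_data"
    by (rule N_infinity_operad.indexing_system_operad[OF that])
  moreover have "operad_norms G respects (homotopy_iso G :: ('g, 'a) operad_data rel)"
    unfolding congruent_def using homotopy_iso_norms by blast
  moreover have "bij_betw (\<lambda>c. norm_digraph G (?N c)) (homotopy_classes G)
      {D. spanning D (subgroup_lattice_digraph G) \<and> norm_system G (arcs D)}"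
    using bij_betw_trans[OF bij bij_betw_norm_digraph[OF assms(1)]] by (simp add: comp_def)
  ultimately show ?thesis
    using bij by blast
qed

end
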